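(* Let $G$ be a second-countable ample Hausdorff groupoid. Suppose that $G$ is minimal and effective. Then the algebra $B(G)=\{1_U x 1_U : x\in C^*_r(G),\ U\subseteq G^{(0)}\text{ compact open}\}$ is algebraically properly infinite if and only if $C^*_r(G)$ is $C^*$-purely infinite simple.
   Context: **Groupoids.** A topological groupoid $G$ has unit space $G^{(0)}$ and range and source maps $r,s:G\to G^{(0)}$. An open bisection is an open set $B\subseteq G$ such that $r$ and $s$ restrict to homeomorphisms of $B$ onto open subsets of $G^{(0)}$. $G$ is ample if it has a basis of compact open bisections. A subset $U\subseteq G^{(0)}$ is invariant if $s(\gamma)\in U\iff r(\gamma)\in U$ for all $\gamma\in G$; $G$ is minimal if the only open invariant subsets of $G^{(0)}$ are $\emptyset$ and $G^{(0)}$. $G$ is effective if for every nonempty compact open bisection $B\subseteq G\setminus G^{(0)}$ there is $\gamma\in B$ with $s(\gamma)\ne r(\gamma)$. **Reduced $C^*$-algebra.** $C_c(G)$ is the $*$-algebra of continuous compactly supported functions $G\to\mathbb{C}$ with $(f*g)(\gamma)=\sum_{\alpha\beta=\gamma}f(\alpha)g(\beta)$ and $f^*(\gamma)=\overline{f(\gamma^{-1})}$. For $u\in G^{(0)}$ let $G_u=s^{-1}(u)$ and let $R_u:C_c(G)\to\mathcal{B}(\ell^2(G_u))$ be $R_u(f)\delta_\gamma=\sum_{s(\alpha)=r(\gamma)}f(\alpha)\delta_{\alpha\gamma}$. $C^*_r(G)$ is the completion of the image of $C_c(G)$ under $\bigoplus_u R_u$. For compact open $U\subseteq G^{(0)}$,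 $1_U\in C_c(G)\subseteq C^*_r(G)$ is its characteristic function. $B(G)$ is a subalgebra of $C^*_r(G)$. **Algebraic definitions.** For a ring $R$, $x\in M_k(R)$, $y\in M_n(R)$, write $x\precsim_{\mathrm{ring}}y$ if there are $\alpha\in M_{kn}(R)$ ($k\times n$) and $\beta\in M_{nk}(R)$ with $x=\alpha y\beta$; $a\oplus b$ is the block-diagonal matrix. An element $a\in R$ is algebraically properly infinite if $a\neq0$ and $a\oplus a\precsim_{\mathrm{ring}}a$. The ring $R$ is algebraically properly infinite if every nonzero element of $R$ is algebraically properly infinite. **$C^*$-algebraic definitions.** For projections $p,q$ in a $C^*$-algebra $A$: $p\sim_{C^*}q$ if $tt^*=p$, $t^*t=q$ for some $t\in A$; $q<_{C^*}p$ if $p-q\in A^+$ and $p\ne q$. A projection $p$ is infinite if there is a projection $q$ with $p\sim_{C^*}q<_{C^*}p$. A $C^*$-subalgebra $D\subseteq A$ is hereditary if $0\le a\le b$, $b\in D$, $a\in A$ imply $a\in D$. $A$ is $C^*$-purely infinite simple if $A$ is simple (no nontrivial closed two-sided ideals) and every nonzero hereditary $C^*$-subalgebra contains an infinite projection. *)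

theory Defs
  imports "HOL-Analysis.Analysis" "Jordan_Normal_Form.Matrix"
begin

section \<open>The Hilbert space of square-summable functions and its bounded operators\<close>

typedef 'i ell2 = "{x :: 'i \<Rightarrow> complex. (\<lambda>i. (cmod (x i))\<^sup>2) summable_on UNIV}"
  by (rule exI[of _ "\<lambda>_. 0"]) simp

setup_lifting type_definition_ell2

lemma square_summable_iff:
  fixes x :: "'i \<Rightarrow> complex"
  shows "(\<lambda>i. (cmod (x i))\<^sup>2) summable_on UNIV \<longleftrightarrow> (\<lambda>i. cmod (x i * x i)) summable_on UNIV"
  by (simp add: norm_mult power2_eq_square)

lemma square_summable_mult:
  fixes x y :: "'i \<Rightarrow> complex"
  assumes "(\<lambda>i. (cmod (x i))\<^sup>2) summable_on UNIV" "(\<lambda>i. (cmod (y i))\<^sup>2) summable_on UNIV"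
  shows "(\<lambda>i. cmod (x i) * cmod (y i)) summable_on UNIV"
  using abs_summable_product[of x UNIV y] assms by (simp add: square_summable_iff norm_mult)

lemma square_summable_add:
  fixes x y :: "'i \<Rightarrow> complex"
  assumes "(\<lambda>i. (cmod (x i))\<^sup>2) summable_on UNIV" "(\<lambda>i. (cmod (y i))\<^sup>2) summable_on UNIV"
  shows "(\<lambda>i. (cmod (x i + y i))\<^sup>2) summable_on UNIV"
proof (rule summable_on_comparison_test)
  show "(\<lambda>i. (cmod (x i))\<^sup>2 + (cmod (y i))\<^sup>2 + 2 * (cmod (x i) * cmod (y i))) summable_on UNIV"
    using assms square_summable_mult[OF assms]
    by (intro summable_on_add summable_on_cmult_right)
next
  fix i
  have "(cmod (x i + y i))\<^sup>2 \<le> (cmod (x i) + cmod (y i))\<^sup>2"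
    by (intro power_mono norm_triangle_ineq) auto
  then show "(cmod (x i + y i))\<^sup>2 \<le> (cmod (x i))\<^sup>2 + (cmod (y i))\<^sup>2 + 2 * (cmod (x i) * cmod (y i))"
    by (simp add: power2_sum)
qed auto

lemma square_summable_cmult:
  fixes x :: "'i \<Rightarrow> complex"
  assumes "(\<lambda>i. (cmod (x i))\<^sup>2) summable_on UNIV"
  shows "(\<lambda>i. (cmod (c * x i))\<^sup>2) summable_on UNIV"
  using assms by (simp add: norm_mult power_mult_distrib summable_on_cmult_right)

lemma square_summable_inner:
  fixes x y :: "'i \<Rightarrow> complex"
  assumes "(\<lambda>i. (cmod (x i))\<^sup>2) summable_on UNIV" "(\<lambda>i. (cmod (y i))\<^sup>2) summable_on UNIV"
  shows "(\<lambda>i. inner (x i) (y i)) summable_on UNIV"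
proof (rule abs_summable_summable, rule summable_on_comparison_test)
  show "(\<lambda>i. cmod (x i) * cmod (y i)) summable_on UNIV"
    using square_summable_mult[OF assms] .
qed (auto intro: Cauchy_Schwarz_ineq2)

instantiation ell2 :: (type) real_inner
begin

lift_definition zero_ell2 :: "'a ell2" is "\<lambda>_. 0" by simp

lift_definition plus_ell2 :: "'a ell2 \<Rightarrow> 'a ell2 \<Rightarrow> 'a ell2" is "\<lambda>x y i. x i + y i"
  by (rule square_summable_add)

lift_definition uminus_ell2 :: "'a ell2 \<Rightarrow> 'a ell2" is "\<lambda>x i. - x i" by simp

lift_definition minus_ell2 :: "'a ell2 \<Rightarrow> 'a ell2 \<Rightarrow> 'a ell2" is "\<lambda>x y i. x i - y i"
proof -
  fix x y :: "'a \<Rightarrow> complex"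
  assume "(\<lambda>i. (cmod (x i))\<^sup>2) summable_on UNIV" "(\<lambda>i. (cmod (y i))\<^sup>2) summable_on UNIV"
  then show "(\<lambda>i. (cmod (x i - y i))\<^sup>2) summable_on UNIV"
    using square_summable_add[of x "\<lambda>i. - y i"] by simp
qed

lift_definition scaleR_ell2 :: "real \<Rightarrow> 'a ell2 \<Rightarrow> 'a ell2" is "\<lambda>c x i. complex_of_real c * x i"
  by (rule square_summable_cmult)

text \<open>The real inner product is the real part of the complex one (\<open>cinner\<close> below).\<close>

lift_definition inner_ell2 :: "'a ell2 \<Rightarrow> 'a ell2 \<Rightarrow> real"
  is "\<lambda>x y. \<Sum>\<^sub>\<infinity>i. inner (x i) (y i)" .

definition norm_ell2 :: "'a ell2 \<Rightarrow> real" where "norm_ell2 x = sqrt (inner x x)"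
definition sgn_ell2 :: "'a ell2 \<Rightarrow> 'a ell2" where "sgn_ell2 x = inverse (norm x) *\<^sub>R x"
definition dist_ell2 :: "'a ell2 \<Rightarrow> 'a ell2 \<Rightarrow> real" where "dist_ell2 x y = norm (x - y)"
definition uniformity_ell2 :: "('a ell2 \<times> 'a ell2) filter"
  where "uniformity_ell2 = (INF e\<in>{0 <..}. principal {(x, y). dist x y < e})"
definition open_ell2 :: "'a ell2 set \<Rightarrow> bool"
  where "open_ell2 U = (\<forall>x\<in>U. eventually (\<lambda>(x', y). x' = x \<longrightarrow> y \<in> U) uniformity)"

instance
proof
  fix x y z :: "'a ell2" and a b :: real and U :: "'a ell2 set"
  show "x + y + z = x + (y + z)" by transfer (simp add: add.assoc)
  show "x + y = y + x" by transfer (simp add: add.commute)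
  show "0 + x = x" by transfer simp
  show "- x + x = 0" by transfer simp
  show "x - y = x + - y" by transfer simp
  show "a *\<^sub>R (x + y) = a *\<^sub>R x + a *\<^sub>R y" by transfer (simp add: algebra_simps)
  show "(a + b) *\<^sub>R x = a *\<^sub>R x + b *\<^sub>R x" by transfer (simp add: algebra_simps)
  show "a *\<^sub>R b *\<^sub>R x = (a * b) *\<^sub>R x" by transfer (simp add: algebra_simps)
  show "1 *\<^sub>R x = x" by transfer simp
  show "dist x y = norm (x - y)" by (rule dist_ell2_def)
  show "sgn x = inverse (norm x) *\<^sub>R x" by (simp add: sgn_ell2_def)
  show "uniformity = (INF e\<in>{0 <..}. principal {(x :: 'a ell2, y). dist x y < e})"
    by (rule uniformity_ell2_def)
  show "open U = (\<forall>x\<in>U. eventually (\<lambda>(x', y). x' = x \<longrightarrow> y \<in> U) uniformity)"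
    by (rule open_ell2_def)
  show "inner x y = inner y x" by transfer (simp add: inner_commute)
  show "inner (x + y) z = inner x z + inner y z"
    by transfer (simp add: inner_add_left infsum_add square_summable_inner)
  show "inner (a *\<^sub>R x) y = a * inner x y"
  proof (transfer fixing: a)
    fix x y :: "'a \<Rightarrow> complex"
    have "inner (complex_of_real a * x i) (y i) = a * inner (x i) (y i)" for i
      by (metis inner_scaleR_left scaleR_conv_of_real)
    then show "(\<Sum>\<^sub>\<infinity>i. inner (complex_of_real a * x i) (y i)) = a * (\<Sum>\<^sub>\<infinity>i. inner (x i) (y i))"
      by (simp add: infsum_cmult_right')
  qed
  show "0 \<le> inner x x" by transfer (simp add: infsum_nonneg)
  show "inner x x = 0 \<longleftrightarrow> x = 0"
  proof transfer
    fix x :: "'a \<Rightarrow> complex"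
    assume x: "(\<lambda>i. (cmod (x i))\<^sup>2) summable_on UNIV"
    show "(\<Sum>\<^sub>\<infinity>i. inner (x i) (x i)) = 0 \<longleftrightarrow> x = (\<lambda>_. 0)"
    proof
      assume 0: "(\<Sum>\<^sub>\<infinity>i. inner (x i) (x i)) = 0"
      have "inner (x i) (x i) = 0" for i
        by (rule nonneg_infsum_le_0D[of _ UNIV])
          (use 0 square_summable_inner[OF x x] in \<open>auto simp: 0\<close>)
      then show "x = (\<lambda>_. 0)" by auto
    qed simp
  qed
  show "norm x = sqrt (inner x x)" by (rule norm_ell2_def)
qed

end

lift_definition scaleC :: "complex \<Rightarrow> 'i ell2 \<Rightarrow> 'i ell2"  (infixr \<open>*\<^sub>C\<close> 75)
  is "\<lambda>c x i. c * x i"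
  by (rule square_summable_cmult)

lift_definition cinner :: "'i ell2 \<Rightarrow> 'i ell2 \<Rightarrow> complex" is "\<lambda>x y. \<Sum>\<^sub>\<infinity>i. x i * cnj (y i)" .

lift_definition delta :: "'i \<Rightarrow> 'i ell2" is "\<lambda>i j. if j = i then 1 else 0"
proof -
  fix i :: 'i
  have "(\<lambda>j. (cmod (if j = i then 1 else 0))\<^sup>2) summable_on {i}" by simp
  then show "(\<lambda>j. (cmod (if j = i then 1 else 0))\<^sup>2) summable_on UNIV"
    by (rule summable_on_cong_neutral[THEN iffD1, rotated -1]) auto
qed

lemma scaleC_add_right: "c *\<^sub>C (x + y) = c *\<^sub>C x + c *\<^sub>C y"
  by transfer (simp add: algebra_simps)

lemma scaleC_scaleR: "c *\<^sub>C (r *\<^sub>R x) = r *\<^sub>R (c *\<^sub>C x)"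
  by transfer (simp add: algebra_simps)

lemma scaleC_minus_right: "c *\<^sub>C (- x) = - (c *\<^sub>C x)"
  by transfer simp

lemma scaleC_diff_right: "c *\<^sub>C (x - y) = c *\<^sub>C x - c *\<^sub>C y"
  by transfer (simp add: algebra_simps)

lemma scaleC_zero_right: "c *\<^sub>C (0 :: 'i ell2) = 0"
  by transfer simp

lemma scaleC_scaleC: "c *\<^sub>C (d *\<^sub>C x) = (c * d) *\<^sub>C x"
  by transfer (simp add: algebra_simps)

lemma norm_scaleC: "norm (c *\<^sub>C x) = cmod c * norm x"
proof -
  have "inner (c *\<^sub>C x) (c *\<^sub>C x) = (cmod c)\<^sup>2 * inner x x"
    by transfer (simp add: dot_square_norm norm_mult power_mult_distrib infsum_cmult_right')
  then show ?thesis by (simp add: norm_ell2_def real_sqrt_mult)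
qed

lemma delta_nonzero: "delta i \<noteq> 0"
proof transfer
  fix i :: 'i
  show "(\<lambda>j. if j = i then 1 else 0 :: complex) \<noteq> (\<lambda>_. 0)"
    by (auto simp: fun_eq_iff)
qed

lemma bounded_linear_scaleC: "bounded_linear (scaleC c)"
  by (rule bounded_linear_intro[where K = "cmod c"])
    (simp_all add: scaleC_add_right scaleC_scaleR norm_scaleC)

lifting_forget ell2.lifting

text \<open>The bounded complex-linear operators on \<open>\<ell>\<^sup>2('i)\<close>, with the operator norm.\<close>

typedef 'i ell2_op = "{T :: 'i ell2 \<Rightarrow>\<^sub>L 'i ell2. \<forall>c x. blinfun_apply T (c *\<^sub>C x) = c *\<^sub>C blinfun_apply T x}"
  by (rule exI[of _ 0]) (simp add: scaleC_zero_right)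

setup_lifting type_definition_ell2_op

lift_definition op_apply :: "'i ell2_op \<Rightarrow> 'i ell2 \<Rightarrow> 'i ell2" is blinfun_apply .

instantiation ell2_op :: (type) real_normed_algebra_1
begin

lift_definition zero_ell2_op :: "'a ell2_op" is 0
  by (simp add: scaleC_zero_right)
lift_definition one_ell2_op :: "'a ell2_op" is id_blinfun by simp
lift_definition plus_ell2_op :: "'a ell2_op \<Rightarrow> 'a ell2_op \<Rightarrow> 'a ell2_op" is "(+)"
  by (simp add: blinfun.add_left scaleC_add_right)
lift_definition uminus_ell2_op :: "'a ell2_op \<Rightarrow> 'a ell2_op" is uminus
  by (simp add: blinfun.minus_left scaleC_minus_right)
lift_definition minus_ell2_op :: "'a ell2_op \<Rightarrow> 'a ell2_op \<Rightarrow> 'a ell2_op" is "(-)"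
  by (simp add: blinfun.diff_left scaleC_diff_right)
lift_definition times_ell2_op :: "'a ell2_op \<Rightarrow> 'a ell2_op \<Rightarrow> 'a ell2_op" is "(o\<^sub>L)" by simp
lift_definition scaleR_ell2_op :: "real \<Rightarrow> 'a ell2_op \<Rightarrow> 'a ell2_op" is scaleR
  by (simp add: blinfun.scaleR_left scaleC_scaleR)
lift_definition norm_ell2_op :: "'a ell2_op \<Rightarrow> real" is norm .

definition sgn_ell2_op :: "'a ell2_op \<Rightarrow> 'a ell2_op" where "sgn_ell2_op x = inverse (norm x) *\<^sub>R x"
definition dist_ell2_op :: "'a ell2_op \<Rightarrow> 'a ell2_op \<Rightarrow> real" where "dist_ell2_op x y = norm (x - y)"
definition uniformity_ell2_op :: "('a ell2_op \<times> 'a ell2_op) filter"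
  where "uniformity_ell2_op = (INF e\<in>{0 <..}. principal {(x, y). dist x y < e})"
definition open_ell2_op :: "'a ell2_op set \<Rightarrow> bool"
  where "open_ell2_op U = (\<forall>x\<in>U. eventually (\<lambda>(x', y). x' = x \<longrightarrow> y \<in> U) uniformity)"

instance
proof
  fix x y z :: "'a ell2_op" and a b :: real and U :: "'a ell2_op set"
  show "x + y + z = x + (y + z)" by transfer (simp add: add.assoc)
  show "x + y = y + x" by transfer (simp add: add.commute)
  show "0 + x = x" by transfer simp
  show "- x + x = 0" by transfer simp
  show "x - y = x + - y" by transfer simp
  show "a *\<^sub>R (x + y) = a *\<^sub>R x + a *\<^sub>R y" by transfer (simp add: algebra_simps)
  show "(a + b) *\<^sub>R x = a *\<^sub>R x + b *\<^sub>R x" by transfer (simp add: algebra_simps)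
  show "a *\<^sub>R b *\<^sub>R x = (a * b) *\<^sub>R x" by transfer simp
  show "1 *\<^sub>R x = x" by transfer simp
  show "dist x y = norm (x - y)" by (rule dist_ell2_op_def)
  show "sgn x = inverse (norm x) *\<^sub>R x" by (simp add: sgn_ell2_op_def)
  show "uniformity = (INF e\<in>{0 <..}. principal {(x :: 'a ell2_op, y). dist x y < e})"
    by (rule uniformity_ell2_op_def)
  show "open U = (\<forall>x\<in>U. eventually (\<lambda>(x', y). x' = x \<longrightarrow> y \<in> U) uniformity)"
    by (rule open_ell2_op_def)
  show "norm x = 0 \<longleftrightarrow> x = 0" by transfer simp
  show "norm (x + y) \<le> norm x + norm y" by transfer (rule norm_triangle_ineq)
  show "norm (a *\<^sub>R x) = \<bar>a\<bar> * norm x" by transfer simp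
  show "x * y * z = x * (y * z)" by transfer (rule blinfun_eqI, simp)
  show "1 * x = x" by transfer (rule blinfun_eqI, simp)
  show "x * 1 = x" by transfer (rule blinfun_eqI, simp)
  show "(x + y) * z = x * z + y * z" by transfer (rule blinfun_eqI, simp add: blinfun.add_left)
  show "x * (y + z) = x * y + x * z"
    by transfer (rule blinfun_eqI, simp add: blinfun.add_left blinfun.add_right)
  show "a *\<^sub>R x * y = a *\<^sub>R (x * y)" by transfer (rule blinfun_eqI, simp add: blinfun.scaleR_left)
  show "x * a *\<^sub>R y = a *\<^sub>R (x * y)"
    by transfer (rule blinfun_eqI, simp add: blinfun.scaleR_left blinfun.scaleR_right)
  show "norm (x * y) \<le> norm x * norm y" by transfer (rule norm_blinfun_compose)
  have ne: "\<exists>v :: 'a ell2. v \<noteq> 0" by (rule exI, rule delta_nonzero)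
  show one: "norm (1 :: 'a ell2_op) = 1"
  proof transfer
    let ?N = "norm (id_blinfun :: 'a ell2 \<Rightarrow>\<^sub>L 'a ell2)"
    obtain v :: "'a ell2" where v: "v \<noteq> 0" using ne by blast
    have le: "norm v \<le> ?N * norm v"
      using norm_blinfun[of id_blinfun v] by simp
    have "\<not> ?N < 1"
    proof
      assume "?N < 1"
      then have "?N * norm v < 1 * norm v"
        by (rule mult_strict_right_mono) (simp add: v)
      with le show False by linarith
    qed
    moreover have "?N \<le> 1" by (rule norm_blinfun_id_le)
    ultimately show "?N = 1" by linarith
  qed
  have "norm (0 :: 'a ell2_op) = 0" by transfer simp
  then show "(0 :: 'a ell2_op) \<noteq> 1" using one by auto
qed

end

lift_definition op_scaleC :: "complex \<Rightarrow> 'i ell2_op \<Rightarrow> 'i ell2_op"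
  is "\<lambda>c T. Blinfun (scaleC c) o\<^sub>L T"
  by (simp add: bounded_linear_Blinfun_apply[OF bounded_linear_scaleC] scaleC_scaleC mult.commute)

definition op_adj :: "'i ell2_op \<Rightarrow> 'i ell2_op" where
  "op_adj T = (THE S. \<forall>x y. cinner (op_apply T x) y = cinner x (op_apply S y))"


section \<open>C*-algebras of operators\<close>

text \<open>In the following, \<open>A\<close> is a C*-algebra of operators on \<open>\<ell>\<^sup>2('i)\<close>.\<close>

definition complex_subspace :: "'i ell2_op set \<Rightarrow> bool" where
  "complex_subspace V \<longleftrightarrow>
     0 \<in> V \<and> (\<forall>a\<in>V. \<forall>b\<in>V. a + b \<in> V) \<and> (\<forall>c. \<forall>a\<in>V. op_scaleC c a \<in> V)"

definition cstar_subalgebra :: "'i ell2_op set \<Rightarrow> 'i ell2_op set \<Rightarrow> bool" where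
  "cstar_subalgebra D A \<longleftrightarrow>
     D \<subseteq> A \<and> complex_subspace D \<and> (\<forall>a\<in>D. \<forall>b\<in>D. a * b \<in> D) \<and> (\<forall>a\<in>D. op_adj a \<in> D) \<and> closed D"

definition closed_ideal :: "'i ell2_op set \<Rightarrow> 'i ell2_op set \<Rightarrow> bool" where
  "closed_ideal I A \<longleftrightarrow>
     I \<subseteq> A \<and> complex_subspace I \<and> (\<forall>a\<in>A. \<forall>x\<in>I. a * x \<in> I \<and> x * a \<in> I) \<and> closed I"

definition cstar_simple :: "'i ell2_op set \<Rightarrow> bool" where
  "cstar_simple A \<longleftrightarrow> (\<forall>I. closed_ideal I A \<longrightarrow> I = {0} \<or> I = A)"

definition pos :: "'i ell2_op set \<Rightarrow> 'i ell2_op set" where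
  "pos A = {op_adj b * b | b. b \<in> A}"

definition projection :: "'i ell2_op set \<Rightarrow> 'i ell2_op \<Rightarrow> bool" where
  "projection A p \<longleftrightarrow> p \<in> A \<and> op_adj p = p \<and> p * p = p"

definition proj_equiv :: "'i ell2_op set \<Rightarrow> 'i ell2_op \<Rightarrow> 'i ell2_op \<Rightarrow> bool" where
  "proj_equiv A p q \<longleftrightarrow> (\<exists>t\<in>A. t * op_adj t = p \<and> op_adj t * t = q)"

definition proj_less :: "'i ell2_op set \<Rightarrow> 'i ell2_op \<Rightarrow> 'i ell2_op \<Rightarrow> bool" where
  "proj_less A q p \<longleftrightarrow> p - q \<in> pos A \<and> p \<noteq> q"

definition infinite_projection :: "'i ell2_op set \<Rightarrow> 'i ell2_op \<Rightarrow> bool" where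
  "infinite_projection A p \<longleftrightarrow>
     projection A p \<and> (\<exists>q. projection A q \<and> proj_equiv A p q \<and> proj_less A q p)"

definition hereditary :: "'i ell2_op set \<Rightarrow> 'i ell2_op set \<Rightarrow> bool" where
  "hereditary D A \<longleftrightarrow>
     cstar_subalgebra D A \<and> (\<forall>a\<in>A. \<forall>b\<in>D. a \<in> pos A \<and> b - a \<in> pos A \<longrightarrow> a \<in> D)"

definition cstar_purely_infinite_simple :: "'i ell2_op set \<Rightarrow> bool" where
  "cstar_purely_infinite_simple A \<longleftrightarrow>
     cstar_simple A \<and>
     (\<forall>D. hereditary D A \<and> D \<noteq> {0} \<longrightarrow> (\<exists>p\<in>D. infinite_projection A p))"


section \<open>Algebraically properly infinite rings\<close>

text \<open>\<open>R\<close> is a subring, possibly without unit, of the ambient ring type.\<close>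

definition matrices_over :: "'a set \<Rightarrow> nat \<Rightarrow> nat \<Rightarrow> 'a mat set" where
  "matrices_over R k n = {M \<in> carrier_mat k n. elements_mat M \<subseteq> R}"

definition ring_subeq :: "'a::ring set \<Rightarrow> 'a mat \<Rightarrow> 'a mat \<Rightarrow> bool" where
  "ring_subeq R x y \<longleftrightarrow>
     (\<exists>k n. x \<in> matrices_over R k k \<and> y \<in> matrices_over R n n \<and>
        (\<exists>\<alpha>\<in>matrices_over R k n. \<exists>\<beta>\<in>matrices_over R n k. x = \<alpha> * y * \<beta>))"

definition mat_oplus :: "'a::zero mat \<Rightarrow> 'a mat \<Rightarrow> 'a mat" where
  "mat_oplus x y =
     four_block_mat x (0\<^sub>m (dim_row x) (dim_col y)) (0\<^sub>m (dim_row y) (dim_col x)) y"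

definition mat1 :: "'a \<Rightarrow> 'a mat" where
  "mat1 a = Matrix.mat 1 1 (\<lambda>_. a)"

definition alg_properly_infinite_elem :: "'a::ring set \<Rightarrow> 'a \<Rightarrow> bool" where
  "alg_properly_infinite_elem R a \<longleftrightarrow>
     a \<in> R \<and> a \<noteq> 0 \<and> ring_subeq R (mat_oplus (mat1 a) (mat1 a)) (mat1 a)"

definition alg_properly_infinite :: "'a::ring set \<Rightarrow> bool" where
  "alg_properly_infinite R \<longleftrightarrow> (\<forall>a\<in>R. a \<noteq> 0 \<longrightarrow> alg_properly_infinite_elem R a)"


section \<open>Ample groupoids\<close>

text \<open>The underlying set of a groupoid is the carrier of \<open>gtop\<close>.  The product \<open>gmul G \<alpha> \<beta>\<close> is
  meaningful when \<open>gsrc G \<alpha> = grng G \<beta>\<close>.\<close>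

record 'g groupoid =
  gtop :: "'g topology"
  grng :: "'g \<Rightarrow> 'g"
  gsrc :: "'g \<Rightarrow> 'g"
  gmul :: "'g \<Rightarrow> 'g \<Rightarrow> 'g"
  ginv :: "'g \<Rightarrow> 'g"

definition arrows :: "'g groupoid \<Rightarrow> 'g set" where
  "arrows G = topspace (gtop G)"

definition gunits :: "'g groupoid \<Rightarrow> 'g set" where
  "gunits G = grng G ` arrows G"

definition gunits_top :: "'g groupoid \<Rightarrow> 'g topology" where
  "gunits_top G = subtopology (gtop G) (gunits G)"

definition composable :: "'g groupoid \<Rightarrow> ('g \<times> 'g) set" where
  "composable G = {(\<alpha>, \<beta>). \<alpha> \<in> arrows G \<and> \<beta> \<in> arrows G \<and> gsrc G \<alpha> = grng G \<beta>}"

text \<open>Continuity of range and source follows from that of multiplication and inversion.\<close>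

locale topological_groupoid =
  fixes G :: "'g groupoid"
  assumes rng_in: "\<gamma> \<in> arrows G \<Longrightarrow> grng G \<gamma> \<in> arrows G"
    and src_in: "\<gamma> \<in> arrows G \<Longrightarrow> gsrc G \<gamma> \<in> arrows G"
    and rng_rng: "\<gamma> \<in> arrows G \<Longrightarrow> grng G (grng G \<gamma>) = grng G \<gamma>"
    and src_rng: "\<gamma> \<in> arrows G \<Longrightarrow> gsrc G (grng G \<gamma>) = grng G \<gamma>"
    and rng_src: "\<gamma> \<in> arrows G \<Longrightarrow> grng G (gsrc G \<gamma>) = gsrc G \<gamma>"
    and src_src: "\<gamma> \<in> arrows G \<Longrightarrow> gsrc G (gsrc G \<gamma>) = gsrc G \<gamma>"
    and mul_in: "(\<alpha>, \<beta>) \<in> composable G \<Longrightarrow> gmul G \<alpha> \<beta> \<in> arrows G"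
    and rng_mul: "(\<alpha>, \<beta>) \<in> composable G \<Longrightarrow> grng G (gmul G \<alpha> \<beta>) = grng G \<alpha>"
    and src_mul: "(\<alpha>, \<beta>) \<in> composable G \<Longrightarrow> gsrc G (gmul G \<alpha> \<beta>) = gsrc G \<beta>"
    and mul_assoc: "(\<alpha>, \<beta>) \<in> composable G \<Longrightarrow> (\<beta>, \<gamma>) \<in> composable G \<Longrightarrow>
          gmul G (gmul G \<alpha> \<beta>) \<gamma> = gmul G \<alpha> (gmul G \<beta> \<gamma>)"
    and rng_mul_self: "\<gamma> \<in> arrows G \<Longrightarrow> gmul G (grng G \<gamma>) \<gamma> = \<gamma>"
    and mul_src_self: "\<gamma> \<in> arrows G \<Longrightarrow> gmul G \<gamma> (gsrc G \<gamma>) = \<gamma>"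
    and inv_in: "\<gamma> \<in> arrows G \<Longrightarrow> ginv G \<gamma> \<in> arrows G"
    and rng_inv: "\<gamma> \<in> arrows G \<Longrightarrow> grng G (ginv G \<gamma>) = gsrc G \<gamma>"
    and src_inv: "\<gamma> \<in> arrows G \<Longrightarrow> gsrc G (ginv G \<gamma>) = grng G \<gamma>"
    and mul_inv: "\<gamma> \<in> arrows G \<Longrightarrow> gmul G \<gamma> (ginv G \<gamma>) = grng G \<gamma>"
    and inv_mul: "\<gamma> \<in> arrows G \<Longrightarrow> gmul G (ginv G \<gamma>) \<gamma> = gsrc G \<gamma>"
    and continuous_mul:
      "continuous_map (subtopology (prod_topology (gtop G) (gtop G)) (composable G)) (gtop G)
         (\<lambda>(\<alpha>, \<beta>). gmul G \<alpha> \<beta>)"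
    and continuous_inv: "continuous_map (gtop G) (gtop G) (ginv G)"

definition homeo_onto_open :: "'g groupoid \<Rightarrow> ('g \<Rightarrow> 'g) \<Rightarrow> 'g set \<Rightarrow> bool" where
  "homeo_onto_open G f B \<longleftrightarrow>
     openin (gunits_top G) (f ` B) \<and>
     homeomorphic_map (subtopology (gtop G) B) (subtopology (gunits_top G) (f ` B)) f"

definition open_bisection :: "'g groupoid \<Rightarrow> 'g set \<Rightarrow> bool" where
  "open_bisection G B \<longleftrightarrow>
     openin (gtop G) B \<and> homeo_onto_open G (grng G) B \<and> homeo_onto_open G (gsrc G) B"

definition compact_open_bisection :: "'g groupoid \<Rightarrow> 'g set \<Rightarrow> bool" where
  "compact_open_bisection G B \<longleftrightarrow> compactin (gtop G) B \<and> open_bisection G B"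

definition ample :: "'g groupoid \<Rightarrow> bool" where
  "ample G \<longleftrightarrow>
     topological_groupoid G \<and>
     (\<forall>W \<gamma>. openin (gtop G) W \<and> \<gamma> \<in> W \<longrightarrow> (\<exists>B. compact_open_bisection G B \<and> \<gamma> \<in> B \<and> B \<subseteq> W))"

definition invariant :: "'g groupoid \<Rightarrow> 'g set \<Rightarrow> bool" where
  "invariant G U \<longleftrightarrow> U \<subseteq> gunits G \<and> (\<forall>\<gamma>\<in>arrows G. gsrc G \<gamma> \<in> U \<longleftrightarrow> grng G \<gamma> \<in> U)"

definition minimal_groupoid :: "'g groupoid \<Rightarrow> bool" where
  "minimal_groupoid G \<longleftrightarrow>
     (\<forall>U. openin (gunits_top G) U \<and> invariant G U \<longrightarrow> U = {} \<or> U = gunits G)"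

definition effective_groupoid :: "'g groupoid \<Rightarrow> bool" where
  "effective_groupoid G \<longleftrightarrow>
     (\<forall>B. compact_open_bisection G B \<and> B \<noteq> {} \<and> B \<subseteq> arrows G - gunits G \<longrightarrow>
        (\<exists>\<gamma>\<in>B. gsrc G \<gamma> \<noteq> grng G \<gamma>))"

definition compact_open_units :: "'g groupoid \<Rightarrow> 'g set \<Rightarrow> bool" where
  "compact_open_units G U \<longleftrightarrow> compactin (gunits_top G) U \<and> openin (gunits_top G) U"


section \<open>The reduced C*-algebra\<close>

text \<open>Functions on \<open>G\<close> are extended by \<open>0\<close> to the ambient type.\<close>

definition Cc :: "'g groupoid \<Rightarrow> ('g \<Rightarrow> complex) set" where
  "Cc G = {f. continuous_map (gtop G) euclidean f \<and>
     compactin (gtop G) (Abstract_Topology.closure_of (gtop G) {\<gamma> \<in> arrows G. f \<gamma> \<noteq> 0}) \<and>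
     (\<forall>\<gamma>. \<gamma> \<notin> arrows G \<longrightarrow> f \<gamma> = 0)}"

text \<open>The regular representation \<open>\<Oplus>\<^sub>u R\<^sub>u\<close>.  As \<open>G\<close> is the disjoint union of the fibres
  \<open>G\<^sub>u = s\<^sup>-\<^sup>1(u)\<close>, the direct sum of the spaces \<open>\<ell>\<^sup>2(G\<^sub>u)\<close> is \<open>\<ell>\<^sup>2(G)\<close>; on \<open>\<delta>\<^sub>\<gamma>\<close> the direct sum
  acts by \<open>R\<^sub>u\<close> for \<open>u = s(\<gamma>)\<close>.  The operator is extended by \<open>0\<close> to the orthogonal complement of
  \<open>\<ell>\<^sup>2(G)\<close> in \<open>\<ell>\<^sup>2('g)\<close>, which affects neither norms nor the *-algebra structure.\<close>

definition regular_rep :: "'g groupoid \<Rightarrow> ('g \<Rightarrow> complex) \<Rightarrow> 'g ell2_op" where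
  "regular_rep G f = (THE T. \<forall>\<gamma>. op_apply T (delta \<gamma>) =
     (if \<gamma> \<in> arrows G
      then \<Sum>\<^sub>\<infinity>\<alpha> | \<alpha> \<in> arrows G \<and> gsrc G \<alpha> = grng G \<gamma>. f \<alpha> *\<^sub>C delta (gmul G \<alpha> \<gamma>)
      else 0))"

text \<open>The closure is taken in the operator norm.\<close>

definition reduced_cstar :: "'g groupoid \<Rightarrow> 'g ell2_op set" where
  "reduced_cstar G = closure (regular_rep G ` Cc G)"

definition unit_ind :: "'g groupoid \<Rightarrow> 'g set \<Rightarrow> 'g ell2_op" where
  "unit_ind G U = regular_rep G (indicator U)"

definition B_alg :: "'g groupoid \<Rightarrow> 'g ell2_op set" where
  "B_alg G = {unit_ind G U * x * unit_ind G U | x U. x \<in> reduced_cstar G \<and> compact_open_units G U}"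

end

theory Submission
  imports Defs
begin

text \<open>The conditional expectation of \<open>C\<^sup>*\<^sub>r(G)\<close> onto the diagonal is read off matrix entries:
  \<open>\<langle>b \<delta>\<^sub>\<gamma>, \<delta>\<^sub>\<gamma>\<rangle> = E(b)(r(\<gamma>))\<close>.  If \<open>a \<noteq> 0\<close>, then \<open>E(a\<^sup>* a)\<close> is nonzero, and effectiveness yields a nonempty
  compact open \<open>V\<close> for which \<open>1\<^sub>V a\<^sup>* a 1\<^sub>V\<close> is close to a positive multiple of \<open>1\<^sub>V\<close>, hence invertible in
  the corner of \<open>1\<^sub>V\<close>.  So \<open>1\<^sub>V = c a d\<close> for some \<open>c\<close> and \<open>d\<close>, and a projection equivalent to \<open>1\<^sub>V\<close> lies
  in every hereditary subalgebra containing \<open>a\<close>.  By minimality every \<open>1\<^sub>U\<close> lies in the algebraic ideal generated by \<open>1\<^sub>V\<close>.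

  If \<open>B(G)\<close> is properly infinite, the matrices witnessing \<open>1\<^sub>V \<oplus> 1\<^sub>V \<precsim> 1\<^sub>V\<close> provide a one-sided inverse in
  the corner, whose polar decomposition shows that \<open>1\<^sub>V\<close> is infinite.  Conversely, an infinite
  projection \<open>q\<close> under \<open>1\<^sub>V\<close> contains infinitely many orthogonal copies of a nonzero projection
  \<open>e\<close>; as \<open>1\<^sub>U\<close> is a finite sum \<open>\<Sum> x\<^sub>i e y\<^sub>i\<close>, two orthogonal copies of \<open>1\<^sub>U\<close> factor through \<open>q = q c a d q\<close>.

  Only square roots of \<open>1 - z\<close> with \<open>\<parallel>z\<parallel> < 1\<close> are needed, and these come from the contraction principle.\<close>

section \<open>Square-summable functions\<close>

text \<open>The reduced algebra need not contain \<open>1\<close>, and \<open>pos\<close> asks for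
  an explicit \<open>b\<close> in the algebra with \<open>op_adj b * b\<close>, so inverses and
  order relations have to be exhibited by hand. One device does both: an element within
  \<open>\<rho> * c\<close> of \<open>c *\<^sub>R p\<close>, \<open>\<rho> < 1\<close>, is
  \<open>c *\<^sub>R (p - z)\<close> with \<open>norm z \<le> \<rho>\<close>. The root of
  \<open>1 - z\<close> and the inverse of that root are written \<open>1 - s\<close> and
  \<open>1 - t\<close> with \<open>s\<close>, \<open>t\<close> in the algebra, and inside the corner
  \<open>p\<close> takes the place of \<open>1\<close>. On the groupoid side, ampleness cuts each
  function of \<open>Cc G\<close> into pieces living on one bisection, where the representation is a
  weighted composition operator; boundedness and products need no estimate of sums. Passing from
  \<open>a\<close> to \<open>op_adj a * a\<close> makes some diagonal entry strictly positive. The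
  set \<open>V\<close> to which one compresses may miss the unit where this happens, since
  effectiveness removes the off-diagonal part only over some smaller open set.\<close>

lemma ell2_eqI: "(\<And>i. Rep_ell2 x i = Rep_ell2 y i) \<Longrightarrow> x = y"
  by (metis Rep_ell2_inject ext)

lemmas ell2_coords = plus_ell2.rep_eq minus_ell2.rep_eq uminus_ell2.rep_eq zero_ell2.rep_eq
  scaleR_ell2.rep_eq scaleC.rep_eq delta.rep_eq

lemma ell2_coord_sum: "Rep_ell2 (sum f F) i = (\<Sum>k\<in>F. Rep_ell2 (f k) i)"
  by (induction F rule: infinite_finite_induct) (auto simp: ell2_coords)

lemma square_summable_Rep: "(\<lambda>i. (cmod (Rep_ell2 x i))\<^sup>2) summable_on UNIV"
  using Rep_ell2 by auto

lemma norm_ell2_square: "(norm x)\<^sup>2 = (\<Sum>\<^sub>\<infinity>i. (cmod (Rep_ell2 x i))\<^sup>2)"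
  by (simp add: power2_norm_eq_inner inner_ell2.rep_eq)

lemma sum_square_le_norm:
  assumes "finite F" shows "(\<Sum>i\<in>F. (cmod (Rep_ell2 x i))\<^sup>2) \<le> (norm x)\<^sup>2"
  unfolding norm_ell2_square
  by (rule finite_sum_le_infsum) (use assms square_summable_Rep in auto)

lemma coord_le_norm: "cmod (Rep_ell2 x i) \<le> norm x"
  using sum_square_le_norm[of "{i}" x] by (auto intro: power2_le_imp_le)

text \<open>Bounded finite partial sums yield the vector and its norm bound at once. Limits of
  Cauchy sequences, Riesz vectors and values of weighted compositions are all built this
  way.\<close>

lemma ell2_ex:
  assumes "\<And>F. finite F \<Longrightarrow> (\<Sum>i\<in>F. (cmod (f i))\<^sup>2) \<le> K\<^sup>2" "K \<ge> 0"
  shows "\<exists>x. Rep_ell2 x = f \<and> norm x \<le> K"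
proof -
  have s: "(\<lambda>i. (cmod (f i))\<^sup>2) summable_on UNIV"
    by (rule nonneg_bdd_above_summable_on) (use assms in \<open>auto intro!: bdd_aboveI[where M = "K\<^sup>2"]\<close>)
  then have R: "Rep_ell2 (Abs_ell2 f) = f" by (simp add: Abs_ell2_inverse)
  have "(norm (Abs_ell2 f))\<^sup>2 \<le> K\<^sup>2"
    unfolding norm_ell2_square R by (rule infsum_le_finite_sums[OF s]) (use assms in auto)
  then show ?thesis using R assms(2) by (metis power2_le_imp_le)
qed

lemma norm_ell2_le:
  assumes "\<And>F. finite F \<Longrightarrow> (\<Sum>i\<in>F. (cmod (Rep_ell2 x i))\<^sup>2) \<le> K\<^sup>2" "K \<ge> 0"
  shows "norm x \<le> K"
  using ell2_ex[of "Rep_ell2 x", OF assms] by (metis Rep_ell2_inject)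

lemma norm_delta: "norm (delta i) = 1"
proof -
  have "(norm (delta i))\<^sup>2 = (\<Sum>\<^sub>\<infinity>j\<in>{i}. (cmod (Rep_ell2 (delta i) j))\<^sup>2)"
    unfolding norm_ell2_square by (rule infsum_cong_neutral) (auto simp: ell2_coords)
  also have "\<dots> = 1\<^sup>2" by (simp add: ell2_coords)
  finally show ?thesis by (metis norm_ge_zero power2_eq_imp_eq zero_le_one)
qed

text \<open>Coordinatewise limits exist; the Cauchy estimate on finitely many coordinates survives
  the limit in \<open>n\<close>, and \<open>ell2_ex\<close> reassembles it.\<close>

instance ell2 :: (type) banach
proof
  fix X :: "nat \<Rightarrow> 'a ell2"
  assume X: "Cauchy X"
  have "Cauchy (\<lambda>n. Rep_ell2 (X n) i)" for i
  proof (rule CauchyI)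
    fix e :: real assume "0 < e"
    then obtain M where "\<forall>m\<ge>M. \<forall>n\<ge>M. norm (X m - X n) < e" using CauchyD[OF X] by blast
    moreover have "cmod (Rep_ell2 (X m) i - Rep_ell2 (X n) i) \<le> norm (X m - X n)" for m n
      using coord_le_norm[of "X m - X n" i] by (simp add: ell2_coords)
    ultimately show "\<exists>M. \<forall>m\<ge>M. \<forall>n\<ge>M. cmod (Rep_ell2 (X m) i - Rep_ell2 (X n) i) < e"
      by (meson le_less_trans)
  qed
  then have "\<exists>l. (\<lambda>n. Rep_ell2 (X n) i) \<longlonglongrightarrow> l" for i
    using Cauchy_convergent_iff convergent_def by blast
  then obtain L where L: "\<And>i. (\<lambda>n. Rep_ell2 (X n) i) \<longlonglongrightarrow> L i" by metis
  have ex: "\<exists>N. \<forall>m\<ge>N. \<exists>y. Rep_ell2 y = (\<lambda>i. Rep_ell2 (X m) i - L i) \<and> norm y \<le> e" if "e > 0" for e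
  proof -
    obtain M where M: "\<And>m n. m \<ge> M \<Longrightarrow> n \<ge> M \<Longrightarrow> norm (X m - X n) < e"
      using CauchyD[OF X \<open>e > 0\<close>] by blast
    have "\<exists>y. Rep_ell2 y = (\<lambda>i. Rep_ell2 (X m) i - L i) \<and> norm y \<le> e" if m: "m \<ge> M" for m
    proof (rule ell2_ex)
      fix F :: "'a set" assume F: "finite F"
      have lim: "(\<lambda>n. \<Sum>i\<in>F. (cmod (Rep_ell2 (X m) i - Rep_ell2 (X n) i))\<^sup>2)
          \<longlonglongrightarrow> (\<Sum>i\<in>F. (cmod (Rep_ell2 (X m) i - L i))\<^sup>2)"
        by (intro tendsto_intros L)
      have "(\<Sum>i\<in>F. (cmod (Rep_ell2 (X m) i - Rep_ell2 (X n) i))\<^sup>2) \<le> e\<^sup>2" if "n \<ge> M" for n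
      proof -
        have "(\<Sum>i\<in>F. (cmod (Rep_ell2 (X m - X n) i))\<^sup>2) \<le> (norm (X m - X n))\<^sup>2"
          by (rule sum_square_le_norm[OF F])
        also have "\<dots> \<le> e\<^sup>2" using M[OF m that] by (intro power_mono) auto
        finally show ?thesis by (simp add: ell2_coords)
      qed
      then show "(\<Sum>i\<in>F. (cmod (Rep_ell2 (X m) i - L i))\<^sup>2) \<le> e\<^sup>2"
        by (intro LIMSEQ_le_const2[OF lim]) blast
    qed (use \<open>e > 0\<close> in auto)
    then show ?thesis by blast
  qed
  \<comment> \<open>Only the differences \<open>X m - L\<close> are known to be square-summable, so
    \<open>L\<close> is recovered as \<open>X m\<close> minus such a difference.\<close>
  obtain m y where y: "Rep_ell2 y = (\<lambda>i. Rep_ell2 (X m) i - L i)" using ex[of 1] by auto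
  define x where "x = X m - y"
  have x: "Rep_ell2 x i = L i" for i by (simp add: x_def ell2_coords y)
  have "X \<longlonglongrightarrow> x"
  proof (rule LIMSEQ_I)
    fix r :: real assume "0 < r"
    then obtain N where N: "\<forall>m\<ge>N. \<exists>y. Rep_ell2 y = (\<lambda>i. Rep_ell2 (X m) i - L i) \<and> norm y \<le> r / 2"
      using ex[of "r / 2"] by auto
    have "norm (X n - x) < r" if n: "n \<ge> N" for n
    proof -
      obtain y where y: "Rep_ell2 y = (\<lambda>i. Rep_ell2 (X n) i - L i)" "norm y \<le> r / 2"
        using N[rule_format, OF n] by blast
      have "X n - x = y" by (rule ell2_eqI) (simp add: ell2_coords y x)
      then show ?thesis using y \<open>0 < r\<close> by simp
    qed
    then show "\<exists>no. \<forall>n\<ge>no. norm (X n - x) < r" by blast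
  qed
  then show "convergent X" by (auto simp: convergent_def)
qed

lemma truncate_ell2:
  assumes "finite F"
  shows "Rep_ell2 (\<Sum>i\<in>F. Rep_ell2 x i *\<^sub>C delta i) j = (if j \<in> F then Rep_ell2 x j else 0)"
proof -
  have "Rep_ell2 (\<Sum>i\<in>F. Rep_ell2 x i *\<^sub>C delta i) j = (\<Sum>i\<in>F. if j = i then Rep_ell2 x j else 0)"
    unfolding ell2_coord_sum by (rule sum.cong) (auto simp: ell2_coords)
  then show ?thesis using assms by simp
qed

text \<open>Finite truncations converge in norm, because the squared distance is the tail of a
  convergent sum. Applied to the solution set of a continuous additive equation, this reduces
  identities to basis vectors.\<close>

lemma ell2_dense:
  fixes S :: "'a ell2 set"
  assumes "closed S" "\<And>c i. c *\<^sub>C delta i \<in> S" "\<And>x y. x \<in> S \<Longrightarrow> y \<in> S \<Longrightarrow> x + y \<in> S"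
  shows "x \<in> S"
proof -
  have "0 *\<^sub>C delta (undefined :: 'a) \<in> S" by (rule assms)
  moreover have "0 *\<^sub>C delta (undefined :: 'a) = 0" by (rule ell2_eqI) (simp add: ell2_coords)
  ultimately have 0: "0 \<in> S" by simp
  have sumS: "(\<Sum>i\<in>F. f i) \<in> S" if "\<And>i. f i \<in> S" for f :: "'a \<Rightarrow> 'a ell2" and F
    by (induction F rule: infinite_finite_induct) (use 0 that assms(3) in auto)
  have "x \<in> closure S"
  proof (unfold closure_approachable, intro allI impI)
    fix e :: real assume e: "0 < e"
    have hs: "((\<lambda>i. (cmod (Rep_ell2 x i))\<^sup>2) has_sum (norm x)\<^sup>2) UNIV"
      unfolding norm_ell2_square using square_summable_Rep by (rule has_sum_infsum)
    obtain F where F: "finite F" "dist (\<Sum>i\<in>F. (cmod (Rep_ell2 x i))\<^sup>2) ((norm x)\<^sup>2) \<le> (e/2)\<^sup>2"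
      using has_sum_finite_approximation[OF hs, of "(e/2)\<^sup>2"] e by auto
    define y where "y = (\<Sum>i\<in>F. Rep_ell2 x i *\<^sub>C delta i)"
    have "norm (y - x) \<le> e / 2"
    proof (rule norm_ell2_le)
      fix H :: "'a set" assume H: "finite H"
      have "(\<Sum>i\<in>H. (cmod (Rep_ell2 (y - x) i))\<^sup>2) = (\<Sum>i\<in>H - F. (cmod (Rep_ell2 x i))\<^sup>2)"
        using H by (intro sum.mono_neutral_cong_right) (auto simp: y_def truncate_ell2 F ell2_coords)
      also have "\<dots> = (\<Sum>i\<in>H \<union> F. (cmod (Rep_ell2 x i))\<^sup>2) - (\<Sum>i\<in>F. (cmod (Rep_ell2 x i))\<^sup>2)"
        using sum.subset_diff[of F "H \<union> F" "\<lambda>i. (cmod (Rep_ell2 x i))\<^sup>2"] H F(1)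
        by (simp add: Un_Diff)
      also have "\<dots> \<le> (norm x)\<^sup>2 - (\<Sum>i\<in>F. (cmod (Rep_ell2 x i))\<^sup>2)"
        using sum_square_le_norm[of "H \<union> F" x] H F by simp
      also have "\<dots> \<le> (e/2)\<^sup>2" using F(2) by (simp add: dist_real_def)
      finally show "(\<Sum>i\<in>H. (cmod (Rep_ell2 (y - x) i))\<^sup>2) \<le> (e / 2)\<^sup>2" .
    qed (use e in simp)
    moreover have "y \<in> S" unfolding y_def by (rule sumS) (rule assms(2))
    ultimately show "\<exists>y\<in>S. dist y x < e" using e by (auto simp: dist_norm intro!: bexI[of _ y])
  qed
  then show ?thesis using assms(1) by simp
qed

text \<open>Multiplication by \<open>- \<i>\<close> turns an imaginary part into a real part, so the
  real form determines the complex one.\<close>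

lemma cinner_eq_inner: "cinner x y = Complex (inner x y) (inner ((- \<i>) *\<^sub>C x) y)"
proof -
  let ?f = "\<lambda>i. Rep_ell2 x i * cnj (Rep_ell2 y i)"
  have s: "?f summable_on UNIV"
    by (rule abs_summable_summable)
      (use square_summable_mult[OF square_summable_Rep square_summable_Rep, of x y] in \<open>simp add: norm_mult\<close>)
  have "Re (cinner x y) = inner x y"
    unfolding cinner.rep_eq inner_ell2.rep_eq using infsum_Re[OF s]
    by (simp add: o_def inner_complex_def)
  moreover have "Im (cinner x y) = inner ((- \<i>) *\<^sub>C x) y"
    unfolding cinner.rep_eq inner_ell2.rep_eq scaleC.rep_eq using infsum_Im[OF s]
    by (simp add: o_def inner_complex_def)
  ultimately show ?thesis by (simp add: complex_eq_iff)
qed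

lemma inner_delta:
  "inner (delta i) y = Re (Rep_ell2 y i)" "inner (\<i> *\<^sub>C delta i) y = Im (Rep_ell2 y i)"
proof -
  have "inner (c *\<^sub>C delta i) y = inner c (Rep_ell2 y i)" for c
  proof -
    have "inner (c *\<^sub>C delta i) y = (\<Sum>\<^sub>\<infinity>j\<in>{i}. inner (Rep_ell2 (c *\<^sub>C delta i) j) (Rep_ell2 y j))"
      unfolding inner_ell2.rep_eq by (rule infsum_cong_neutral) (auto simp: ell2_coords)
    then show ?thesis by (simp add: ell2_coords)
  qed
  from this[of 1] this[of \<i>] show "inner (delta i) y = Re (Rep_ell2 y i)"
    "inner (\<i> *\<^sub>C delta i) y = Im (Rep_ell2 y i)"
    by (simp_all add: inner_complex_def scaleC_def map_fun_def Rep_ell2_inverse)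
qed

lemma scaleC_complex_split: "c *\<^sub>C x = Re c *\<^sub>R x + Im c *\<^sub>R (\<i> *\<^sub>C x)"
  by (rule ell2_eqI) (simp add: ell2_coords complex_eq_iff algebra_simps)

section \<open>Bounded operators\<close>

lemma op_eqI: "(\<And>x. op_apply S x = op_apply T x) \<Longrightarrow> S = T"
  by (metis Rep_ell2_op_inject blinfun_eqI op_apply.rep_eq)

lemma op_apply_add_op: "op_apply (S + T) x = op_apply S x + op_apply T x"
  and op_apply_diff_op: "op_apply (S - T) x = op_apply S x - op_apply T x"
  and op_apply_minus_op: "op_apply (- S) x = - op_apply S x"
  and op_apply_zero_op: "op_apply 0 x = 0"
  and op_apply_scaleR_op: "op_apply (r *\<^sub>R S) x = r *\<^sub>R op_apply S x"
  and op_apply_times: "op_apply (S * T) x = op_apply S (op_apply T x)"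
  and op_apply_one: "op_apply 1 x = x"
  and op_apply_scaleC_op: "op_apply (op_scaleC c S) x = c *\<^sub>C op_apply S x"
  by (simp_all add: op_apply.rep_eq plus_ell2_op.rep_eq minus_ell2_op.rep_eq uminus_ell2_op.rep_eq
      zero_ell2_op.rep_eq scaleR_ell2_op.rep_eq times_ell2_op.rep_eq one_ell2_op.rep_eq
      op_scaleC.rep_eq blinfun.add_left blinfun.diff_left blinfun.minus_left blinfun.scaleR_left
      bounded_linear_Blinfun_apply[OF bounded_linear_scaleC])

lemmas op_apply_op = op_apply_add_op op_apply_diff_op op_apply_minus_op op_apply_zero_op
  op_apply_scaleR_op op_apply_times op_apply_one op_apply_scaleC_op

lemma op_apply_add: "op_apply S (x + y) = op_apply S x + op_apply S y"
  and op_apply_diff: "op_apply S (x - y) = op_apply S x - op_apply S y"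
  and op_apply_minus: "op_apply S (- x) = - op_apply S x"
  and op_apply_zero: "op_apply S 0 = 0"
  and op_apply_scaleR: "op_apply S (r *\<^sub>R x) = r *\<^sub>R op_apply S x"
  and op_apply_scaleC: "op_apply S (c *\<^sub>C x) = c *\<^sub>C op_apply S x"
  using Rep_ell2_op[of S]
  by (simp_all add: op_apply.rep_eq blinfun.add_right blinfun.diff_right blinfun.minus_right blinfun.scaleR_right)

lemma op_apply_sum: "op_apply S (sum f F) = (\<Sum>i\<in>F. op_apply S (f i))"
  by (induction F rule: infinite_finite_induct) (auto simp: op_apply_add op_apply_zero)

lemmas op_apply_vec = op_apply_add op_apply_diff op_apply_minus op_apply_zero
  op_apply_scaleR op_apply_scaleC

lemma norm_op_apply: "norm (op_apply S x) \<le> norm S * norm x"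
  by (simp add: op_apply.rep_eq norm_ell2_op.rep_eq norm_blinfun)

lemma norm_op_le: "(\<And>x. norm (op_apply S x) \<le> K * norm x) \<Longrightarrow> K \<ge> 0 \<Longrightarrow> norm S \<le> K"
  unfolding norm_ell2_op.rep_eq op_apply.rep_eq by (rule norm_blinfun_bound)

lemma bounded_linear_op_apply: "bounded_linear (op_apply S)"
  by (simp add: op_apply.rep_eq blinfun.bounded_linear_right)

lemma continuous_op_apply: "continuous_on A f \<Longrightarrow> continuous_on A (\<lambda>x. op_apply S (f x))"
  by (rule bounded_linear.continuous_on[OF bounded_linear_op_apply])

lemma bounded_linear_op_apply_left: "bounded_linear (\<lambda>S. op_apply S x)"
  by (rule bounded_linear_intro[where K = "norm x"])
    (simp_all add: op_apply_op mult.commute norm_op_apply[of _ x, simplified mult.commute])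

lemma op_ex:
  assumes "\<And>x y. f (x + y) = f x + f y" "\<And>c x. f (c *\<^sub>C x) = c *\<^sub>C f x"
    and bnd: "\<And>x. norm (f x) \<le> K * norm x" and "K \<ge> 0"
  shows "\<exists>T. op_apply T = f \<and> norm T \<le> K"
proof -
  have r: "r *\<^sub>R x = complex_of_real r *\<^sub>C x" for r and x :: "'a ell2"
    by (rule ell2_eqI) (simp add: ell2_coords)
  have "bounded_linear f"
    by (rule bounded_linear_intro[where K = K]) (use assms in \<open>auto simp: r mult.commute\<close>)
  then have "op_apply (Abs_ell2_op (Blinfun f)) = f"
    using assms(2) by (simp add: op_apply.rep_eq Abs_ell2_op_inverse bounded_linear_Blinfun_apply)
  then show ?thesis using norm_op_le bnd \<open>K \<ge> 0\<close> by metis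
qed

lemma op_eqI_delta:
  assumes "\<And>i. op_apply S (delta i) = op_apply T (delta i)" shows "S = T"
proof (rule op_eqI)
  fix x
  have "x \<in> {x. op_apply S x = op_apply T x}"
  proof (rule ell2_dense)
    show "closed {x. op_apply S x = op_apply T x}"
      by (intro closed_Collect_eq continuous_op_apply continuous_on_id)
  qed (use assms in \<open>auto simp: op_apply_vec\<close>)
  then show "op_apply S x = op_apply T x" by simp
qed

lemma tendsto_ell2_op_iff: "(X \<longlonglongrightarrow> T) \<longleftrightarrow> ((\<lambda>n. Rep_ell2_op (X n)) \<longlonglongrightarrow> Rep_ell2_op T)"
  by (simp add: LIMSEQ_iff norm_ell2_op.rep_eq minus_ell2_op.rep_eq)

text \<open>The limit is taken among real bounded operators; complex linearity is a closed pointwise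
  condition and passes to it.\<close>

instance ell2_op :: (type) banach
proof
  fix X :: "nat \<Rightarrow> 'a ell2_op"
  assume "Cauchy X"
  then have "Cauchy (\<lambda>n. Rep_ell2_op (X n))"
    by (simp add: Cauchy_iff norm_ell2_op.rep_eq minus_ell2_op.rep_eq)
  then obtain L where L: "(\<lambda>n. Rep_ell2_op (X n)) \<longlonglongrightarrow> L"
    using Cauchy_convergent_iff convergent_def by blast
  have ap: "(\<lambda>n. blinfun_apply (Rep_ell2_op (X n)) x) \<longlonglongrightarrow> blinfun_apply L x" for x
    by (intro tendsto_intros L)
  have "blinfun_apply L (c *\<^sub>C x) = c *\<^sub>C blinfun_apply L x" for c x
  proof (rule LIMSEQ_unique)
    show "(\<lambda>n. blinfun_apply (Rep_ell2_op (X n)) (c *\<^sub>C x)) \<longlonglongrightarrow> blinfun_apply L (c *\<^sub>C x)" by (rule ap)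
    have "(\<lambda>n. c *\<^sub>C blinfun_apply (Rep_ell2_op (X n)) x) \<longlonglongrightarrow> c *\<^sub>C blinfun_apply L x"
      by (rule bounded_linear.tendsto[OF bounded_linear_scaleC ap])
    then show "(\<lambda>n. blinfun_apply (Rep_ell2_op (X n)) (c *\<^sub>C x)) \<longlonglongrightarrow> c *\<^sub>C blinfun_apply L x"
      using Rep_ell2_op[of "X _"] by simp
  qed
  then have "Rep_ell2_op (Abs_ell2_op L) = L" by (simp add: Abs_ell2_op_inverse)
  then have "X \<longlonglongrightarrow> Abs_ell2_op L" using L by (simp add: tendsto_ell2_op_iff)
  then show "convergent X" by (auto simp: convergent_def)
qed

subsection \<open>Adjoints\<close>

text \<open>For complex-linear operators it suffices to test the adjoint relation on the real inner
  product, because \<open>cinner\<close> is recovered from it.\<close>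

lemma op_adj_eqI:
  assumes "\<And>x y. inner (op_apply T x) y = inner x (op_apply S y)"
  shows "op_adj T = S"
  unfolding op_adj_def
proof (rule the_equality)
  show "\<forall>x y. cinner (op_apply T x) y = cinner x (op_apply S y)"
    using assms by (simp add: cinner_eq_inner flip: op_apply_scaleC)
  fix S' assume S': "\<forall>x y. cinner (op_apply T x) y = cinner x (op_apply S' y)"
  show "S' = S"
  proof (rule op_eqI)
    fix y
    have "inner x (op_apply S' y) = inner x (op_apply S y)" for x
      using S' assms unfolding cinner_eq_inner by (metis complex.sel(1))
    then have "inner (op_apply S' y - op_apply S y) (op_apply S' y - op_apply S y) = 0"
      by (simp add: inner_diff_right)
    then show "op_apply S' y = op_apply S y" by simp
  qed
qed

text \<open>Riesz representation by hand: testing on \<open>delta i\<close> and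
  \<open>\<i> *\<^sub>C delta i\<close> forces the coordinates of the adjoint vector.\<close>

lemma op_adj_ex: "\<exists>S. \<forall>x y. inner (op_apply T x) y = inner x (op_apply S y)"
proof -
  have "\<exists>z. (\<forall>x. inner (op_apply T x) y = inner x z) \<and> norm z \<le> norm T * norm y" for y
  proof -
    define c where "c i = Complex (inner (op_apply T (delta i)) y) (inner (op_apply T (\<i> *\<^sub>C delta i)) y)" for i
    have "\<exists>z. Rep_ell2 z = c \<and> norm z \<le> norm T * norm y"
    proof (rule ell2_ex)
      fix F :: "'a set" assume F: "finite F"
      define Q where "Q = (\<Sum>i\<in>F. (cmod (c i))\<^sup>2)"
      \<comment> \<open>The truncated candidate is itself the test vector:
        \<open>inner (op_apply T v) y\<close> equals \<open>(norm v)\<^sup>2\<close> and is at most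
        \<open>norm T * norm v * norm y\<close>, so cancelling \<open>norm v\<close> bounds
        it.\<close>
      define v where "v = (\<Sum>i\<in>F. c i *\<^sub>C delta i)"
      have v: "Rep_ell2 v j = (if j \<in> F then c j else 0)" for j
      proof -
        have "Rep_ell2 v j = (\<Sum>i\<in>F. if j = i then c j else 0)"
          unfolding v_def ell2_coord_sum by (rule sum.cong) (auto simp: ell2_coords)
        then show ?thesis using F by simp
      qed
      have "(norm v)\<^sup>2 = (\<Sum>\<^sub>\<infinity>i\<in>F. (cmod (c i))\<^sup>2)"
        unfolding norm_ell2_square by (rule infsum_cong_neutral) (auto simp: v)
      then have nv: "(norm v)\<^sup>2 = Q" using F by (simp add: Q_def)
      have "inner (op_apply T (c i *\<^sub>C delta i)) y = (cmod (c i))\<^sup>2" for i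
        by (subst scaleC_complex_split)
          (simp add: op_apply_vec inner_add_left cmod_power2, simp add: c_def power2_eq_square op_apply_vec)
      then have "inner (op_apply T v) y = Q"
        by (simp add: v_def op_apply_sum inner_sum_left Q_def)
      moreover have "inner (op_apply T v) y \<le> norm T * norm v * norm y"
        by (meson norm_cauchy_schwarz norm_op_apply mult_right_mono norm_ge_zero order_trans)
      ultimately have "norm v * norm v \<le> norm v * (norm T * norm y)"
        using nv by (simp add: power2_eq_square mult_ac)
      then have "norm v \<le> norm T * norm y"
        by (cases "norm v = 0") (auto simp: mult_le_cancel_left)
      then show "Q \<le> (norm T * norm y)\<^sup>2" unfolding nv[symmetric] by (rule power_mono) simp
    qed simp
    then obtain z where z: "Rep_ell2 z = c" "norm z \<le> norm T * norm y" by blast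
    have "x \<in> {x. inner (op_apply T x) y = inner x z}" for x
    proof (rule ell2_dense)
      show "closed {x. inner (op_apply T x) y = inner x z}"
        by (intro closed_Collect_eq continuous_intros continuous_op_apply)
      fix a i
      have "inner (op_apply T (delta i)) y = inner (delta i) z"
        "inner (op_apply T (\<i> *\<^sub>C delta i)) y = inner (\<i> *\<^sub>C delta i) z"
        by (simp_all only: inner_delta z c_def complex.sel)
      then show "a *\<^sub>C delta i \<in> {x. inner (op_apply T x) y = inner x z}"
        by (subst scaleC_complex_split) (simp add: op_apply_add op_apply_scaleR inner_add_left)
    qed (auto simp: op_apply_vec inner_add_left)
    then show ?thesis using z by blast
  qed
  then obtain S where S: "\<And>x y. inner (op_apply T x) y = inner x (S y)"
    and bnd: "\<And>y. norm (S y) \<le> norm T * norm y" by metis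
  have eqI: "u = v" if "\<And>x. inner x u = inner x v" for u v :: "'a ell2"
    using that[of "u - v"] by (metis inner_diff_right inner_eq_zero_iff right_minus_eq)
  have cs: "inner x (c *\<^sub>C y) = inner (cnj c *\<^sub>C x) y" for c and x y :: "'a ell2"
  proof -
    have "inner a (c * b) = inner (cnj c * a) b" for a b :: complex
      by (simp add: inner_complex_def algebra_simps)
    then show ?thesis by (simp add: inner_ell2.rep_eq scaleC.rep_eq)
  qed
  have "S (y + z) = S y + S z" for y z
    by (rule eqI) (simp add: inner_add_right flip: S)
  moreover have "S (c *\<^sub>C y) = c *\<^sub>C S y" for c y
    by (rule eqI) (simp add: cs op_apply_vec flip: S)
  ultimately obtain U where "op_apply U = S" using op_ex[of S, OF _ _ bnd] by auto
  then show ?thesis using S by auto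
qed

lemma inner_op_adj: "inner (op_apply T x) y = inner x (op_apply (op_adj T) y)"
  using op_adj_ex[of T] op_adj_eqI by metis

lemma inner_op_adj': "inner (op_apply (op_adj T) x) y = inner x (op_apply T y)"
  using inner_op_adj[of T y x] by (simp add: inner_commute)

lemma op_adj_simps [simp]:
  fixes S T :: "'a ell2_op"
  shows op_adj_op_adj: "op_adj (op_adj T) = T"
    and op_adj_times: "op_adj (S * T) = op_adj T * op_adj S"
    and op_adj_add: "op_adj (S + T) = op_adj S + op_adj T"
    and op_adj_diff: "op_adj (S - T) = op_adj S - op_adj T"
    and op_adj_scaleR: "op_adj (r *\<^sub>R S) = r *\<^sub>R op_adj S"
    and op_adj_zero: "op_adj (0 :: 'a ell2_op) = 0"
    and op_adj_one: "op_adj (1 :: 'a ell2_op) = 1"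
proof -
  show "op_adj (op_adj T) = T" by (rule op_adj_eqI) (rule inner_op_adj')
  show "op_adj (S * T) = op_adj T * op_adj S" by (rule op_adj_eqI) (simp add: op_apply_op inner_op_adj)
  show "op_adj (S + T) = op_adj S + op_adj T"
    by (rule op_adj_eqI) (simp add: op_apply_op inner_op_adj inner_add_left inner_add_right)
  show "op_adj (S - T) = op_adj S - op_adj T"
    by (rule op_adj_eqI) (simp add: op_apply_op inner_op_adj inner_diff_left inner_diff_right)
  show "op_adj (r *\<^sub>R S) = r *\<^sub>R op_adj S"
    by (rule op_adj_eqI) (simp add: op_apply_op inner_op_adj)
  show "op_adj (0 :: 'a ell2_op) = 0" by (rule op_adj_eqI) (simp add: op_apply_op)
  show "op_adj (1 :: 'a ell2_op) = 1" by (rule op_adj_eqI) (simp add: op_apply_op)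
qed

lemma op_adj_power: "op_adj (S ^ n) = op_adj S ^ n"
  by (induction n) (simp_all add: power_commutes)

lemma norm_op_adj_le: "norm (op_adj T) \<le> norm T"
proof (rule norm_op_le)
  fix y
  let ?z = "op_apply (op_adj T) y"
  have "norm ?z * norm ?z = inner (op_apply T ?z) y"
    by (simp add: inner_op_adj flip: power2_norm_eq_inner power2_eq_square)
  also have "\<dots> \<le> norm T * norm ?z * norm y"
    by (meson norm_cauchy_schwarz norm_op_apply mult_right_mono norm_ge_zero order_trans)
  finally have "norm ?z * norm ?z \<le> norm ?z * (norm T * norm y)" by (simp add: mult_ac)
  then show "norm ?z \<le> norm T * norm y"
    by (cases "norm ?z = 0") (auto simp: mult_le_cancel_left)
qed simp

lemma norm_op_adj: "norm (op_adj T) = norm T"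
  using norm_op_adj_le[of T] norm_op_adj_le[of "op_adj T"] by simp

lemma bounded_linear_op_adj: "bounded_linear op_adj"
  by (rule bounded_linear_intro[where K = 1]) (simp_all add: norm_op_adj)

lemma inner_adj_times: "inner (op_apply (op_adj T * T) x) x = (norm (op_apply T x))\<^sup>2"
  by (simp add: op_apply_op inner_op_adj' power2_norm_eq_inner)

lemma op_adj_times_self_eq_0: "op_adj T * T = 0 \<Longrightarrow> T = 0"
  by (rule op_eqI) (use inner_adj_times[of T] in \<open>auto simp: op_apply_op\<close>)

lemma op_adj_delta: "Rep_ell2 (op_apply (op_adj T) (delta i)) j = cnj (Rep_ell2 (op_apply T (delta j)) i)"
proof -
  let ?z = "op_apply (op_adj T) (delta i)"
  have "Re (Rep_ell2 ?z j) = Re (Rep_ell2 (op_apply T (delta j)) i)"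
    using inner_delta(1)[of j ?z] inner_delta(1)[of i "op_apply T (delta j)"]
    by (simp add: inner_op_adj[symmetric] inner_commute)
  moreover have "Im (Rep_ell2 ?z j) = - Im (Rep_ell2 (op_apply T (delta j)) i)"
    using inner_delta(2)[of j ?z] inner_delta(1)[of i "op_apply T (\<i> *\<^sub>C delta j)"]
    by (simp add: inner_op_adj[symmetric] inner_commute op_apply_vec ell2_coords)
  ultimately show ?thesis by (simp add: complex_eq_iff)
qed

text \<open>Polarisation of the quadratic form at \<open>x\<close> and a multiple of
  \<open>T x\<close>; self-adjointness makes the cross terms equal.\<close>

lemma norm_le_of_form_bound:
  assumes "op_adj T = T" "\<And>x. \<bar>inner (op_apply T x) x\<bar> \<le> K * (norm x)\<^sup>2" "K \<ge> 0"
  shows "norm T \<le> K"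
proof (rule norm_op_le)
  fix x
  show "norm (op_apply T x) \<le> K * norm x"
  proof (cases "op_apply T x = 0")
    case False
    \<comment> \<open>\<open>y\<close> is \<open>T x\<close> rescaled to the length of
      \<open>x\<close>, so that the parallelogram law yields exactly
      \<open>4 * K * (norm x)\<^sup>2\<close>.\<close>
    define r where "r = norm x / norm (op_apply T x)"
    define y where "y = r *\<^sub>R op_apply T x"
    have ny: "norm y = norm x" using False by (simp add: y_def r_def)
    have sym: "inner (op_apply T y) x = inner (op_apply T x) y"
      using inner_op_adj[of T y x] assms(1) by (simp add: inner_commute)
    have "4 * inner (op_apply T x) y
        = inner (op_apply T (x + y)) (x + y) - inner (op_apply T (x - y)) (x - y)"
      by (simp add: op_apply_vec inner_add_left inner_add_right inner_diff_left inner_diff_right sym)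
    also have "\<dots> \<le> K * (norm (x + y))\<^sup>2 + K * (norm (x - y))\<^sup>2"
      using assms(2)[of "x + y"] assms(2)[of "x - y"] by linarith
    also have "\<dots> = 4 * K * (norm x)\<^sup>2"
    proof -
      have "(norm (x + y))\<^sup>2 + (norm (x - y))\<^sup>2 = 2 * (norm x)\<^sup>2 + 2 * (norm y)\<^sup>2"
        by (simp add: power2_norm_eq_inner inner_add_left inner_add_right inner_diff_left inner_diff_right)
      then have "(norm (x + y))\<^sup>2 + (norm (x - y))\<^sup>2 = 4 * (norm x)\<^sup>2" by (simp add: ny)
      then have "K * ((norm (x + y))\<^sup>2 + (norm (x - y))\<^sup>2) = K * (4 * (norm x)\<^sup>2)" by simp
      then show ?thesis by (simp add: algebra_simps)
    qed
    finally have "inner (op_apply T x) y \<le> K * (norm x)\<^sup>2" by simp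
    moreover have "inner (op_apply T x) y = norm x * norm (op_apply T x)"
      using False by (simp add: y_def r_def power2_eq_square flip: power2_norm_eq_inner)
    ultimately have "norm x * norm (op_apply T x) \<le> norm x * (K * norm x)"
      by (simp add: power2_eq_square mult_ac)
    moreover have "norm x > 0" using False op_apply_zero by auto
    ultimately show ?thesis by simp
  qed (use assms(3) in simp)
qed (use assms in simp)

text \<open>Injectivity of \<open>\<tau>\<close> where \<open>w\<close> is nonzero prevents a
  coordinate of \<open>x\<close> from being counted twice, so the bound on the weight bounds the
  norm. It serves for diagonal operators, with \<open>\<tau>\<close> the identity, and for
  convolution by a function on a bisection.\<close>

lemma weighted_composition_op_ex:
  assumes bnd: "\<And>j. cmod (w j) \<le> K" and inj: "inj_on \<tau> {j. w j \<noteq> 0}"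
  shows "\<exists>T. (\<forall>x j. Rep_ell2 (op_apply T x) j = w j * Rep_ell2 x (\<tau> j)) \<and> norm T \<le> K"
proof -
  have K: "K \<ge> 0" using bnd norm_ge_zero order_trans by blast
  have "\<exists>y. Rep_ell2 y = (\<lambda>j. w j * Rep_ell2 x (\<tau> j)) \<and> norm y \<le> K * norm x" for x
  proof (rule ell2_ex)
    fix F :: "'a set" assume F: "finite F"
    let ?H = "{j \<in> F. w j \<noteq> 0}"
    have "(\<Sum>i\<in>F. (cmod (w i * Rep_ell2 x (\<tau> i)))\<^sup>2) = (\<Sum>i\<in>?H. (cmod (w i * Rep_ell2 x (\<tau> i)))\<^sup>2)"
      using F by (intro sum.mono_neutral_cong_right) auto
    also have "\<dots> \<le> (\<Sum>i\<in>?H. K\<^sup>2 * (cmod (Rep_ell2 x (\<tau> i)))\<^sup>2)"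
      by (intro sum_mono) (simp add: norm_mult power_mult_distrib mult_right_mono power_mono bnd)
    also have "\<dots> = K\<^sup>2 * (\<Sum>i\<in>\<tau> ` ?H. (cmod (Rep_ell2 x i))\<^sup>2)"
      by (subst sum.reindex) (auto intro: inj_on_subset[OF inj] simp: sum_distrib_left)
    also have "\<dots> \<le> K\<^sup>2 * (norm x)\<^sup>2"
      by (intro mult_left_mono sum_square_le_norm) (use F in auto)
    finally show "(\<Sum>i\<in>F. (cmod (w i * Rep_ell2 x (\<tau> i)))\<^sup>2) \<le> (K * norm x)\<^sup>2"
      by (simp add: power_mult_distrib)
  qed (use K in simp)
  then obtain f where f: "\<And>x. Rep_ell2 (f x) = (\<lambda>j. w j * Rep_ell2 x (\<tau> j))"
    and fb: "\<And>x. norm (f x) \<le> K * norm x" by metis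
  have "f (x + y) = f x + f y" "f (c *\<^sub>C x) = c *\<^sub>C f x" for x y c
    by (rule ell2_eqI; simp add: f ell2_coords algebra_simps)+
  then show ?thesis using op_ex[of f, OF _ _ fb K] f by metis
qed

section \<open>Operator algebras without functional calculus\<close>

lemma op_scaleC_of_real: "op_scaleC (complex_of_real r) T = r *\<^sub>R T"
  by (rule op_eqI, rule ell2_eqI) (simp add: op_apply_op ell2_coords)

lemma op_adj_mult_eq: "a * b = c \<Longrightarrow> op_adj b * op_adj a = op_adj c"
  by auto

lemma cstar_subalgebraD:
  assumes "cstar_subalgebra C A"
  shows "0 \<in> C" "a \<in> C \<Longrightarrow> b \<in> C \<Longrightarrow> a + b \<in> C" "a \<in> C \<Longrightarrow> b \<in> C \<Longrightarrow> a - b \<in> C"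
    "a \<in> C \<Longrightarrow> b \<in> C \<Longrightarrow> a * b \<in> C" "a \<in> C \<Longrightarrow> op_adj a \<in> C" "a \<in> C \<Longrightarrow> r *\<^sub>R a \<in> C"
    "closed C" "C \<subseteq> A"
proof -
  show scale: "r *\<^sub>R a \<in> C" if "a \<in> C" for r a
    using assms that unfolding cstar_subalgebra_def complex_subspace_def op_scaleC_of_real[symmetric] by blast
  show "a - b \<in> C" if "a \<in> C" "b \<in> C" for a b
    using assms that scale[of b "- 1"] unfolding cstar_subalgebra_def complex_subspace_def
    by (metis diff_conv_add_uminus scaleR_minus1_left)
qed (use assms in \<open>auto simp: cstar_subalgebra_def complex_subspace_def\<close>)

text \<open>The fixed point equation \<open>s = (z + s\<^sup>2) / 2\<close> says \<open>(1 - s)\<^sup>2 = 1 - z\<close>; on the ball of radius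
  \<open>1 - sqrt (1 - \<rho>)\<close> it is a contraction.\<close>

lemma sqrt_one_minus_ex:
  fixes z :: "'i ell2_op"
  assumes C: "cstar_subalgebra C A" and z: "z \<in> C" "op_adj z = z" "norm z \<le> \<rho>" and \<rho>: "\<rho> < 1"
  shows "\<exists>s\<in>C. op_adj s = s \<and> norm s < 1 \<and> (1 - s) * (1 - s) = 1 - z"
proof -
  have \<rho>0: "0 \<le> \<rho>" using z(3) norm_ge_zero order_trans by blast
  define r where "r = 1 - sqrt (1 - \<rho>)"
  have r: "0 \<le> r" "r < 1" using \<rho> \<rho>0 by (simp_all add: r_def)
  \<comment> \<open>\<open>r\<close> is the fixed point of the scalar map at \<open>\<rho>\<close>,
    so the ball of radius \<open>r\<close> is sent into itself.\<close>
  have r2: "\<rho> + r * r = 2 * r" using \<rho> by (simp add: r_def algebra_simps)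
  \<comment> \<open>Membership in \<open>C\<close>, self-adjointness and the norm bound are closed
    conditions that \<open>f\<close> preserves, so the fixed point inherits all three.\<close>
  define S where "S = {s \<in> C. op_adj s = s \<and> norm s \<le> r}"
  have "closed {s :: 'i ell2_op. op_adj s = s}" "closed {s :: 'i ell2_op. norm s \<le> r}"
    by (intro closed_Collect_eq closed_Collect_le continuous_intros
        bounded_linear.continuous_on[OF bounded_linear_op_adj])+
  moreover have "S = C \<inter> {s. op_adj s = s} \<inter> {s. norm s \<le> r}" by (auto simp: S_def)
  ultimately have "complete S"
    using cstar_subalgebraD(7)[OF C] by (simp add: complete_eq_closed closed_Int)
  moreover have "S \<noteq> {}" using cstar_subalgebraD(1)[OF C] r by (auto simp: S_def intro!: exI[of _ 0])
  moreover define f where "f s = (1/2) *\<^sub>R (z + s * s)" for s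
  have "f ` S \<subseteq> S"
  proof clarify
    fix s assume s: "s \<in> S"
    then have sC: "s \<in> C" "op_adj s = s" "norm s \<le> r" by (auto simp: S_def)
    have "norm (z + s * s) \<le> \<rho> + r * r"
      using z(3) norm_triangle_ineq[of z "s * s"] norm_mult_ineq[of s s] mult_mono[OF sC(3) sC(3)] r
      by (auto intro!: order_trans[OF norm_triangle_ineq] add_mono order_trans[OF norm_mult_ineq])
    then have "norm (f s) \<le> r" by (simp add: f_def r2)
    then show "f s \<in> S" using sC z cstar_subalgebraD[OF C] by (simp add: S_def f_def)
  qed
  moreover have "dist (f s) (f t) \<le> r * dist s t" if "s \<in> S" "t \<in> S" for s t
  proof -
    \<comment> \<open>\<open>s\<close> and \<open>t\<close> need not commute; this factorisation of
      \<open>s * s - t * t\<close> keeps their order.\<close>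
    have "f s - f t = (1/2) *\<^sub>R (s * (s - t) + (s - t) * t)"
      by (simp add: f_def algebra_simps)
    moreover have "norm (s * (s - t) + (s - t) * t) \<le> r * norm (s - t) + norm (s - t) * r"
      using that r by (intro order_trans[OF norm_triangle_ineq] add_mono order_trans[OF norm_mult_ineq] mult_mono)
        (auto simp: S_def)
    ultimately show ?thesis by (simp add: dist_norm mult.commute)
  qed
  ultimately obtain s where s: "s \<in> S" "f s = s"
    using Banach_fix[of S r f] r by blast
  have "2 *\<^sub>R s = z + s * s" using s(2) by (metis f_def scaleR_half_double scaleR_scaleR scaleR_2 scaleR_one
        mult.commute nonzero_mult_div_cancel_left zero_neq_numeral times_divide_eq_right mult_1_right)
  then have "s + s = z + s * s" by (simp add: scaleR_2)
  then have "(1 - s) * (1 - s) = 1 - z" by (simp add: algebra_simps)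
  then show ?thesis using s(1) r by (auto simp: S_def)
qed

text \<open>The inverse is sought as \<open>1 - t\<close> because \<open>C\<close> need not contain
  \<open>1\<close>: the relation \<open>(1 - s) * (1 - t) = 1\<close> expands to
  \<open>s * t - s = t\<close>, a contraction equation in \<open>C\<close>.\<close>

lemma quasi_inverse_ex:
  fixes s :: "'i ell2_op"
  assumes C: "cstar_subalgebra C A" and s: "s \<in> C" "op_adj s = s" "norm s < 1"
  shows "\<exists>t\<in>C. op_adj t = t \<and> (1 - s) * (1 - t) = 1 \<and> (1 - t) * (1 - s) = 1"
proof -
  have "\<exists>!t. t \<in> C \<and> s * t - s = t"
  proof (rule Banach_fix[where c = "norm s"])
    show "complete C" "C \<noteq> {}" using cstar_subalgebraD[OF C] by (auto simp: complete_eq_closed)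
    show "(\<lambda>t. s * t - s) ` C \<subseteq> C" using cstar_subalgebraD[OF C] s by auto
    show "dist (s * t - s) (s * u - s) \<le> norm s * dist t u" for t u
      using norm_mult_ineq[of s "t - u"] by (simp add: dist_norm right_diff_distrib)
  qed (use s in auto)
  then obtain t where t: "t \<in> C" "s * t - s = t" by blast
  have 1: "(1 - s) * (1 - t) = 1" using t(2) by (simp add: algebra_simps)
  then have 2: "(1 - op_adj t) * (1 - s) = 1" using s(2) op_adj_mult_eq[OF 1] by simp
  \<comment> \<open>A left inverse and a right inverse of one element agree; this makes
    \<open>t\<close> self-adjoint and the inverse two-sided.\<close>
  have "1 - op_adj t = 1 - t" using 1 2 by (metis mult.assoc mult.right_neutral mult_1)
  then show ?thesis using t 1 2 by auto
qed

lemma pos_self_adjoint: "a \<in> pos A \<Longrightarrow> op_adj a = a"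
  by (auto simp: pos_def)

lemma pos_inner_ge_0: "a \<in> pos A \<Longrightarrow> inner (op_apply a x) x \<ge> 0"
  by (auto simp: pos_def inner_adj_times)

subsection \<open>Projections and corners\<close>

text \<open>For the defect \<open>d = v - v * p\<close> the product \<open>op_adj d * d\<close> is
  \<open>(1 - p) * p * (1 - p) = 0\<close>.\<close>

lemma partial_isometry_right:
  assumes "op_adj v * v = p" "op_adj p = p" "p * p = p"
  shows "v * p = v"
proof -
  have "op_adj (v - v * p) * (v - v * p) = p - p * p - p * p + p * p * p"
    using assms by (simp add: algebra_simps mult.assoc[symmetric])
  then have "op_adj (v - v * p) * (v - v * p) = 0" using assms by simp
  then have "v - v * p = 0" by (rule op_adj_times_self_eq_0)
  then show ?thesis by simp
qed

lemma proj_inner: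
  assumes "op_adj p = p" "p * p = p"
  shows "inner (op_apply p x) x = (norm (op_apply p x))\<^sup>2"
  using inner_adj_times[of p x] assms by simp

lemma norm_proj_apply_le:
  assumes "op_adj p = p" "p * p = p"
  shows "norm (op_apply p x) \<le> norm x"
proof -
  have "norm (op_apply p x) * norm (op_apply p x) \<le> norm (op_apply p x) * norm x"
    using proj_inner[OF assms, of x] norm_cauchy_schwarz[of "op_apply p x" x] by (simp add: power2_eq_square)
  then show ?thesis by (cases "norm (op_apply p x) = 0") (auto simp: mult_le_cancel_left)
qed

text \<open>On the kernel of \<open>p\<close>, positivity of \<open>p - q\<close> forces the form of
  \<open>q\<close> to be at most zero, so \<open>q\<close> vanishes there.\<close>

lemma proj_le_mult:
  assumes p: "op_adj p = p" "p * p = p" and q: "op_adj q = q" "q * q = q" and "p - q \<in> pos A"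
  shows "p * q = q" "q * p = q"
proof -
  have "op_apply (q * (1 - p)) x = 0" for x
  proof -
    define y where "y = op_apply (1 - p) x"
    have py: "op_apply p y = 0" using p by (simp add: y_def op_apply_op op_apply_vec flip: op_apply_times)
    have "(norm (op_apply q y))\<^sup>2 \<le> 0"
      using pos_inner_ge_0[OF assms(5), of y] proj_inner[OF q, of y]
      by (simp add: op_apply_op py inner_diff_left)
    then show ?thesis by (simp add: op_apply_times y_def)
  qed
  then have "q * (1 - p) = 0" by (intro op_eqI) (simp add: op_apply_op)
  then show *: "q * p = q" by (simp add: algebra_simps)
  show "p * q = q" using op_adj_mult_eq[OF *] p q by simp
qed

text \<open>For a projection \<open>p\<close> in \<open>A\<close> this is the set of all
  \<open>p * x * p\<close>. The two equations are closed conditions and serve directly as rewrite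
  rules.\<close>

definition corner :: "'i ell2_op set \<Rightarrow> 'i ell2_op \<Rightarrow> 'i ell2_op set" where
  "corner A p = {x \<in> A. p * x = x \<and> x * p = x}"

lemma cornerD: "x \<in> corner A p \<Longrightarrow> x \<in> A" "x \<in> corner A p \<Longrightarrow> p * x = x" "x \<in> corner A p \<Longrightarrow> x * p = x"
  by (auto simp: corner_def)

lemma cornerI:
  assumes "cstar_subalgebra A UNIV" "p \<in> A" "p * p = p" "x \<in> A"
  shows "p * x * p \<in> corner A p"
  using assms cstar_subalgebraD[OF assms(1)] unfolding corner_def
  by (auto simp: mult.assoc) (auto simp: mult.assoc[symmetric])

lemma op_scaleC_mult: "op_scaleC c (S * T) = op_scaleC c S * T" "S * op_scaleC c T = op_scaleC c (S * T)"
  by (rule op_eqI; simp add: op_apply_op op_apply_scaleC)+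

lemma cstar_subalgebra_corner:
  assumes A: "cstar_subalgebra A UNIV" and p: "op_adj p = p"
  shows "cstar_subalgebra (corner A p) A"
proof -
  have adj: "op_adj x \<in> corner A p" if "x \<in> corner A p" for x
    using that cstar_subalgebraD(5)[OF A] op_adj_mult_eq[of p x x] op_adj_mult_eq[of x p x] p
    by (auto simp: corner_def)
  have "closed {x. p * x = x}" "closed {x. x * p = x}"
    by (intro closed_Collect_eq continuous_intros)+
  moreover have "corner A p = A \<inter> {x. p * x = x} \<inter> {x. x * p = x}" by (auto simp: corner_def)
  ultimately have "closed (corner A p)" using cstar_subalgebraD(7)[OF A] by (simp add: closed_Int)
  moreover have "op_scaleC c x \<in> corner A p" if "x \<in> corner A p" for c x
    using that A by (auto simp: corner_def op_scaleC_mult(2) cstar_subalgebra_def complex_subspace_def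
        simp flip: op_scaleC_mult(1))
  moreover have "x * y \<in> corner A p" if "x \<in> corner A p" "y \<in> corner A p" for x y
    using that cstar_subalgebraD[OF A] by (auto simp: corner_def mult.assoc) (metis mult.assoc)
  ultimately show ?thesis
    using adj cstar_subalgebraD[OF A] unfolding cstar_subalgebra_def[of "corner A p"] complex_subspace_def
    by (auto simp: corner_def algebra_simps)
qed

text \<open>If \<open>x = op_adj b * b\<close> is dominated by \<open>y\<close>, then
  \<open>b\<close> vanishes wherever \<open>y\<close> does, in particular on the kernel of
  \<open>p\<close>; hence \<open>b * p = b\<close>.\<close>

lemma hereditary_corner:
  assumes A: "cstar_subalgebra A UNIV" and p: "op_adj p = p" "p * p = p"
  shows "hereditary (corner A p) A"
  unfolding hereditary_def
proof (intro conjI ballI impI)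
  fix x y assume xA: "x \<in> A" and y: "y \<in> corner A p" and xy: "x \<in> pos A \<and> y - x \<in> pos A"
  obtain b where b: "x = op_adj b * b" using xy by (auto simp: pos_def)
  have "op_apply (b * (1 - p)) v = 0" for v
  proof -
    define w where "w = op_apply (1 - p) v"
    have pw: "op_apply p w = 0" using p by (simp add: w_def op_apply_op op_apply_vec flip: op_apply_times)
    have "op_apply y w = op_apply y (op_apply p w)" using y by (simp add: corner_def flip: op_apply_times)
    then have "op_apply y w = 0" by (simp add: pw op_apply_vec)
    then have "inner (op_apply x w) w \<le> 0"
      using xy pos_inner_ge_0[of "y - x" A w] by (simp add: op_apply_op)
    then show ?thesis using inner_adj_times[of b w] by (simp add: b op_apply_times w_def)
  qed
  then have "b * (1 - p) = 0" by (intro op_eqI) (simp add: op_apply_op)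
  then have "b * p = b" by (simp add: algebra_simps)
  then have xp: "x * p = x" by (simp add: b mult.assoc)
  then have "p * x = x" using op_adj_mult_eq[OF xp] p pos_self_adjoint[of x A] xy by simp
  then show "x \<in> corner A p" using xA xp by (simp add: corner_def)
qed (rule cstar_subalgebra_corner[OF A p(1)])

section \<open>Inverse square roots, polar decomposition and infinite projections in a
  corner\<close>

lemma corner_inverse_sqrt_ex:
  assumes A: "cstar_subalgebra A UNIV" and p: "p \<in> A" "op_adj p = p" "p * p = p"
    and b: "b \<in> corner A p" "op_adj b = b" and c: "c > 0"
    and bnd: "norm (b - c *\<^sub>R p) \<le> \<rho> * c" and \<rho>: "\<rho> < 1"
  shows "\<exists>w\<in>corner A p. op_adj w = w \<and> w * b * w = p \<and> w * w * b = p"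
proof -
  note C = cstar_subalgebra_corner[OF A p(2)]
  \<comment> \<open>Division by \<open>c\<close> gives \<open>b = c *\<^sub>R (p - z)\<close> with
    \<open>norm z \<le> \<rho>\<close>, which is why the bound is stated relative to
    \<open>c\<close>.\<close>
  define z where "z = p - (1 / c) *\<^sub>R b"
  have pC: "p \<in> corner A p" using p by (simp add: corner_def)
  have zC: "z \<in> corner A p" unfolding z_def by (intro cstar_subalgebraD(3,6)[OF C] pC b(1))
  have b_eq: "b = c *\<^sub>R (p - z)" using c by (simp add: z_def)
  have "z = (- 1 / c) *\<^sub>R (b - c *\<^sub>R p)" using c by (simp add: z_def scaleR_diff_right)
  then have "norm z = norm (b - c *\<^sub>R p) / c" using c by (simp add: divide_inverse mult.commute)
  then have "norm z \<le> \<rho>" using bnd c by (simp add: pos_divide_le_eq)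
  moreover have "op_adj z = z" using p b by (simp add: z_def)
  ultimately obtain s where s: "s \<in> corner A p" "op_adj s = s" "norm s < 1" "(1 - s) * (1 - s) = 1 - z"
    using sqrt_one_minus_ex[OF C zC _ _ \<rho>] by blast
  obtain t where t: "t \<in> corner A p" "op_adj t = t" "(1 - s) * (1 - t) = 1" "(1 - t) * (1 - s) = 1"
    using quasi_inverse_ex[OF C s(1-3)] by blast
  note ps = cornerD(2,3)[OF s(1)] and pt = cornerD(2,3)[OF t(1)]
  \<comment> \<open>\<open>s\<close>, \<open>t\<close> and \<open>z\<close> lie in the corner, so
    \<open>p\<close> may replace \<open>1\<close> in the relations for \<open>1 - s\<close> and
    \<open>1 - t\<close>.\<close>
  have ss: "(p - s) * (p - s) = p - z" using s(4) ps p(3) by (simp add: algebra_simps)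
  have st: "(p - s) * (p - t) = p" "(p - t) * (p - s) = p"
    using t(3,4) ps pt p(3) by (simp_all add: algebra_simps)
  \<comment> \<open>\<open>p - t\<close> inverts the root \<open>p - s\<close> of
    \<open>p - z\<close>, so \<open>w\<close> acts as the inverse square root of
    \<open>b\<close>.\<close>
  define w where "w = (1 / sqrt c) *\<^sub>R (p - t)"
  have cc: "(1 / sqrt c) * (1 / sqrt c) * c = 1" using c by (simp add: field_simps)
  have "w \<in> corner A p" unfolding w_def by (intro cstar_subalgebraD(3,6)[OF C] pC t(1))
  moreover have "op_adj w = w" using p t by (simp add: w_def)
  moreover have "w * b * w = p"
  proof -
    have "w * b * w = ((1 / sqrt c) * (1 / sqrt c) * c) *\<^sub>R ((p - t) * (p - z) * (p - t))"
      unfolding w_def b_eq by (simp del: times_divide_eq_right times_divide_eq_left mult_1_left mult_1_right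
          real_sqrt_mult_self add: mult_ac)
    also have "\<dots> = (p - t) * (p - s) * ((p - s) * (p - t))" unfolding cc ss[symmetric] by (simp add: mult.assoc)
    finally show ?thesis using st p by simp
  qed
  moreover have "w * w * b = p"
  proof -
    have "w * w * b = ((1 / sqrt c) * (1 / sqrt c) * c) *\<^sub>R ((p - t) * (p - t) * (p - z))"
      unfolding w_def b_eq by (simp del: times_divide_eq_right times_divide_eq_left mult_1_left mult_1_right
          real_sqrt_mult_self add: mult_ac)
    also have "\<dots> = (p - t) * (((p - t) * (p - s)) * (p - s))" unfolding cc ss[symmetric] by (simp add: mult.assoc)
    also have "\<dots> = p" using st p ps pt by (simp add: algebra_simps)
    finally show ?thesis .
  qed
  ultimately show ?thesis by blast
qed

text \<open>\<open>w\<close> plays the role of the inverse absolute value of \<open>a * p\<close>,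
  so \<open>a * w\<close> is its polar part. The second equation is the same inverse read as a
  factorisation of \<open>p\<close> through \<open>a\<close>.\<close>

lemma polar_ex:
  assumes A: "cstar_subalgebra A UNIV" and p: "p \<in> A" "op_adj p = p" "p * p = p" and a: "a \<in> A"
    and c: "c > 0" and bnd: "norm (p * (op_adj a * a) * p - c *\<^sub>R p) \<le> \<rho> * c" and \<rho>: "\<rho> < 1"
  shows "\<exists>w\<in>corner A p. op_adj (a * w) * (a * w) = p \<and> w * w * (p * (op_adj a * a) * p) = p"
proof -
  have "p * (op_adj a * a) * p \<in> corner A p" by (rule cornerI[OF A p(1,3)]) (use cstar_subalgebraD[OF A] a in auto)
  moreover have "op_adj (p * (op_adj a * a) * p) = p * (op_adj a * a) * p" using p by (simp add: mult.assoc)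
  ultimately obtain w where w: "w \<in> corner A p" "op_adj w = w" "w * (p * (op_adj a * a) * p) * w = p"
      "w * w * (p * (op_adj a * a) * p) = p"
    using corner_inverse_sqrt_ex[OF A p _ _ c bnd \<rho>] by blast
  have "op_adj (a * w) * (a * w) = (w * p) * (op_adj a * a) * (p * w)"
    using w(2) cornerD[OF w(1)] by (simp add: mult.assoc)
  also have "\<dots> = p" using w(3) by (simp add: mult.assoc)
  finally show ?thesis using w by blast
qed

text \<open>A left inverse bounds \<open>b\<^sup>* b\<close> below on the range of \<open>p\<close>, so \<open>b\<close> has a polar decomposition.\<close>

lemma nonunitary_isometry_ex:
  assumes A: "cstar_subalgebra A UNIV" and p: "p \<in> A" "op_adj p = p" "p * p = p" "p \<noteq> 0"
    and ab: "a1 \<in> A" "a2 \<in> A" "b1 \<in> A"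
      "a1 * p * b1 = p" "a2 * p * b1 = 0" "a2 * p * b2 = p"
  shows "\<exists>w\<in>corner A p. op_adj w * w = p \<and> w * op_adj w \<noteq> p"
proof -
  define b where "b = p * b1 * p"
  define a where "a = p * a1 * p"
  have bC: "b \<in> corner A p" unfolding b_def using cornerI[OF A p(1,3)] ab by auto
  have "a * b = p * (a1 * p * b1) * p" using p(3) by (simp add: a_def b_def mult.assoc) (metis mult.assoc)
  then have "a * b = p" using p ab by simp
  \<comment> \<open>On the range of \<open>p\<close>, \<open>op_adj b * b\<close> lies between
    \<open>\<epsilon>\<close> and \<open>M\<close>: the left inverse \<open>a\<close> gives the
    lower bound, the norm of \<open>b\<close> the upper one. The added \<open>1\<close> keeps both
    constants positive in all cases.\<close>
  define \<epsilon> where "\<epsilon> = 1 / ((norm a)\<^sup>2 + 1)"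
  define M where "M = (norm b)\<^sup>2 + 1"
  have \<epsilon>: "0 < \<epsilon>" "\<epsilon> \<le> 1" "\<epsilon> * (norm a)\<^sup>2 \<le> 1"
    by (auto simp: \<epsilon>_def add_nonneg_pos divide_simps intro: add_nonneg_pos)
  have M: "M \<ge> 1" "M > 0" by (auto simp: M_def add_nonneg_pos)
  have "norm (M *\<^sub>R p - op_adj b * b) \<le> M - \<epsilon>"
  proof (rule norm_le_of_form_bound)
    fix x
    let ?px = "op_apply p x" and ?bx = "op_apply b x"
    have form: "inner (op_apply (M *\<^sub>R p - op_adj b * b) x) x = M * (norm ?px)\<^sup>2 - (norm ?bx)\<^sup>2"
      using proj_inner[OF p(2,3), of x] inner_adj_times[of b x]
      by (simp add: op_apply_op inner_diff_left)
    have "?bx = op_apply b ?px" using cornerD(3)[OF bC] by (metis op_apply_times)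
    then have up: "(norm ?bx)\<^sup>2 \<le> (norm b)\<^sup>2 * (norm ?px)\<^sup>2"
      using norm_op_apply[of b ?px] by (metis norm_ge_zero power_mono power_mult_distrib)
    have "?px = op_apply a ?bx" using \<open>a * b = p\<close> by (simp flip: op_apply_times)
    then have "(norm ?px)\<^sup>2 \<le> (norm a)\<^sup>2 * (norm ?bx)\<^sup>2"
      using norm_op_apply[of a ?bx] by (metis norm_ge_zero power_mono power_mult_distrib)
    then have "\<epsilon> * (norm ?px)\<^sup>2 \<le> \<epsilon> * ((norm a)\<^sup>2 * (norm ?bx)\<^sup>2)" using \<epsilon> by (simp add: mult_left_mono)
    also have "\<dots> \<le> 1 * (norm ?bx)\<^sup>2"
      unfolding mult.assoc[symmetric] by (rule mult_right_mono[OF \<epsilon>(3)]) simp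
    finally have low: "\<epsilon> * (norm ?px)\<^sup>2 \<le> (norm ?bx)\<^sup>2" by simp
    have "(norm ?px)\<^sup>2 \<le> (norm x)\<^sup>2" using norm_proj_apply_le[OF p(2,3)] by (simp add: power_mono)
    then have "(M - \<epsilon>) * (norm ?px)\<^sup>2 \<le> (M - \<epsilon>) * (norm x)\<^sup>2" using M \<epsilon> by (intro mult_left_mono) auto
    moreover have "(norm ?bx)\<^sup>2 \<le> M * (norm ?px)\<^sup>2" using up by (simp add: M_def algebra_simps add_increasing)
    ultimately show "\<bar>inner (op_apply (M *\<^sub>R p - op_adj b * b) x) x\<bar> \<le> (M - \<epsilon>) * (norm x)\<^sup>2"
      unfolding form using low by (simp add: left_diff_distrib)
  qed (use p M \<epsilon> in auto)
  \<comment> \<open>Relative to \<open>M\<close> the error is \<open>1 - \<epsilon> / M < 1\<close>,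
    the form that \<open>polar_ex\<close> requires.\<close>
  then have "norm (p * (op_adj b * b) * p - M *\<^sub>R p) \<le> (1 - \<epsilon> / M) * M"
  proof -
    have "op_adj b = p * op_adj b" using op_adj_mult_eq[OF cornerD(3)[OF bC]] p by simp
    then have "p * (op_adj b * b) * p = op_adj b * b" using cornerD(3)[OF bC] by (simp add: mult.assoc) (metis mult.assoc)
    then show ?thesis using \<open>norm _ \<le> M - \<epsilon>\<close> M by (simp add: norm_minus_commute left_diff_distrib)
  qed
  then obtain w where w: "w \<in> corner A p" "op_adj (b * w) * (b * w) = p"
    using polar_ex[OF A p(1-3) cornerD(1)[OF bC] M(2)] \<epsilon> M by force
  have "b * w \<in> corner A p"
    using cstar_subalgebraD(4)[OF cstar_subalgebra_corner[OF A p(2)] bC w(1)] .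
  \<comment> \<open>\<open>a2 * p\<close> is nonzero but kills the range of \<open>b\<close>, so
    \<open>b * w\<close> cannot be a unitary of the corner.\<close>
  moreover have "(b * w) * op_adj (b * w) \<noteq> p"
  proof
    assume eq: "(b * w) * op_adj (b * w) = p"
    have "a2 * p * b = (a2 * p * b1) * p" using p(3) by (simp add: b_def mult.assoc) (metis mult.assoc)
    then have "a2 * p * b = 0" using ab by simp
    then have "a2 * p * ((b * w) * op_adj (b * w)) = 0" by (metis mult.assoc mult_zero_left)
    then have "a2 * p = 0" unfolding eq using p(3) by (simp add: mult.assoc)
    then show False using ab(6) p(4) by simp
  qed
  ultimately show ?thesis using w by blast
qed

text \<open>Conjugation by the partial isometry \<open>v\<close> carries the corner of
  \<open>p\<close> onto that of \<open>v * op_adj v\<close>, and with it the proper isometry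
  \<open>w\<close>.\<close>

lemma infinite_projection_transport:
  assumes A: "cstar_subalgebra A UNIV" and p: "op_adj p = p" "p * p = p"
    and v: "v \<in> A" "op_adj v * v = p"
    and w: "w \<in> corner A p" "op_adj w * w = p" "w * op_adj w \<noteq> p"
  shows "infinite_projection A (v * op_adj v)"
proof -
  note alg = cstar_subalgebraD(3-5)[OF A]
  have vp: "v * p = v" by (rule partial_isometry_right[OF v(2) p])
  have pv: "p * op_adj v = op_adj v" using op_adj_mult_eq[OF vp] p by simp
  have wA: "w \<in> A" and pw: "p * w = w" "w * p = w" using cornerD[OF w(1)] by auto
  have pw': "p * op_adj w = op_adj w" "op_adj w * p = op_adj w"
    using op_adj_mult_eq[OF pw(1)] op_adj_mult_eq[OF pw(2)] p by simp_all
  \<comment> \<open>Absorption rules are needed with a trailing factor \<open>x\<close> too: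
    products are normalised to the right, and the pattern then heads a longer product.\<close>
  have r: "op_adj v * (v * x) = p * x" "op_adj w * (w * x) = p * x" "p * (p * x) = p * x"
    "p * (w * x) = w * x" "p * (op_adj w * x) = op_adj w * x" "p * (op_adj v * x) = op_adj v * x"
    "w * (p * x) = w * x" "op_adj w * (p * x) = op_adj w * x" "v * (p * x) = v * x" for x
    using v(2) w(2) p(2) pw pw' pv vp by (simp_all flip: mult.assoc)
  note R = r v(2) w(2) p vp pv pw pw' mult.assoc
  define q where "q = v * w * op_adj w * op_adj v"
  have P: "projection A (v * op_adj v)" using v(1) alg by (auto simp: projection_def R)
  moreover have "projection A q" using v(1) wA alg by (auto simp: projection_def q_def R)
  \<comment> \<open>The witness is the adjoint of the transported isometry
    \<open>v * w * op_adj v\<close>, since \<open>proj_equiv\<close> puts the larger projection at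
    \<open>t * op_adj t\<close>.\<close>
  moreover have "proj_equiv A (v * op_adj v) q"
    unfolding proj_equiv_def
    by (rule bexI[of _ "v * op_adj w * op_adj v"]) (use v(1) wA alg in \<open>auto simp: q_def R\<close>)
  \<comment> \<open>A difference of nested projections is a projection, hence its own witness of
    positivity.\<close>
  moreover have "v * op_adj v - q = op_adj (v * op_adj v - q) * (v * op_adj v - q)"
    by (simp add: q_def R algebra_simps)
  then have "v * op_adj v - q \<in> pos A"
    using v(1) wA alg by (auto simp: pos_def q_def intro!: exI[of _ "v * op_adj v - v * w * op_adj w * op_adj v"])
  moreover have "v * op_adj v \<noteq> q"
  proof
    assume "v * op_adj v = q"
    then have "op_adj v * (v * op_adj v) * v = op_adj v * q * v" by simp
    then show False using w(3) by (simp add: q_def R)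
  qed
  ultimately show ?thesis by (auto simp: infinite_projection_def proj_less_def)
qed

text \<open>The element is dominated by a multiple of \<open>d * op_adj d\<close>, which lies in
  \<open>D\<close>; a square root of \<open>1 - z\<close> exhibits the difference as
  \<open>op_adj c * c\<close>.\<close>

lemma hereditary_conjugate:
  assumes A: "cstar_subalgebra A UNIV" and D: "hereditary D A" and d: "d \<in> D" and y: "y \<in> A"
  shows "d * y * op_adj (d * y) \<in> D"
proof -
  note alg = cstar_subalgebraD[OF A]
  have Dalg: "cstar_subalgebra D A" using D by (simp add: hereditary_def)
  have dA: "d \<in> A" using cstar_subalgebraD(8)[OF Dalg] d by blast
  \<comment> \<open>Doubling the norm gives \<open>norm z \<le> 1 / 2\<close>, safely below the
    bound \<open>1\<close> that the root needs; the added \<open>1\<close> covers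
    \<open>y = 0\<close>.\<close>
  define M where "M = 2 * norm (y * op_adj y) + 1"
  have M: "M > 0" by (simp add: M_def add_nonneg_pos)
  define z where "z = (1 / M) *\<^sub>R (y * op_adj y)"
  have "norm z \<le> 1 / 2" using M by (simp add: z_def M_def divide_simps)
  moreover have "z \<in> A" "op_adj z = z" using y alg by (simp_all add: z_def)
  ultimately obtain s where s: "s \<in> A" "op_adj s = s" "(1 - s) * (1 - s) = 1 - z"
    using sqrt_one_minus_ex[OF A, of z "1/2"] by auto
  \<comment> \<open>\<open>d - d * s\<close> is \<open>d * (1 - s)\<close> written without
    \<open>1\<close>, so that \<open>c\<close> belongs to \<open>A\<close>.\<close>
  define c where "c = sqrt M *\<^sub>R op_adj (d - d * s)"
  have cA: "c \<in> A" using alg dA s by (simp add: c_def)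
  have "M *\<^sub>R (d * op_adj d) - d * y * op_adj (d * y) = M *\<^sub>R (d * ((1 - z) * op_adj d))"
    using M by (simp add: z_def algebra_simps)
  also have "\<dots> = M *\<^sub>R (d * ((1 - s) * (1 - s)) * op_adj d)" by (simp add: s mult.assoc)
  also have "\<dots> = op_adj c * c"
    using M s by (simp add: c_def algebra_simps)
  finally have "M *\<^sub>R (d * op_adj d) - d * y * op_adj (d * y) \<in> pos A" using cA by (auto simp: pos_def)
  moreover have "M *\<^sub>R (d * op_adj d) \<in> D" by (intro cstar_subalgebraD(4-6)[OF Dalg] d)
  moreover have "d * y * op_adj (d * y) \<in> A" by (intro alg(4,5) dA y)
  moreover have "d * y * op_adj (d * y) \<in> pos A"
    using alg(4,5) dA y by (auto simp: pos_def intro!: exI[of _ "op_adj (d * y)"] simp del: op_adj_times)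
  ultimately show ?thesis using D unfolding hereditary_def by blast
qed

subsection \<open>Ideals and copies of a projection\<close>

text \<open>Finite sums of products \<open>x * a * y\<close>, deliberately without closure: a finite
  sum is what can be spread over finitely many copies of a projection.\<close>

inductive_set ideal_gen :: "'r::ring set \<Rightarrow> 'r \<Rightarrow> 'r set" for A a where
  zero: "0 \<in> ideal_gen A a"
| step: "z \<in> ideal_gen A a \<Longrightarrow> x \<in> A \<Longrightarrow> y \<in> A \<Longrightarrow> z + x * a * y \<in> ideal_gen A a"

lemma ideal_gen_add:
  assumes "z \<in> ideal_gen A a" "z' \<in> ideal_gen A a" shows "z + z' \<in> ideal_gen A a"
  using assms(2,1) by induction (auto simp: add.assoc[symmetric] intro: ideal_gen.intros)

lemma ideal_gen_mult:
  assumes "z \<in> ideal_gen A a" and A: "\<And>x y. x \<in> A \<Longrightarrow> y \<in> A \<Longrightarrow> x * y \<in> A" and "w \<in> A"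
  shows "w * z \<in> ideal_gen A a" "z * w \<in> ideal_gen A a"
  using assms(1)
proof induction
  case (step z x y)
  have "w * z + (w * x) * a * y \<in> ideal_gen A a" "z * w + x * a * (y * w) \<in> ideal_gen A a"
    using step A \<open>w \<in> A\<close> by (auto intro: ideal_gen.step)
  then show "w * (z + x * a * y) \<in> ideal_gen A a" "(z + x * a * y) * w \<in> ideal_gen A a"
    by (simp_all add: algebra_simps)
qed (auto intro: ideal_gen.zero)

lemma ideal_gen_sum:
  assumes "z \<in> ideal_gen A a"
  shows "\<exists>(n::nat) x y. (\<forall>i<n. x i \<in> A \<and> y i \<in> A) \<and> z = (\<Sum>i<n. x i * a * y i)"
  using assms
proof induction
  case zero
  show ?case by (rule exI[of _ 0]) simp
next
  case (step z x y)
  then obtain n :: nat and x' y' where *: "\<forall>i<n. x' i \<in> A \<and> y' i \<in> A" "z = (\<Sum>i<n. x' i * a * y' i)" by blast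
  have "(\<Sum>i<n. (x'(n := x)) i * a * (y'(n := y)) i) = (\<Sum>i<n. x' i * a * y' i)"
    by (intro sum.cong) auto
  then show ?case using * step
    by (intro exI[of _ "Suc n"] exI[of _ "x'(n := x)"] exI[of _ "y'(n := y)"]) (auto simp: less_Suc_eq)
qed

text \<open>An infinite projection \<open>q\<close> contains infinitely many orthogonal copies \<open>s\<^sup>i e s\<^sup>*\<^sup>i\<close> of the defect
  projection \<open>e = q - s s\<^sup>*\<close> of a proper isometry \<open>s\<close> under \<open>q\<close>.\<close>

lemma infinite_projection_matrix_units:
  assumes A: "cstar_subalgebra A UNIV" and q: "infinite_projection A q"
  shows "\<exists>e f g. e \<in> A \<and> e \<noteq> 0 \<and> (\<forall>i::nat. f i \<in> A \<and> f i * q = f i \<and> g i \<in> A \<and> q * g i = g i)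
    \<and> (\<forall>i j. f i * g j = (if i = j then e else 0))"
proof -
  note alg = cstar_subalgebraD(3-5)[OF A]
  obtain q' t where q': "projection A q" "projection A q'" "proj_less A q' q"
    and t: "t \<in> A" "t * op_adj t = q" "op_adj t * t = q'"
    using q by (auto simp: infinite_projection_def proj_equiv_def)
  have pq: "q \<in> A" "op_adj q = q" "q * q = q" "q' \<in> A" "op_adj q' = q'" "q' * q' = q'"
    using q' by (auto simp: projection_def)
  have le: "q * q' = q'" "q' * q = q'" and ne: "q \<noteq> q'"
    using proj_le_mult[OF pq(2,3,5,6)] q'(3) by (auto simp: proj_less_def)
  \<comment> \<open>The equivalence is read backwards: \<open>op_adj s * s = q\<close> and
    \<open>s * op_adj s = q'\<close>, an isometry of the corner of \<open>q\<close> with smaller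
    range.\<close>
  define s where "s = op_adj t"
  have s: "s \<in> A" "op_adj s * s = q" "s * op_adj s = q'" using t alg by (auto simp: s_def)
  have tq': "t * q' = t" by (rule partial_isometry_right) (use t pq in auto)
  have sq: "s * q = s" by (rule partial_isometry_right) (use s pq in auto)
  have q's: "q' * s = s" using op_adj_mult_eq[OF tq'] pq by (simp add: s_def)
  have qs: "q * s = s" using q's le by (metis mult.assoc)
  have s'q: "op_adj s * q = op_adj s" using op_adj_mult_eq[OF qs] pq by simp
  define e where "e = q - q'"
  have e: "e \<in> A" "e \<noteq> 0" "e * e = e" "e * q = e" "q * e = e" "op_adj e = e"
    using pq le ne alg by (auto simp: e_def algebra_simps)
  have es: "e * s = 0" by (simp add: e_def left_diff_distrib qs q's)
  have s'e: "op_adj s * e = 0" using op_adj_mult_eq[OF es] e by simp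
  \<comment> \<open>The factor \<open>e\<close> on the right covers \<open>i = 0\<close>, where the
    power is the ambient \<open>1\<close> and not \<open>q\<close>.\<close>
  have pow: "op_adj s ^ i * s ^ i * e = e" for i
  proof (induction i)
    case (Suc i)
    have "op_adj s ^ Suc i * s ^ Suc i * e = op_adj s ^ i * ((op_adj s * s) * (s ^ i * e))"
      by (simp only: power_Suc[of s] power_Suc2[of "op_adj s"] mult.assoc)
    also have "(op_adj s * s) * (s ^ i * e) = s ^ i * e"
      unfolding s by (cases i) (auto simp: e qs simp flip: mult.assoc)
    finally show ?case using Suc by (simp add: mult.assoc)
  qed simp
  have pow': "e * (op_adj s ^ i * s ^ i) = e" for i
    using op_adj_mult_eq[OF pow[of i]] e by (simp add: op_adj_power mult.assoc)
  define f where "f i = e * op_adj s ^ i" for i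
  define g where "g i = s ^ i * e" for i
  have "f i \<in> A" for i
    by (induction i) (use alg e s in \<open>auto simp: f_def power_Suc2 simp flip: mult.assoc simp del: power_Suc\<close>)
  moreover have "g i \<in> A" for i
    by (induction i) (use alg e s in \<open>auto simp: g_def mult.assoc\<close>)
  moreover have "f i * q = f i" for i
    by (cases i) (auto simp: f_def e power_Suc2 mult.assoc s'q simp del: power_Suc)
  moreover have "q * g i = g i" for i
    by (cases i) (auto simp: g_def e qs simp flip: mult.assoc)
  \<comment> \<open>Once the common powers of \<open>s\<close> are cancelled, a surplus factor
    leaves \<open>e * s\<close> or \<open>op_adj s * e\<close>, both zero.\<close>
  moreover have "f i * g j = (if i = j then e else 0)" for i j
  proof (cases i j rule: linorder_cases)
    case less
    then obtain k where k: "j = i + Suc k" using less_imp_Suc_add by auto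
    have "f i * g j = (e * (op_adj s ^ i * s ^ i)) * s * s ^ k * e"
      unfolding k f_def g_def power_add by (simp add: mult.assoc)
    also have "\<dots> = 0" by (simp add: pow' es)
    finally show ?thesis using less by simp
  next
    case equal
    then show ?thesis using pow'[of j] e(3) unfolding f_def g_def by (simp add: mult.assoc) (metis mult.assoc)
  next
    case greater
    then obtain k where k: "i = Suc k + j" using less_imp_Suc_add by (metis add.commute add_Suc_right)
    have "f i * g j = e * op_adj s ^ k * op_adj s * (op_adj s ^ j * s ^ j * e)"
      unfolding k f_def g_def power_add power_Suc2 by (simp add: mult.assoc)
    also have "\<dots> = 0" unfolding pow by (simp add: mult.assoc s'e)
    finally show ?thesis using greater by simp
  qed
  ultimately show ?thesis using e by blast
qed

text \<open>Row \<open>0\<close> uses the copies of \<open>e\<close> with even index, row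
  \<open>1\<close> those with odd index; different rows are orthogonal, while each reproduces
  \<open>u\<close> as the sum of the \<open>x i * e * y i\<close>.\<close>

lemma double_below_infinite_projection:
  assumes A: "cstar_subalgebra A UNIV"
    and fg: "\<And>i::nat. f i \<in> A \<and> f i * q = f i \<and> g i \<in> A \<and> q * g i = g i"
      "\<And>i j. f i * g j = (if i = j then e else 0)"
    and u: "u \<in> ideal_gen A e"
  shows "\<exists>X Y. (\<forall>k<2::nat. X k \<in> A \<and> Y k \<in> A) \<and> (\<forall>k<2. \<forall>l<2. X k * q * Y l = (if k = l then u else 0))"
proof -
  obtain n :: nat and x y where xy: "\<forall>i<n. x i \<in> A \<and> y i \<in> A" "u = (\<Sum>i<n. x i * e * y i)"
    using ideal_gen_sum[OF u] by blast
  define X where "X k = (\<Sum>i<n. x i * f (2 * i + k))" for k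
  define Y where "Y l = (\<Sum>j<n. g (2 * j + l) * y j)" for l
  have sumA: "sum h F \<in> A" if "\<And>i. i \<in> F \<Longrightarrow> h i \<in> A" for h and F :: "nat set"
    using that by (induction F rule: infinite_finite_induct) (auto intro: cstar_subalgebraD[OF A])
  have "X k \<in> A" "Y k \<in> A" for k
    unfolding X_def Y_def using xy fg by (auto intro!: sumA cstar_subalgebraD(4)[OF A])
  moreover have "X k * q * Y l = (if k = l then u else 0)" if "k < 2" "l < 2" for k l
  proof -
    have "X k * q = X k" unfolding X_def sum_distrib_right using fg by (auto simp: mult.assoc intro!: sum.cong)
    then have "X k * q * Y l = (\<Sum>i<n. \<Sum>j<n. x i * (f (2 * i + k) * g (2 * j + l)) * y j)"
      by (simp add: X_def Y_def sum_product mult.assoc)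
    also have "\<dots> = (\<Sum>i<n. \<Sum>j<n. if i = j then (if k = l then x i * e * y i else 0) else 0)"
    proof (intro sum.cong refl)
      fix i j
      \<comment> \<open>Uniqueness of quotient and remainder modulo two; this is where
        \<open>k\<close> and \<open>l\<close> have to be below \<open>2\<close>.\<close>
      have "2 * i + k = 2 * j + l \<longleftrightarrow> i = j \<and> k = l" using that by presburger
      then show "x i * (f (2 * i + k) * g (2 * j + l)) * y j
          = (if i = j then (if k = l then x i * e * y i else 0) else 0)"
        by (auto simp: fg(2))
    qed
    also have "\<dots> = (if k = l then u else 0)" by (simp add: xy(2))
    finally show ?thesis .
  qed
  ultimately show ?thesis by blast
qed

text \<open>A column \<open>\<alpha>\<close> and a row \<open>\<beta>\<close> give
  \<open>\<alpha> * mat1 a * \<beta>\<close> the entries \<open>x k * a * y l\<close>. The zero of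
  \<open>R\<close> fills the off-diagonal places of the block matrix.\<close>

lemma alg_properly_infinite_elem_iff:
  assumes "(0 :: 'r :: ring) \<in> R"
  shows "alg_properly_infinite_elem R a \<longleftrightarrow> a \<in> R \<and> a \<noteq> 0 \<and>
    (\<exists>x y. (\<forall>k<2::nat. x k \<in> R \<and> y k \<in> R) \<and> (\<forall>k<2. \<forall>l<2. x k * a * y l = (if k = l then a else 0)))"
proof -
  let ?D = "mat_oplus (mat1 a) (mat1 a)"
  have D: "?D \<in> carrier_mat 2 2" "mat1 a \<in> carrier_mat 1 1"
    unfolding mat_oplus_def mat1_def by (auto simp: numeral_2_eq_2)
  have Dij: "?D $$ (k, l) = (if k = l then a else 0)" if "k < 2" "l < 2" for k l
    using that by (auto simp: mat_oplus_def mat1_def less_2_cases_iff)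
  have entry: "(\<alpha> * mat1 a * \<beta>) $$ (k, l) = \<alpha> $$ (k, 0) * a * \<beta> $$ (0, l)"
    if "\<alpha> \<in> carrier_mat 2 1" "\<beta> \<in> carrier_mat 1 2" "k < 2" "l < 2" for \<alpha> \<beta> k l
    using that by (simp add: mat1_def scalar_prod_def)
  have "ring_subeq R ?D (mat1 a) \<longleftrightarrow>
    (\<exists>x y. (\<forall>k<2::nat. x k \<in> R \<and> y k \<in> R) \<and> (\<forall>k<2. \<forall>l<2. x k * a * y l = (if k = l then a else 0)))"
    (is "?L \<longleftrightarrow> ?R") if "a \<in> R"
  proof
    assume ?L
    then obtain \<alpha> \<beta> where *: "\<alpha> \<in> matrices_over R 2 1" "\<beta> \<in> matrices_over R 1 2" "?D = \<alpha> * mat1 a * \<beta>"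
      unfolding ring_subeq_def matrices_over_def using D by fastforce
    then have c: "\<alpha> \<in> carrier_mat 2 1" "\<beta> \<in> carrier_mat 1 2" by (auto simp: matrices_over_def)
    have "\<alpha> $$ (k, 0) \<in> R \<and> \<beta> $$ (0, k) \<in> R" if "k < 2" for k
    proof -
      have "\<alpha> $$ (k, 0) \<in> elements_mat \<alpha>" "\<beta> $$ (0, k) \<in> elements_mat \<beta>"
        using elements_matI[OF c(1), of k 0 "\<alpha> $$ (k, 0)"] elements_matI[OF c(2), of 0 k "\<beta> $$ (0, k)"] that
        by simp_all
      then show ?thesis using *(1,2) unfolding matrices_over_def by blast
    qed
    then show ?R using entry[OF c] Dij *(3)
      by (intro exI[of _ "\<lambda>k. \<alpha> $$ (k, 0)"] exI[of _ "\<lambda>l. \<beta> $$ (0, l)"]) metis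
  next
    assume ?R
    then obtain x y where xy: "\<forall>k<2::nat. x k \<in> R \<and> y k \<in> R"
      "\<forall>k<2. \<forall>l<2. x k * a * y l = (if k = l then a else 0)" by blast
    define \<alpha> where "\<alpha> = Matrix.mat 2 1 (\<lambda>(i, j). x i)"
    define \<beta> where "\<beta> = Matrix.mat 1 2 (\<lambda>(i, j). y j)"
    have c: "\<alpha> \<in> carrier_mat 2 1" "\<beta> \<in> carrier_mat 1 2" by (auto simp: \<alpha>_def \<beta>_def)
    have "\<alpha> \<in> matrices_over R 2 1" "\<beta> \<in> matrices_over R 1 2"
      using xy c by (auto simp: matrices_over_def \<alpha>_def \<beta>_def dest!: elements_matD)
    moreover have "?D = \<alpha> * mat1 a * \<beta>"
    proof (rule eq_matI)
      fix k l assume "k < dim_row (\<alpha> * mat1 a * \<beta>)" "l < dim_col (\<alpha> * mat1 a * \<beta>)"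
      then have "k < 2" "l < 2" using c by auto
      then show "?D $$ (k, l) = (\<alpha> * mat1 a * \<beta>) $$ (k, l)"
        using Dij entry[OF c] xy(2) by (simp add: \<alpha>_def \<beta>_def)
    qed (use D c in auto)
    moreover have "?D \<in> matrices_over R 2 2" "mat1 a \<in> matrices_over R 1 1"
      using D Dij that assms by (auto simp: matrices_over_def mat1_def dest!: elements_matD)
    ultimately show ?L unfolding ring_subeq_def by blast
  qed
  then show ?thesis unfolding alg_properly_infinite_elem_def by blast
qed

section \<open>Ample Hausdorff groupoids\<close>

lemma continuous_map_clopen_extend:
  fixes f :: "'a \<Rightarrow> 'b :: {topological_space, zero}"
  assumes "openin X S" "closedin X S" "continuous_map (subtopology X S) euclidean f"
  shows "continuous_map X euclidean (\<lambda>x. if x \<in> S then f x else 0)"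
proof -
  have SX: "S \<subseteq> topspace X" using assms(1) openin_subset by blast
  have "openin X {x \<in> topspace X. (if x \<in> S then f x else 0) \<in> T}" if T: "open T" for T
  proof -
    have "openin (subtopology X S) {x \<in> topspace (subtopology X S). f x \<in> T}"
      using openin_continuous_map_preimage[OF assms(3)] T by simp
    then have "openin X {x \<in> topspace (subtopology X S). f x \<in> T}"
      using openin_open_subtopology[OF assms(1)] by blast
    moreover have "openin X (topspace X - S)" using assms(2) by (simp add: closedin_def)
    ultimately have "openin X ({x \<in> topspace (subtopology X S). f x \<in> T} \<union> (if 0 \<in> T then topspace X - S else {}))"
      by auto
    moreover have "{x \<in> topspace X. (if x \<in> S then f x else 0) \<in> T}
        = {x \<in> topspace (subtopology X S). f x \<in> T} \<union> (if 0 \<in> T then topspace X - S else {})"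
      using SX by auto
    ultimately show ?thesis by simp
  qed
  then show ?thesis by (simp add: continuous_map_def)
qed

lemma continuous_map_complex_arith:
  fixes f g :: "'a \<Rightarrow> complex"
  assumes "continuous_map X euclidean f" "continuous_map X euclidean g"
  shows "continuous_map X euclidean (\<lambda>x. f x + g x)" "continuous_map X euclidean (\<lambda>x. f x * g x)"
  using assms by (simp_all add: continuous_map_atin tendsto_add tendsto_mult)

locale ample_hausdorff_groupoid =
  fixes G :: "'g groupoid"
  assumes ample: "ample G" and hausdorff: "Hausdorff_space (gtop G)"

sublocale ample_hausdorff_groupoid \<subseteq> topological_groupoid G
  using ample by (simp add: ample_def)

context topological_groupoid
begin

section \<open>Cancellation in a groupoid\<close>

lemma composable_iff:
  "(\<alpha>, \<beta>) \<in> composable G \<longleftrightarrow> \<alpha> \<in> arrows G \<and> \<beta> \<in> arrows G \<and> gsrc G \<alpha> = grng G \<beta>"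
  by (simp add: composable_def)

lemmas arrow_simps = rng_in src_in rng_rng src_rng rng_src src_src mul_in rng_mul src_mul
  rng_mul_self mul_src_self inv_in rng_inv src_inv mul_inv inv_mul composable_iff

lemma units_iff: "u \<in> gunits G \<longleftrightarrow> u \<in> arrows G \<and> grng G u = u"
  by (auto simp: gunits_def arrow_simps image_iff) metis

lemma unit_rng: "u \<in> gunits G \<Longrightarrow> grng G u = u"
  and unit_src: "u \<in> gunits G \<Longrightarrow> gsrc G u = u"
  and unit_arrow: "u \<in> gunits G \<Longrightarrow> u \<in> arrows G"
  by (auto simp: units_iff) (metis src_rng)

lemma rng_unit: "\<gamma> \<in> arrows G \<Longrightarrow> grng G \<gamma> \<in> gunits G"
  by (auto simp: units_iff arrow_simps)

lemma inv_mul_cancel: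
  "\<alpha> \<in> arrows G \<Longrightarrow> \<beta> \<in> arrows G \<Longrightarrow> gsrc G \<alpha> = grng G \<beta> \<Longrightarrow> gmul G (ginv G \<alpha>) (gmul G \<alpha> \<beta>) = \<beta>"
  using mul_assoc[of "ginv G \<alpha>" \<alpha> \<beta>] by (simp add: arrow_simps)

lemma mul_inv_cancel:
  "\<alpha> \<in> arrows G \<Longrightarrow> \<beta> \<in> arrows G \<Longrightarrow> gsrc G \<alpha> = grng G \<beta> \<Longrightarrow> gmul G (gmul G \<alpha> \<beta>) (ginv G \<beta>) = \<alpha>"
  using mul_assoc[of \<alpha> \<beta> "ginv G \<beta>"] mul_src_self[of \<alpha>] by (simp add: arrow_simps)

lemma inv_inv: "\<gamma> \<in> arrows G \<Longrightarrow> ginv G (ginv G \<gamma>) = \<gamma>"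
  using inv_mul_cancel[of "ginv G \<gamma>" \<gamma>] mul_src_self[of "ginv G (ginv G \<gamma>)"] by (simp add: arrow_simps)

lemma mul_inv_cancel_left:
  "\<alpha> \<in> arrows G \<Longrightarrow> \<beta> \<in> arrows G \<Longrightarrow> grng G \<alpha> = grng G \<beta> \<Longrightarrow> gmul G \<alpha> (gmul G (ginv G \<alpha>) \<beta>) = \<beta>"
  using inv_mul_cancel[of "ginv G \<alpha>" \<beta>] by (simp add: arrow_simps inv_inv)

lemma mul_inv_cancel_right:
  "\<alpha> \<in> arrows G \<Longrightarrow> \<beta> \<in> arrows G \<Longrightarrow> gsrc G \<alpha> = gsrc G \<beta> \<Longrightarrow> gmul G (gmul G \<alpha> (ginv G \<beta>)) \<beta> = \<alpha>"
  using mul_inv_cancel[of \<alpha> "ginv G \<beta>"] by (simp add: arrow_simps inv_inv)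

lemma inv_mul_inv:
  assumes "\<alpha> \<in> arrows G" "\<beta> \<in> arrows G" "gsrc G \<alpha> = gsrc G \<beta>"
  shows "ginv G (gmul G \<alpha> (ginv G \<beta>)) = gmul G \<beta> (ginv G \<alpha>)"
proof -
  let ?x = "gmul G \<alpha> (ginv G \<beta>)" and ?y = "gmul G \<beta> (ginv G \<alpha>)"
  have xy: "?x \<in> arrows G" "?y \<in> arrows G" "gsrc G ?x = grng G ?y" "grng G ?x = grng G \<alpha>" "gsrc G ?x = grng G \<beta>"
    using assms by (simp_all add: arrow_simps)
  have "gmul G ?x ?y = gmul G \<alpha> (gmul G (ginv G \<beta>) ?y)"
    by (rule mul_assoc) (use assms in \<open>simp_all add: arrow_simps\<close>)
  also have "\<dots> = grng G ?x"
    using assms inv_mul_cancel[of \<beta> "ginv G \<alpha>"] by (simp add: arrow_simps)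
  finally have "gmul G (ginv G ?x) (gmul G ?x ?y) = ginv G ?x"
    using mul_src_self[of "ginv G ?x"] xy by (simp add: arrow_simps)
  then show ?thesis using inv_mul_cancel[OF xy(1-3)] by simp
qed

text \<open>Its use: an off-diagonal matrix entry always evaluates the function at an arrow outside
  \<open>gunits G\<close>.\<close>

lemma mul_inv_self_unit:
  assumes "\<alpha> \<in> arrows G" "\<beta> \<in> arrows G" "gsrc G \<alpha> = gsrc G \<beta>" "gmul G \<alpha> (ginv G \<beta>) \<in> gunits G"
  shows "\<alpha> = \<beta>"
proof -
  have "gmul G \<alpha> (ginv G \<beta>) = grng G \<beta>"
    using unit_src[OF assms(4)] assms(1-3) by (simp add: arrow_simps)
  then show ?thesis using mul_inv_cancel_right[OF assms(1-3)] rng_mul_self[OF assms(2)] by simp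
qed

lemma continuous_rng: "continuous_map (gtop G) (gtop G) (grng G)"
  and continuous_src: "continuous_map (gtop G) (gtop G) (gsrc G)"
proof -
  have i: "continuous_map (gtop G) (subtopology (prod_topology (gtop G) (gtop G)) (composable G)) (\<lambda>\<gamma>. (\<gamma>, ginv G \<gamma>))"
    "continuous_map (gtop G) (subtopology (prod_topology (gtop G) (gtop G)) (composable G)) (\<lambda>\<gamma>. (ginv G \<gamma>, \<gamma>))"
    using continuous_inv
    by (auto simp: continuous_map_in_subtopology continuous_map_pairedI arrow_simps simp flip: arrows_def)
  show "continuous_map (gtop G) (gtop G) (grng G)"
    by (rule continuous_map_eq[OF continuous_map_compose[OF i(1) continuous_mul]])
      (simp add: arrow_simps flip: arrows_def)
  show "continuous_map (gtop G) (gtop G) (gsrc G)"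
    by (rule continuous_map_eq[OF continuous_map_compose[OF i(2) continuous_mul]])
      (simp add: arrow_simps flip: arrows_def)
qed

end

lemma open_bisectionD:
  assumes "open_bisection G B"
  shows "openin (gtop G) B" "B \<subseteq> arrows G" "inj_on (grng G) B" "inj_on (gsrc G) B"
    "openin (gunits_top G) (grng G ` B)"
    "continuous_map (subtopology (gtop G) (grng G ` B)) (gtop G) (inv_into B (grng G))"
proof -
  show o: "openin (gtop G) B" and u: "openin (gunits_top G) (grng G ` B)"
    using assms by (auto simp: open_bisection_def homeo_onto_open_def)
  then show B: "B \<subseteq> arrows G" using openin_subset unfolding arrows_def by blast
  have hr: "homeomorphic_map (subtopology (gtop G) B) (subtopology (gunits_top G) (grng G ` B)) (grng G)"
    and hs: "homeomorphic_map (subtopology (gtop G) B) (subtopology (gunits_top G) (gsrc G ` B)) (gsrc G)"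
    using assms by (auto simp: open_bisection_def homeo_onto_open_def)
  have tB: "topspace (subtopology (gtop G) B) = B" using B by (auto simp: arrows_def)
  show ir: "inj_on (grng G) B" using homeomorphic_imp_injective_map[OF hr] tB by simp
  show "inj_on (gsrc G) B" using homeomorphic_imp_injective_map[OF hs] tB by simp
  have sub: "subtopology (gunits_top G) (grng G ` B) = subtopology (gtop G) (grng G ` B)"
    using openin_subset[OF u] by (auto simp: gunits_top_def subtopology_subtopology Int_absorb1 inf_commute
        intro!: arg_cong[of _ _ "subtopology (gtop G)"])
  obtain g where g: "homeomorphic_maps (subtopology (gtop G) B) (subtopology (gtop G) (grng G ` B)) (grng G) g"
    using hr unfolding sub by (auto simp: homeomorphic_map_maps)
  then have "continuous_map (subtopology (gtop G) (grng G ` B)) (gtop G) g"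
    by (simp add: homeomorphic_maps_def continuous_map_in_subtopology)
  then show "continuous_map (subtopology (gtop G) (grng G ` B)) (gtop G) (inv_into B (grng G))"
  proof (rule continuous_map_eq)
    fix u assume "u \<in> topspace (subtopology (gtop G) (grng G ` B))"
    then obtain \<beta> where "\<beta> \<in> B" "u = grng G \<beta>" by auto
    then show "g u = inv_into B (grng G) u"
      using g ir tB by (auto simp: homeomorphic_maps_def inv_into_f_f)
  qed
qed

section \<open>Compact open bisections and the clopen unit space\<close>

context ample_hausdorff_groupoid
begin

lemma ample_basis:
  assumes "openin (gtop G) W" "\<gamma> \<in> W"
  obtains B where "compact_open_bisection G B" "\<gamma> \<in> B" "B \<subseteq> W"
  using ample assms unfolding ample_def by meson

lemma compact_closed: "compactin (gtop G) K \<Longrightarrow> closedin (gtop G) K"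
  using compactin_imp_closedin[OF hausdorff] .

text \<open>If an arrow and its range both lie in a bisection \<open>B\<close>, they coincide,
  because they have the same range and \<open>grng G\<close> is injective on \<open>B\<close>. For
  \<open>u\<close> in \<open>B\<close> such arrows form a neighbourhood of \<open>u\<close>.\<close>

lemma openin_units: "openin (gtop G) (gunits G)"
proof (subst openin_subopen, intro ballI)
  fix u assume u: "u \<in> gunits G"
  have "openin (gtop G) (topspace (gtop G))" by simp
  then obtain B where B: "compact_open_bisection G B" "u \<in> B"
    using ample_basis unit_arrow[OF u] unfolding arrows_def by metis
  then have ob: "open_bisection G B" by (simp add: compact_open_bisection_def)
  let ?T = "{\<gamma> \<in> topspace (gtop G). grng G \<gamma> \<in> B} \<inter> B"
  have "openin (gtop G) ?T"
    using openin_continuous_map_preimage[OF continuous_rng] open_bisectionD(1)[OF ob] by blast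
  moreover have "u \<in> ?T" using B u unit_arrow unit_rng by (auto simp: arrows_def)
  moreover have "?T \<subseteq> gunits G"
  proof
    fix \<gamma> assume \<gamma>: "\<gamma> \<in> ?T"
    then have "grng G (grng G \<gamma>) = grng G \<gamma>" by (simp add: arrow_simps arrows_def)
    then have "grng G \<gamma> = \<gamma>" using open_bisectionD(3)[OF ob] \<gamma> by (auto dest: inj_onD)
    then show "\<gamma> \<in> gunits G" using \<gamma> by (simp add: units_iff arrows_def)
  qed
  ultimately show "\<exists>T. openin (gtop G) T \<and> u \<in> T \<and> T \<subseteq> gunits G" by blast
qed

text \<open>The units are the fixed points of the continuous map \<open>grng G\<close>, and the
  space is Hausdorff.\<close>

lemma closedin_units: "closedin (gtop G) (gunits G)"
proof -
  have "gunits G = {\<gamma> \<in> topspace (gtop G). grng G \<gamma> = id \<gamma>}" by (auto simp: units_iff arrows_def)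
  then show ?thesis
    using closedin_continuous_maps_eq[OF hausdorff continuous_rng, of id] by simp
qed

lemma openin_units_top_iff: "openin (gunits_top G) U \<longleftrightarrow> openin (gtop G) U \<and> U \<subseteq> gunits G"
  unfolding gunits_top_def by (rule openin_open_subtopology[OF openin_units])

lemma compact_open_units_iff:
  "compact_open_units G U \<longleftrightarrow> openin (gtop G) U \<and> compactin (gtop G) U \<and> U \<subseteq> gunits G"
  unfolding compact_open_units_def openin_units_top_iff
  by (auto simp: gunits_top_def compactin_subtopology)

lemma compact_open_bisectionD:
  assumes "compact_open_bisection G B"
  shows "openin (gtop G) B" "B \<subseteq> arrows G" "inj_on (grng G) B" "inj_on (gsrc G) B"
    "compactin (gtop G) B" "closedin (gtop G) B" "compact_open_units G (grng G ` B)"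
    "continuous_map (subtopology (gtop G) (grng G ` B)) (gtop G) (inv_into B (grng G))"
proof -
  have B: "compactin (gtop G) B" "open_bisection G B" using assms by (auto simp: compact_open_bisection_def)
  show "compact_open_units G (grng G ` B)"
    using open_bisectionD(5)[OF B(2)] image_compactin[OF B(1) continuous_rng]
    unfolding compact_open_units_iff openin_units_top_iff by blast
  show "compactin (gtop G) B" "closedin (gtop G) B" using B compact_closed by auto
  show "openin (gtop G) B" "B \<subseteq> arrows G" "inj_on (grng G) B" "inj_on (gsrc G) B"
    "continuous_map (subtopology (gtop G) (grng G ` B)) (gtop G) (inv_into B (grng G))"
    by (fact open_bisectionD[OF B(2)])+
qed

lemma compact_bisection_cover:
  assumes "compactin (gtop G) K" "openin (gtop G) W" "K \<subseteq> W"
  obtains \<B> where "finite \<B>" "\<And>B. B \<in> \<B> \<Longrightarrow> compact_open_bisection G B \<and> B \<subseteq> W" "K \<subseteq> \<Union>\<B>"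
proof -
  let ?U = "{B. compact_open_bisection G B \<and> B \<subseteq> W}"
  have "\<forall>U\<in>?U. openin (gtop G) U" using compact_open_bisectionD by blast
  moreover have "K \<subseteq> \<Union>?U"
  proof
    fix k assume "k \<in> K"
    then show "k \<in> \<Union>?U" using ample_basis[OF assms(2), of k] assms(3) by blast
  qed
  ultimately obtain \<B> where "finite \<B>" "\<B> \<subseteq> ?U" "K \<subseteq> \<Union>\<B>"
    using assms(1) unfolding compactin_def by meson
  then show ?thesis using that by blast
qed

subsection \<open>Continuous functions with compact support\<close>

text \<open>Compact sets are closed here, so any compact set off which \<open>f\<close> vanishes can
  stand for the closure of the support.\<close>

lemma Cc_iff: "f \<in> Cc G \<longleftrightarrow> continuous_map (gtop G) euclidean f \<and> (\<exists>K. compactin (gtop G) K \<and> (\<forall>\<gamma>. \<gamma> \<notin> K \<longrightarrow> f \<gamma> = 0))"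
proof
  assume f: "f \<in> Cc G"
  let ?S = "{\<gamma> \<in> arrows G. f \<gamma> \<noteq> 0}"
  have "?S \<subseteq> Abstract_Topology.closure_of (gtop G) ?S"
    by (rule closure_of_subset) (auto simp: arrows_def)
  then show "continuous_map (gtop G) euclidean f \<and> (\<exists>K. compactin (gtop G) K \<and> (\<forall>\<gamma>. \<gamma> \<notin> K \<longrightarrow> f \<gamma> = 0))"
    using f unfolding Cc_def by (auto intro!: exI[of _ "Abstract_Topology.closure_of (gtop G) ?S"])
next
  assume *: "continuous_map (gtop G) euclidean f \<and> (\<exists>K. compactin (gtop G) K \<and> (\<forall>\<gamma>. \<gamma> \<notin> K \<longrightarrow> f \<gamma> = 0))"
  then obtain K where K: "compactin (gtop G) K" "\<And>\<gamma>. \<gamma> \<notin> K \<Longrightarrow> f \<gamma> = 0" by blast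
  let ?S = "{\<gamma> \<in> arrows G. f \<gamma> \<noteq> 0}"
  have "Abstract_Topology.closure_of (gtop G) ?S \<subseteq> K"
    by (rule closure_of_minimal) (use K compact_closed in auto)
  then have "compactin (gtop G) (Abstract_Topology.closure_of (gtop G) ?S)"
    using K(1) closed_compactin closedin_closure_of by metis
  moreover have "K \<subseteq> arrows G" using compactin_subset_topspace[OF K(1)] by (simp add: arrows_def)
  ultimately show "f \<in> Cc G" using * K(2) by (auto simp: Cc_def)
qed

lemma CcI:
  "continuous_map (gtop G) euclidean f \<Longrightarrow> compactin (gtop G) K \<Longrightarrow> (\<And>\<gamma>. \<gamma> \<notin> K \<Longrightarrow> f \<gamma> = 0) \<Longrightarrow> f \<in> Cc G"
  unfolding Cc_iff by blast

lemma Cc_outside: "f \<in> Cc G \<Longrightarrow> \<gamma> \<notin> arrows G \<Longrightarrow> f \<gamma> = 0"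
  by (simp add: Cc_def)

lemma Cc_zero: "(\<lambda>_. 0) \<in> Cc G"
  by (rule CcI[of _ "{}"]) auto

lemma Cc_add:
  assumes "f \<in> Cc G" "g \<in> Cc G" shows "(\<lambda>\<gamma>. f \<gamma> + g \<gamma>) \<in> Cc G"
proof -
  obtain K where K: "compactin (gtop G) K" "\<And>\<gamma>. \<gamma> \<notin> K \<Longrightarrow> f \<gamma> = 0" using assms by (auto simp: Cc_iff)
  obtain L where L: "compactin (gtop G) L" "\<And>\<gamma>. \<gamma> \<notin> L \<Longrightarrow> g \<gamma> = 0" using assms by (auto simp: Cc_iff)
  show ?thesis
  proof (rule CcI)
    show "continuous_map (gtop G) euclidean (\<lambda>\<gamma>. f \<gamma> + g \<gamma>)"
      by (rule continuous_map_complex_arith) (use assms in \<open>simp_all add: Cc_iff\<close>)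
    show "compactin (gtop G) (K \<union> L)" using K L by (simp add: compactin_Un)
  qed (use K L in simp)
qed

lemma Cc_cmult:
  assumes "f \<in> Cc G" shows "(\<lambda>\<gamma>. c * f \<gamma>) \<in> Cc G"
proof -
  obtain K where "compactin (gtop G) K" "\<And>\<gamma>. \<gamma> \<notin> K \<Longrightarrow> f \<gamma> = 0" using assms by (auto simp: Cc_iff)
  then show ?thesis using continuous_map_complex_arith(2)[of "gtop G" "\<lambda>_. c" f] assms
    by (intro CcI[of _ K]) (simp_all add: Cc_iff)
qed

lemma Cc_star:
  assumes "f \<in> Cc G" shows "(\<lambda>\<gamma>. if \<gamma> \<in> arrows G then cnj (f (ginv G \<gamma>)) else 0) \<in> Cc G"
proof -
  obtain K where K: "compactin (gtop G) K" "\<And>\<gamma>. \<gamma> \<notin> K \<Longrightarrow> f \<gamma> = 0" using assms by (auto simp: Cc_iff)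
  have "continuous_map (gtop G) euclidean (\<lambda>\<gamma>. f (ginv G \<gamma>))"
    using continuous_map_compose[OF continuous_inv, of euclidean f] assms by (simp add: Cc_iff o_def)
  moreover have "continuous_map euclidean euclidean cnj"
    unfolding continuous_map_iff_continuous2 by (intro continuous_intros)
  ultimately have c: "continuous_map (gtop G) euclidean (\<lambda>\<gamma>. cnj (f (ginv G \<gamma>)))"
    using continuous_map_compose[of "gtop G" euclidean "\<lambda>\<gamma>. f (ginv G \<gamma>)" euclidean cnj] by (simp add: o_def)
  show ?thesis
  proof (rule CcI)
    show "continuous_map (gtop G) euclidean (\<lambda>\<gamma>. if \<gamma> \<in> arrows G then cnj (f (ginv G \<gamma>)) else 0)"
      using continuous_map_clopen_extend[of "gtop G" "arrows G"] c unfolding arrows_def by simp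
    show "compactin (gtop G) (ginv G ` K)" by (rule image_compactin[OF K(1) continuous_inv])
    fix \<gamma> assume "\<gamma> \<notin> ginv G ` K"
    then have "\<gamma> \<in> arrows G \<Longrightarrow> ginv G \<gamma> \<notin> K" using inv_inv by (metis image_eqI)
    then show "(if \<gamma> \<in> arrows G then cnj (f (ginv G \<gamma>)) else 0) = 0" using K by simp
  qed
qed

lemma Cc_restrict:
  assumes "f \<in> Cc G" "openin (gtop G) S" "closedin (gtop G) S"
  shows "(\<lambda>\<gamma>. if \<gamma> \<in> S then f \<gamma> else 0) \<in> Cc G"
proof -
  obtain K where K: "compactin (gtop G) K" "\<And>\<gamma>. \<gamma> \<notin> K \<Longrightarrow> f \<gamma> = 0" using assms by (auto simp: Cc_iff)
  then show ?thesis
    using continuous_map_clopen_extend[OF assms(2,3), of f] assms(1)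
    by (intro CcI[of _ K]) (auto simp: Cc_iff continuous_map_from_subtopology)
qed

lemma Cc_indicator:
  assumes "openin (gtop G) S" "compactin (gtop G) S"
  shows "(indicator S :: 'g \<Rightarrow> complex) \<in> Cc G"
proof -
  have "indicator S = (\<lambda>\<gamma>. if \<gamma> \<in> S then 1 else 0 :: complex)" by (auto simp: indicator_def)
  then show ?thesis
    using continuous_map_clopen_extend[OF assms(1) compact_closed[OF assms(2)], of "\<lambda>_. 1 :: complex"] assms(2)
    by (intro CcI[of _ S]) auto
qed

lemma Cc_bounded:
  assumes "f \<in> Cc G" shows "\<exists>M. \<forall>\<gamma>. cmod (f \<gamma>) \<le> M"
proof -
  obtain K where K: "compactin (gtop G) K" "\<And>\<gamma>. \<gamma> \<notin> K \<Longrightarrow> f \<gamma> = 0" using assms by (auto simp: Cc_iff)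
  have "compactin euclidean (f ` K)" using image_compactin[OF K(1), of euclidean f] assms by (simp add: Cc_iff)
  then have "bounded (f ` K)" by (simp add: compact_imp_bounded)
  then obtain M where "\<And>\<gamma>. \<gamma> \<in> K \<Longrightarrow> cmod (f \<gamma>) \<le> M" by (auto simp: bounded_iff)
  then have "cmod (f \<gamma>) \<le> max M 0" for \<gamma> using K(2)[of \<gamma>] by (cases "\<gamma> \<in> K") (auto simp: max.coboundedI1)
  then show ?thesis by blast
qed

text \<open>Cover the support by finitely many compact open bisections and split off one at a time;
  they are clopen, so both restrictions stay continuous.\<close>

lemma Cc_induct [consumes 1, case_names zero add bisection]:
  assumes "f \<in> Cc G"
    and zero: "P (\<lambda>_. 0)"
    and add: "\<And>f g. f \<in> Cc G \<Longrightarrow> g \<in> Cc G \<Longrightarrow> P f \<Longrightarrow> P g \<Longrightarrow> P (\<lambda>\<gamma>. f \<gamma> + g \<gamma>)"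
    and bis: "\<And>f B. f \<in> Cc G \<Longrightarrow> compact_open_bisection G B \<Longrightarrow> (\<And>\<gamma>. \<gamma> \<notin> B \<Longrightarrow> f \<gamma> = 0) \<Longrightarrow> P f"
  shows "P f"
proof -
  have *: "P f" if "finite \<B>" "\<And>B. B \<in> \<B> \<Longrightarrow> compact_open_bisection G B"
    "f \<in> Cc G" "\<And>\<gamma>. \<gamma> \<notin> \<Union>\<B> \<Longrightarrow> f \<gamma> = 0" for \<B> f
    using that
  proof (induction \<B> arbitrary: f rule: finite_induct)
    case empty
    then have "f = (\<lambda>_. 0)" by auto
    then show ?case using zero by simp
  next
    case (insert B \<B>)
    have B: "compact_open_bisection G B" using insert by simp
    let ?f1 = "\<lambda>\<gamma>. if \<gamma> \<in> B then f \<gamma> else 0"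
    let ?f2 = "\<lambda>\<gamma>. if \<gamma> \<in> topspace (gtop G) - B then f \<gamma> else 0"
    note BD = compact_open_bisectionD[OF B]
    have 1: "?f1 \<in> Cc G" using Cc_restrict insert.prems(2) BD by blast
    have 2: "?f2 \<in> Cc G" by (rule Cc_restrict[OF insert.prems(2)]) (use BD in auto)
    have "P ?f1" using bis[OF 1 B] by simp
    moreover have "P ?f2" using insert.prems by (intro insert.IH 2) auto
    ultimately have "P (\<lambda>\<gamma>. ?f1 \<gamma> + ?f2 \<gamma>)" using add 1 2 by blast
    moreover have "(\<lambda>\<gamma>. ?f1 \<gamma> + ?f2 \<gamma>) = f"
      using Cc_outside[OF insert.prems(2)] by (auto simp: fun_eq_iff arrows_def)
    ultimately show ?case by simp
  qed
  obtain K where K: "compactin (gtop G) K" "\<And>\<gamma>. \<gamma> \<notin> K \<Longrightarrow> f \<gamma> = 0" using assms by (auto simp: Cc_iff)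
  obtain \<B> where \<B>: "finite \<B>" "\<And>B. B \<in> \<B> \<Longrightarrow> compact_open_bisection G B \<and> B \<subseteq> topspace (gtop G)" "K \<subseteq> \<Union>\<B>"
    using compact_bisection_cover[OF K(1) openin_topspace compactin_subset_topspace[OF K(1)]] by metis
  show ?thesis
  proof (rule *)
    show "finite \<B>" "f \<in> Cc G" by fact+
    show "compact_open_bisection G B" if "B \<in> \<B>" for B using \<B>(2)[OF that] by simp
    show "f \<gamma> = 0" if "\<gamma> \<notin> \<Union>\<B>" for \<gamma> using K(2)[of \<gamma>] that \<B>(3) by blast
  qed
qed

text \<open>A bisection meets each source fibre at most once. This makes the infinite sum in
  \<open>regular_rep\<close> a finite one.\<close>

lemma Cc_finite_fibre:
  assumes "f \<in> Cc G" shows "finite {\<alpha> \<in> arrows G. gsrc G \<alpha> = u \<and> f \<alpha> \<noteq> 0}"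
  using assms
proof (induction rule: Cc_induct)
  case (add f g)
  show ?case
    by (rule finite_subset[OF _ finite_UnI[OF add.IH]]) auto
next
  case (bisection f B)
  have "inj_on (gsrc G) {\<alpha> \<in> arrows G. gsrc G \<alpha> = u \<and> f \<alpha> \<noteq> 0}"
    using bisection compact_open_bisectionD(4)[OF bisection(2)] by (auto intro: inj_on_subset)
  moreover have "finite (gsrc G ` {\<alpha> \<in> arrows G. gsrc G \<alpha> = u \<and> f \<alpha> \<noteq> 0})"
    by (rule finite_subset[of _ "{u}"]) auto
  ultimately show ?case using finite_imageD by blast
qed simp

subsection \<open>The regular representation\<close>

text \<open>The matrix entry from \<open>delta \<gamma>\<close> to \<open>delta \<eta>\<close>: the
  only arrow \<open>\<alpha>\<close> with \<open>gmul G \<alpha> \<gamma> = \<eta>\<close> is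
  \<open>gmul G \<eta> (ginv G \<gamma>)\<close>.\<close>

definition rep_coord :: "('g \<Rightarrow> complex) \<Rightarrow> 'g \<Rightarrow> 'g \<Rightarrow> complex" where
  "rep_coord f \<gamma> \<eta> = (if \<gamma> \<in> arrows G \<and> \<eta> \<in> arrows G \<and> gsrc G \<eta> = gsrc G \<gamma> then f (gmul G \<eta> (ginv G \<gamma>)) else 0)"

text \<open>The definite description is evaluated by exhibiting one operator with the right entries,
  since basis vectors determine it. Sums, adjoints and products are then compared entry by
  entry.\<close>

lemma regular_rep_eqI:
  assumes f: "f \<in> Cc G" and T: "\<And>\<gamma> \<eta>. Rep_ell2 (op_apply T (delta \<gamma>)) \<eta> = rep_coord f \<gamma> \<eta>"
  shows "regular_rep G f = T"
proof -
  let ?R = "\<lambda>\<gamma>. if \<gamma> \<in> arrows G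
      then \<Sum>\<^sub>\<infinity>\<alpha> | \<alpha> \<in> arrows G \<and> gsrc G \<alpha> = grng G \<gamma>. f \<alpha> *\<^sub>C delta (gmul G \<alpha> \<gamma>) else 0"
  have "op_apply T (delta \<gamma>) = ?R \<gamma>" for \<gamma>
  proof (cases "\<gamma> \<in> arrows G")
    case \<gamma>: True
    let ?F = "{\<alpha> \<in> arrows G. gsrc G \<alpha> = grng G \<gamma> \<and> f \<alpha> \<noteq> 0}"
    have F: "finite ?F" by (rule Cc_finite_fibre[OF f])
    have "?R \<gamma> = (\<Sum>\<^sub>\<infinity>\<alpha>\<in>?F. f \<alpha> *\<^sub>C delta (gmul G \<alpha> \<gamma>))"
    proof -
      have "0 *\<^sub>C x = 0" for x :: "'g ell2" by (rule ell2_eqI) (simp add: ell2_coords)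
      then show ?thesis using \<gamma> by (auto intro!: infsum_cong_neutral)
    qed
    then have R: "?R \<gamma> = (\<Sum>\<alpha>\<in>?F. f \<alpha> *\<^sub>C delta (gmul G \<alpha> \<gamma>))" using F by simp
    have "Rep_ell2 (?R \<gamma>) \<eta> = rep_coord f \<gamma> \<eta>" for \<eta>
    proof -
      let ?\<alpha> = "gmul G \<eta> (ginv G \<gamma>)"
      have "Rep_ell2 (?R \<gamma>) \<eta> = (\<Sum>\<alpha>\<in>?F. if \<eta> = gmul G \<alpha> \<gamma> then f \<alpha> else 0)"
        unfolding R ell2_coord_sum by (rule sum.cong) (auto simp: ell2_coords)
      also have "\<dots> = (\<Sum>\<alpha>\<in>?F. if \<alpha> = ?\<alpha> \<and> \<eta> \<in> arrows G \<and> gsrc G \<eta> = gsrc G \<gamma> then f ?\<alpha> else 0)"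
      proof (rule sum.cong[OF refl])
        fix \<alpha> assume \<alpha>: "\<alpha> \<in> ?F"
        have "\<eta> = gmul G \<alpha> \<gamma> \<longleftrightarrow> \<alpha> = ?\<alpha> \<and> \<eta> \<in> arrows G \<and> gsrc G \<eta> = gsrc G \<gamma>"
          using \<alpha> \<gamma> mul_inv_cancel[of \<alpha> \<gamma>] mul_inv_cancel_right[of \<eta> \<gamma>] by (auto simp: arrow_simps)
        then show "(if \<eta> = gmul G \<alpha> \<gamma> then f \<alpha> else 0)
            = (if \<alpha> = ?\<alpha> \<and> \<eta> \<in> arrows G \<and> gsrc G \<eta> = gsrc G \<gamma> then f ?\<alpha> else 0)" by auto
      qed
      also have "\<dots> = rep_coord f \<gamma> \<eta>"
      proof (cases "\<eta> \<in> arrows G \<and> gsrc G \<eta> = gsrc G \<gamma>")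
        case True
        then show ?thesis using F \<gamma> by (auto simp: rep_coord_def arrow_simps)
      qed (auto simp: rep_coord_def)
      finally show ?thesis .
    qed
    then show ?thesis by (intro ell2_eqI) (simp only: T)
  next
    case False
    then show ?thesis by (intro ell2_eqI) (simp add: T rep_coord_def ell2_coords)
  qed
  then show ?thesis
    unfolding regular_rep_def by (intro the_equality) (auto intro: op_eqI_delta)
qed

lemma bisection_section:
  assumes "compact_open_bisection G B" "\<eta> \<in> arrows G" "grng G \<eta> \<in> grng G ` B"
  defines "\<beta> \<equiv> inv_into B (grng G) (grng G \<eta>)"
  shows "\<beta> \<in> B" "\<beta> \<in> arrows G" "grng G \<beta> = grng G \<eta>"
  unfolding \<beta>_def using assms(3) compact_open_bisectionD(2)[OF assms(1)] inv_into_into[OF assms(3)] f_inv_into_f[OF assms(3)]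
  by auto

text \<open>At \<open>\<eta>\<close> only the arrow \<open>\<beta> \<eta>\<close> of
  \<open>B\<close> with the same range contributes, so the operator is a weighted composition. The
  formula on all vectors \<open>x\<close> is what products of operators use.\<close>

lemma regular_rep_bisection:
  assumes f: "f \<in> Cc G" and B: "compact_open_bisection G B" and fB: "\<And>\<gamma>. \<gamma> \<notin> B \<Longrightarrow> f \<gamma> = 0"
  defines "\<beta> \<equiv> \<lambda>\<eta>. inv_into B (grng G) (grng G \<eta>)"
  shows "\<exists>T. (\<forall>x \<eta>. Rep_ell2 (op_apply T x) \<eta> =
      (if \<eta> \<in> arrows G \<and> grng G \<eta> \<in> grng G ` B
       then f (\<beta> \<eta>) * Rep_ell2 x (gmul G (ginv G (\<beta> \<eta>)) \<eta>) else 0))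
    \<and> (\<forall>\<gamma> \<eta>. Rep_ell2 (op_apply T (delta \<gamma>)) \<eta> = rep_coord f \<gamma> \<eta>)"
proof -
  have sec: "\<beta> \<eta> \<in> B" "\<beta> \<eta> \<in> arrows G" "grng G (\<beta> \<eta>) = grng G \<eta>"
    if "\<eta> \<in> arrows G" "grng G \<eta> \<in> grng G ` B" for \<eta>
    using bisection_section[OF B that] by (simp_all add: \<beta>_def)
  define w where "w \<eta> = (if \<eta> \<in> arrows G \<and> grng G \<eta> \<in> grng G ` B then f (\<beta> \<eta>) else 0)" for \<eta>
  define \<tau> where "\<tau> \<eta> = gmul G (ginv G (\<beta> \<eta>)) \<eta>" for \<eta>
  have inv: "\<eta> \<in> arrows G \<and> \<beta> \<eta> \<in> B \<and> grng G (\<tau> \<eta>) = gsrc G (\<beta> \<eta>) \<and> \<tau> \<eta> \<in> arrows G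
     \<and> gsrc G (\<tau> \<eta>) = gsrc G \<eta> \<and> grng G \<eta> \<in> grng G ` B"
    if "w \<eta> \<noteq> 0" for \<eta>
  proof -
    have \<eta>: "\<eta> \<in> arrows G" "grng G \<eta> \<in> grng G ` B" using that by (auto simp: w_def split: if_splits)
    then show ?thesis using sec[OF \<eta>] by (simp add: \<tau>_def arrow_simps)
  qed
  have mul: "gmul G (\<beta> \<eta>) (\<tau> \<eta>) = \<eta>" if "w \<eta> \<noteq> 0" for \<eta>
    unfolding \<tau>_def by (rule mul_inv_cancel_left) (use inv[OF that] sec[of \<eta>] in auto)
  \<comment> \<open>The range of \<open>\<tau> \<eta>\<close> is the source of
    \<open>\<beta> \<eta>\<close>, which determines \<open>\<beta> \<eta>\<close> in
    \<open>B\<close> and then \<open>\<eta>\<close>.\<close>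
  have "inj_on \<tau> {\<eta>. w \<eta> \<noteq> 0}"
  proof (rule inj_onI)
    fix \<eta> \<eta>' assume *: "\<eta> \<in> {\<eta>. w \<eta> \<noteq> 0}" "\<eta>' \<in> {\<eta>. w \<eta> \<noteq> 0}" "\<tau> \<eta> = \<tau> \<eta>'"
    then have "gsrc G (\<beta> \<eta>) = gsrc G (\<beta> \<eta>')" using inv[of \<eta>] inv[of \<eta>'] by auto
    then have "\<beta> \<eta> = \<beta> \<eta>'" using inv[of \<eta>] inv[of \<eta>'] * compact_open_bisectionD(4)[OF B] by (auto dest: inj_onD)
    then have "gmul G (\<beta> \<eta>) (\<tau> \<eta>) = gmul G (\<beta> \<eta>') (\<tau> \<eta>')" using *(3) by simp
    moreover have "w \<eta> \<noteq> 0" "w \<eta>' \<noteq> 0" using * by auto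
    ultimately show "\<eta> = \<eta>'" by (simp only: mul not_False_eq_True)
  qed
  moreover obtain M where M: "\<And>\<gamma>. cmod (f \<gamma>) \<le> M" using Cc_bounded[OF f] by blast
  moreover have "cmod (w \<eta>) \<le> M" for \<eta> using M order_trans[OF norm_ge_zero M] by (auto simp: w_def)
  ultimately obtain T where T: "\<And>x \<eta>. Rep_ell2 (op_apply T x) \<eta> = w \<eta> * Rep_ell2 x (\<tau> \<eta>)"
    using weighted_composition_op_ex[of w M \<tau>] by blast
  have "Rep_ell2 (op_apply T (delta \<gamma>)) \<eta> = rep_coord f \<gamma> \<eta>" for \<gamma> \<eta>
  proof (cases "w \<eta> \<noteq> 0 \<and> \<tau> \<eta> = \<gamma>")
    case True
    then have w: "w \<eta> \<noteq> 0" and \<tau>: "\<tau> \<eta> = \<gamma>" by auto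
    have "gmul G (gmul G (\<beta> \<eta>) (\<tau> \<eta>)) (ginv G (\<tau> \<eta>)) = \<beta> \<eta>"
      by (rule mul_inv_cancel) (use inv[OF w] compact_open_bisectionD(2)[OF B] in auto)
    then have "gmul G \<eta> (ginv G \<gamma>) = \<beta> \<eta>" by (simp only: mul[OF w] \<tau>[symmetric])
    moreover have "\<gamma> \<in> arrows G" "\<eta> \<in> arrows G" "gsrc G \<eta> = gsrc G \<gamma>" "grng G \<eta> \<in> grng G ` B"
      using inv[OF w] \<tau> by simp_all
    ultimately have "rep_coord f \<gamma> \<eta> = w \<eta>" by (simp add: rep_coord_def w_def)
    then show ?thesis by (simp add: T ell2_coords \<tau>)
  next
    case False
    have "rep_coord f \<gamma> \<eta> = 0"
    proof (rule ccontr)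
      assume "rep_coord f \<gamma> \<eta> \<noteq> 0"
      then have a: "\<gamma> \<in> arrows G" "\<eta> \<in> arrows G" "gsrc G \<eta> = gsrc G \<gamma>" and f0: "f (gmul G \<eta> (ginv G \<gamma>)) \<noteq> 0"
        by (auto simp: rep_coord_def split: if_splits)
      let ?\<alpha> = "gmul G \<eta> (ginv G \<gamma>)"
      have \<alpha>: "?\<alpha> \<in> B" "grng G ?\<alpha> = grng G \<eta>" using fB f0 a by (auto simp: arrow_simps)
      then have \<eta>B: "grng G \<eta> \<in> grng G ` B" by (metis imageI)
      have \<beta>\<alpha>: "\<beta> \<eta> = ?\<alpha>"
        by (rule inj_onD[OF compact_open_bisectionD(3)[OF B]]) (use sec[OF a(2) \<eta>B] \<alpha> in simp_all)
      have "\<tau> \<eta> = gmul G (ginv G ?\<alpha>) (gmul G ?\<alpha> \<gamma>)"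
        using mul_inv_cancel_right[OF a(2,1,3)] by (simp add: \<tau>_def \<beta>\<alpha>)
      also have "\<dots> = \<gamma>" by (rule inv_mul_cancel) (use a in \<open>simp_all add: arrow_simps\<close>)
      finally have "\<tau> \<eta> = \<gamma>" .
      moreover have "w \<eta> = f ?\<alpha>" using a \<eta>B by (simp add: w_def \<beta>\<alpha>)
      ultimately show False using False f0 by simp
    qed
    then show ?thesis using False by (auto simp: T ell2_coords)
  qed
  then show ?thesis using T by (intro exI[of _ T]) (auto simp: w_def \<tau>_def)
qed

lemma regular_rep_coord:
  assumes "f \<in> Cc G" shows "Rep_ell2 (op_apply (regular_rep G f) (delta \<gamma>)) \<eta> = rep_coord f \<gamma> \<eta>"
proof -
  have "\<exists>T. \<forall>\<gamma> \<eta>. Rep_ell2 (op_apply T (delta \<gamma>)) \<eta> = rep_coord f \<gamma> \<eta>"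
    using assms
  proof (induction rule: Cc_induct)
    case zero
    show ?case by (rule exI[of _ 0]) (simp add: rep_coord_def op_apply_op ell2_coords)
  next
    case (add f g)
    then obtain S T where "\<forall>\<gamma> \<eta>. Rep_ell2 (op_apply S (delta \<gamma>)) \<eta> = rep_coord f \<gamma> \<eta>"
      "\<forall>\<gamma> \<eta>. Rep_ell2 (op_apply T (delta \<gamma>)) \<eta> = rep_coord g \<gamma> \<eta>" by blast
    then show ?case by (intro exI[of _ "S + T"]) (simp add: rep_coord_def op_apply_op ell2_coords)
  next
    case (bisection f B)
    then show ?case using regular_rep_bisection by blast
  qed
  then obtain T where T: "\<And>\<gamma> \<eta>. Rep_ell2 (op_apply T (delta \<gamma>)) \<eta> = rep_coord f \<gamma> \<eta>" by blast
  then show ?thesis using regular_rep_eqI[OF assms T] by simp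
qed

lemma regular_rep_add:
  "f \<in> Cc G \<Longrightarrow> g \<in> Cc G \<Longrightarrow> regular_rep G (\<lambda>\<gamma>. f \<gamma> + g \<gamma>) = regular_rep G f + regular_rep G g"
  by (rule regular_rep_eqI[OF Cc_add])
    (simp_all add: op_apply_op ell2_coords regular_rep_coord, simp add: rep_coord_def)

lemma regular_rep_cmult: "f \<in> Cc G \<Longrightarrow> regular_rep G (\<lambda>\<gamma>. c * f \<gamma>) = op_scaleC c (regular_rep G f)"
  by (rule regular_rep_eqI[OF Cc_cmult])
    (simp_all add: op_apply_op ell2_coords regular_rep_coord, simp add: rep_coord_def)

lemma regular_rep_zero: "regular_rep G (\<lambda>_. 0) = 0"
  by (rule regular_rep_eqI[OF Cc_zero]) (simp add: op_apply_op ell2_coords rep_coord_def)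

lemma regular_rep_star:
  assumes "f \<in> Cc G"
  shows "regular_rep G (\<lambda>\<gamma>. if \<gamma> \<in> arrows G then cnj (f (ginv G \<gamma>)) else 0) = op_adj (regular_rep G f)"
  by (rule regular_rep_eqI[OF Cc_star[OF assms]])
    (auto simp: op_adj_delta regular_rep_coord[OF assms] rep_coord_def arrow_simps inv_mul_inv)

text \<open>With \<open>f\<close> living on \<open>B\<close>, this is the convolution of
  \<open>f\<close> and \<open>g\<close>: a single term, continuous through the section of
  \<open>grng G\<close> over the range of \<open>B\<close>.\<close>

lemma Cc_convolution_bisection:
  assumes f: "f \<in> Cc G" and B: "compact_open_bisection G B" and g: "g \<in> Cc G"
  defines "\<beta> \<equiv> \<lambda>\<eta>. inv_into B (grng G) (grng G \<eta>)"
  shows "(\<lambda>\<eta>. if \<eta> \<in> arrows G \<and> grng G \<eta> \<in> grng G ` B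
      then f (\<beta> \<eta>) * g (gmul G (ginv G (\<beta> \<eta>)) \<eta>) else 0) \<in> Cc G"
proof -
  note BD = compact_open_bisectionD[OF B]
  have sec: "\<beta> \<eta> \<in> B" "\<beta> \<eta> \<in> arrows G" "grng G (\<beta> \<eta>) = grng G \<eta>"
    if "\<eta> \<in> arrows G" "grng G \<eta> \<in> grng G ` B" for \<eta>
    using bisection_section[OF B that] by (simp_all add: \<beta>_def)
  let ?X = "gtop G" and ?XX = "prod_topology (gtop G) (gtop G)"
  let ?h = "\<lambda>\<eta>. f (\<beta> \<eta>) * g (gmul G (ginv G (\<beta> \<eta>)) \<eta>)"
  define S where "S = {\<eta> \<in> topspace ?X. grng G \<eta> \<in> grng G ` B}"
  have rB: "openin ?X (grng G ` B)" "closedin ?X (grng G ` B)"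
    using BD(7) compact_closed by (auto simp: compact_open_units_iff)
  have S: "openin ?X S" "closedin ?X S"
    unfolding S_def using openin_continuous_map_preimage[OF continuous_rng rB(1)]
      closedin_continuous_map_preimage[OF continuous_rng rB(2)] by auto
  have S_iff: "\<eta> \<in> S \<longleftrightarrow> \<eta> \<in> arrows G \<and> grng G \<eta> \<in> grng G ` B" for \<eta> by (simp add: S_def arrows_def)
  have c1: "continuous_map (subtopology ?X S) (subtopology ?X (grng G ` B)) (grng G)"
    using continuous_rng by (auto simp: continuous_map_in_subtopology continuous_map_from_subtopology S_iff)
  have \<beta>: "continuous_map (subtopology ?X S) ?X \<beta>"
    using continuous_map_compose[OF c1 BD(8)] by (simp add: \<beta>_def o_def)
  have c2: "continuous_map (subtopology ?X S) ?X (\<lambda>\<eta>. ginv G (\<beta> \<eta>))"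
    using continuous_map_compose[OF \<beta> continuous_inv] by (simp add: o_def)
  have "continuous_map (subtopology ?X S) (subtopology ?XX (composable G)) (\<lambda>\<eta>. (ginv G (\<beta> \<eta>), \<eta>))"
    using c2 sec by (auto simp: continuous_map_in_subtopology continuous_map_pairedI S_iff arrow_simps
        continuous_map_from_subtopology)
  from continuous_map_compose[OF this continuous_mul]
  have c3: "continuous_map (subtopology ?X S) ?X (\<lambda>\<eta>. gmul G (ginv G (\<beta> \<eta>)) \<eta>)" by (simp add: o_def)
  have fc: "continuous_map ?X euclidean f" and gc: "continuous_map ?X euclidean g" using f g by (auto simp: Cc_iff)
  have "continuous_map (subtopology ?X S) euclidean ?h"
    using continuous_map_complex_arith(2)[OF continuous_map_compose[OF \<beta> fc] continuous_map_compose[OF c3 gc]]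
    by (simp add: o_def)
  from continuous_map_clopen_extend[OF S this]
  have cont: "continuous_map ?X euclidean (\<lambda>\<eta>. if \<eta> \<in> S then ?h \<eta> else 0)" .
  obtain K where K: "compactin ?X K" "\<And>\<gamma>. \<gamma> \<notin> K \<Longrightarrow> g \<gamma> = 0" using g by (auto simp: Cc_iff)
  \<comment> \<open>\<open>composable G\<close> is closed by the Hausdorff property, so
    \<open>L\<close> is compact, and products of pairs in \<open>L\<close> cover the
    support.\<close>
  define L where "L = (B \<times> K) \<inter> composable G"
  have comp: "composable G = {p \<in> topspace ?XX. (gsrc G \<circ> fst) p = (grng G \<circ> snd) p}"
    by (auto simp: composable_def arrows_def)
  have "closedin ?XX (composable G)"
    unfolding comp by (intro closedin_continuous_maps_eq[OF hausdorff] continuous_map_compose[OF continuous_map_fst continuous_src]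
        continuous_map_compose[OF continuous_map_snd continuous_rng])
  then have "compactin ?XX L"
    unfolding L_def using K BD by (intro compact_Int_closedin) (auto simp: compactin_Times)
  then have "compactin (subtopology ?XX (composable G)) L" by (simp add: compactin_subtopology L_def)
  then have L: "compactin ?X ((\<lambda>(\<alpha>, \<beta>). gmul G \<alpha> \<beta>) ` L)" using image_compactin continuous_mul by blast
  have "(\<lambda>\<eta>. if \<eta> \<in> S then ?h \<eta> else 0) \<in> Cc G"
  proof (rule CcI[OF cont L])
    fix \<eta> assume \<eta>: "\<eta> \<notin> (\<lambda>(\<alpha>, \<beta>). gmul G \<alpha> \<beta>) ` L"
    show "(if \<eta> \<in> S then ?h \<eta> else 0) = 0"
    proof (cases "\<eta> \<in> S")
      case True
      then have \<eta>S: "\<eta> \<in> arrows G" "grng G \<eta> \<in> grng G ` B" by (auto simp: S_iff)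
      note s = sec[OF \<eta>S]
      have "gmul G (ginv G (\<beta> \<eta>)) \<eta> \<notin> K"
      proof
        assume "gmul G (ginv G (\<beta> \<eta>)) \<eta> \<in> K"
        then have "(\<beta> \<eta>, gmul G (ginv G (\<beta> \<eta>)) \<eta>) \<in> L" using s \<eta>S by (simp add: L_def arrow_simps)
        then show False using \<eta> mul_inv_cancel_left[OF s(2) \<eta>S(1) s(3)] by force
      qed
      then show ?thesis using K(2) by simp
    qed simp
  qed
  then show ?thesis by (simp add: S_iff)
qed

text \<open>Closure under products asks only for some \<open>h\<close>, which is assembled bisection
  by bisection from single-term convolutions.\<close>

lemma regular_rep_mult_ex:
  assumes "f \<in> Cc G" and g: "g \<in> Cc G"
  shows "\<exists>h\<in>Cc G. regular_rep G f * regular_rep G g = regular_rep G h"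
  using assms(1)
proof (induction rule: Cc_induct)
  case zero
  then show ?case using Cc_zero regular_rep_zero by (intro bexI[of _ "\<lambda>_. 0"]) auto
next
  case (add f1 f2)
  then obtain h1 h2 where "h1 \<in> Cc G" "regular_rep G f1 * regular_rep G g = regular_rep G h1"
    "h2 \<in> Cc G" "regular_rep G f2 * regular_rep G g = regular_rep G h2" by blast
  then show ?case using add
    by (intro bexI[of _ "\<lambda>\<gamma>. h1 \<gamma> + h2 \<gamma>"] Cc_add) (simp_all add: regular_rep_add distrib_right)
next
  case (bisection f B)
  let ?\<beta> = "\<lambda>\<eta>. inv_into B (grng G) (grng G \<eta>)"
  let ?h = "\<lambda>\<eta>. if \<eta> \<in> arrows G \<and> grng G \<eta> \<in> grng G ` B
      then f (?\<beta> \<eta>) * g (gmul G (ginv G (?\<beta> \<eta>)) \<eta>) else 0"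
  have h: "?h \<in> Cc G" using Cc_convolution_bisection bisection g by blast
  note sec = bisection_section[OF bisection(2)]
  obtain T where T: "\<And>x \<eta>. Rep_ell2 (op_apply T x) \<eta> =
      (if \<eta> \<in> arrows G \<and> grng G \<eta> \<in> grng G ` B
       then f (?\<beta> \<eta>) * Rep_ell2 x (gmul G (ginv G (?\<beta> \<eta>)) \<eta>) else 0)"
    "\<And>\<gamma> \<eta>. Rep_ell2 (op_apply T (delta \<gamma>)) \<eta> = rep_coord f \<gamma> \<eta>"
    using regular_rep_bisection[OF bisection] by blast
  have fT: "regular_rep G f = T" by (rule regular_rep_eqI[OF bisection(1) T(2)])
  have "regular_rep G ?h = regular_rep G f * regular_rep G g"
  proof (rule regular_rep_eqI[OF h])
    fix \<gamma> \<eta>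
    show "Rep_ell2 (op_apply (regular_rep G f * regular_rep G g) (delta \<gamma>)) \<eta> = rep_coord ?h \<gamma> \<eta>"
    proof (cases "\<gamma> \<in> arrows G \<and> \<eta> \<in> arrows G \<and> gsrc G \<eta> = gsrc G \<gamma> \<and> grng G \<eta> \<in> grng G ` B")
      case True
      then have \<eta>: "\<gamma> \<in> arrows G" "\<eta> \<in> arrows G" "grng G \<eta> \<in> grng G ` B" "gsrc G \<eta> = gsrc G \<gamma>" by auto
      note s = sec[OF \<eta>(2,3)]
      have "gmul G (gmul G (ginv G (?\<beta> \<eta>)) \<eta>) (ginv G \<gamma>) = gmul G (ginv G (?\<beta> \<eta>)) (gmul G \<eta> (ginv G \<gamma>))"
        by (rule mul_assoc) (use \<eta> s in \<open>auto simp: arrow_simps\<close>)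
      then show ?thesis using \<eta> s
        by (simp add: op_apply_op fT T(1) regular_rep_coord[OF g] rep_coord_def arrow_simps)
    next
      case False
      have "grng G (gmul G \<eta> (ginv G \<gamma>)) = grng G \<eta>" if "\<gamma> \<in> arrows G" "\<eta> \<in> arrows G" "gsrc G \<eta> = gsrc G \<gamma>"
        using that by (simp add: arrow_simps)
      moreover have "rep_coord g \<gamma> (gmul G (ginv G (?\<beta> \<eta>)) \<eta>) = 0"
        if "\<eta> \<in> arrows G" "grng G \<eta> \<in> grng G ` B"
        using that False sec[OF that] by (auto simp: rep_coord_def arrow_simps)
      ultimately show ?thesis using False
        by (auto simp: op_apply_op fT T(1) regular_rep_coord[OF g]) (auto simp: rep_coord_def)
    qed
  qed
  from this[symmetric] h show ?case by (rule bexI[where x = ?h])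
qed

abbreviation "\<A> \<equiv> reduced_cstar G"

lemma regular_rep_in: "f \<in> Cc G \<Longrightarrow> regular_rep G f \<in> \<A>"
  unfolding reduced_cstar_def by (intro subsetD[OF closure_subset] imageI)

lemma cstar_subalgebra_reduced: "cstar_subalgebra \<A> UNIV"
proof -
  let ?I = "regular_rep G ` Cc G"
  have lim: "x \<in> \<A> \<longleftrightarrow> (\<exists>X. (\<forall>n. X n \<in> ?I) \<and> X \<longlonglongrightarrow> x)" for x
    unfolding reduced_cstar_def closure_sequential by blast
  have limI: "x \<in> \<A>" if "X \<longlonglongrightarrow> x" "\<And>n. X n \<in> ?I" for X x using lim that by blast
  have add: "a + b \<in> ?I" if "a \<in> ?I" "b \<in> ?I" for a b
    using that Cc_add by (auto simp: regular_rep_add[symmetric])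
  have mul: "a * b \<in> ?I" if "a \<in> ?I" "b \<in> ?I" for a b
    using that regular_rep_mult_ex by (auto simp: image_iff)
  have adj: "op_adj a \<in> ?I" if "a \<in> ?I" for a
    using that Cc_star by (auto simp: regular_rep_star[symmetric])
  have scale: "op_scaleC c a \<in> ?I" if "a \<in> ?I" for a c
    using that Cc_cmult by (auto simp: regular_rep_cmult[symmetric])
  have bl: "bounded_linear (op_scaleC c :: 'g ell2_op \<Rightarrow> _)" for c
  proof (rule bounded_linear_intro[where K = "cmod c"])
    fix x y :: "'g ell2_op" and r
    show "op_scaleC c (x + y) = op_scaleC c x + op_scaleC c y"
      by (rule op_eqI) (simp add: op_apply_op scaleC_add_right)
    show "op_scaleC c (r *\<^sub>R x) = r *\<^sub>R op_scaleC c x"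
      by (rule op_eqI) (simp add: op_apply_op scaleC_scaleR)
    show "norm (op_scaleC c x) \<le> norm x * cmod c"
    proof (rule norm_op_le)
      fix v show "norm (op_apply (op_scaleC c x) v) \<le> norm x * cmod c * norm v"
        using mult_left_mono[OF norm_op_apply[of x v], of "cmod c"] by (simp add: op_apply_op norm_scaleC mult_ac)
    qed simp
  qed
  have "a + b \<in> \<A> \<and> a * b \<in> \<A>" if "a \<in> \<A>" "b \<in> \<A>" for a b
  proof -
    obtain X Y where X: "\<forall>n. X n \<in> ?I" "X \<longlonglongrightarrow> a" and Y: "\<forall>n. Y n \<in> ?I" "Y \<longlonglongrightarrow> b"
      using \<open>a \<in> \<A>\<close> \<open>b \<in> \<A>\<close> lim by metis
    show ?thesis
      using limI[OF tendsto_add[OF X(2) Y(2)]] limI[OF tendsto_mult[OF X(2) Y(2)]] add mul X(1) Y(1) by simp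
  qed
  moreover have "op_adj a \<in> \<A> \<and> op_scaleC c a \<in> \<A>" if "a \<in> \<A>" for a c
  proof -
    obtain X where X: "\<forall>n. X n \<in> ?I" "X \<longlonglongrightarrow> a" using \<open>a \<in> \<A>\<close> lim[of a] by blast
    show ?thesis
      using limI[OF bounded_linear.tendsto[OF bounded_linear_op_adj X(2)]] limI[OF bounded_linear.tendsto[OF bl X(2)]]
        adj scale X(1) by simp
  qed
  moreover have "0 \<in> \<A>" using regular_rep_in[OF Cc_zero] regular_rep_zero by simp
  moreover have "closed \<A>" by (simp add: reduced_cstar_def)
  ultimately show ?thesis unfolding cstar_subalgebra_def complex_subspace_def by blast
qed

text \<open>Guarantees that a nonzero operator of the algebra is nonzero on
  \<open>delta \<gamma>\<close> for an actual arrow \<open>\<gamma>\<close>, which supplies the unit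
  \<open>grng G \<gamma>\<close>.\<close>

lemma reduced_apply_delta_outside:
  assumes "a \<in> \<A>" "\<gamma> \<notin> arrows G" shows "op_apply a (delta \<gamma>) = 0"
proof -
  have "closed {a :: 'g ell2_op. op_apply a (delta \<gamma>) = 0}"
    by (intro closed_Collect_eq continuous_intros bounded_linear.continuous_on[OF bounded_linear_op_apply_left])
  moreover have "regular_rep G ` Cc G \<subseteq> {a. op_apply a (delta \<gamma>) = 0}"
    using assms(2) by (auto intro!: ell2_eqI simp: regular_rep_coord rep_coord_def ell2_coords)
  ultimately have "\<A> \<subseteq> {a. op_apply a (delta \<gamma>) = 0}" unfolding reduced_cstar_def by (rule closure_minimal[rotated])
  then show ?thesis using assms(1) by blast
qed

end

section \<open>Minimal effective groupoids\<close>

context ample_hausdorff_groupoid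
begin

text \<open>\<open>gmul G \<eta> (ginv G \<gamma>)\<close> is a unit only for
  \<open>\<eta> = \<gamma>\<close>, so the operator is diagonal.\<close>

lemma unit_ind_apply:
  assumes "compact_open_units G V"
  shows "Rep_ell2 (op_apply (unit_ind G V) x) \<eta> = (if \<eta> \<in> arrows G \<and> grng G \<eta> \<in> V then Rep_ell2 x \<eta> else 0)"
proof -
  have V: "openin (gtop G) V" "compactin (gtop G) V" "V \<subseteq> gunits G"
    using assms by (auto simp: compact_open_units_iff)
  let ?w = "\<lambda>\<eta>. if \<eta> \<in> arrows G \<and> grng G \<eta> \<in> V then 1 else 0 :: complex"
  have "cmod (?w \<eta>) \<le> 1" for \<eta> by simp
  then obtain T where T: "\<And>x \<eta>. Rep_ell2 (op_apply T x) \<eta> = ?w \<eta> * Rep_ell2 x \<eta>"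
    using weighted_composition_op_ex[of ?w 1 "\<lambda>j. j", OF _ inj_on_id2] by blast
  have "unit_ind G V = T"
    unfolding unit_ind_def
  proof (rule regular_rep_eqI[OF Cc_indicator[OF V(1,2)]])
    fix \<gamma> \<eta>
    have "gmul G \<eta> (ginv G \<gamma>) \<in> V \<longleftrightarrow> \<eta> = \<gamma> \<and> grng G \<gamma> \<in> V"
      if a: "\<gamma> \<in> arrows G" "\<eta> \<in> arrows G" "gsrc G \<eta> = gsrc G \<gamma>"
    proof
      assume i: "gmul G \<eta> (ginv G \<gamma>) \<in> V"
      then have "\<eta> = \<gamma>" using mul_inv_self_unit[OF a(2,1,3)] V(3) by blast
      then show "\<eta> = \<gamma> \<and> grng G \<gamma> \<in> V" using i a(1) by (simp add: mul_inv)
    qed (use a in \<open>auto simp: mul_inv\<close>)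
    then show "Rep_ell2 (op_apply T (delta \<gamma>)) \<eta> = rep_coord (indicator V) \<gamma> \<eta>"
      by (auto simp: T ell2_coords rep_coord_def indicator_def)
  qed
  then show ?thesis by (simp add: T)
qed

lemma unit_ind_in: "compact_open_units G V \<Longrightarrow> unit_ind G V \<in> \<A>"
  unfolding unit_ind_def by (intro regular_rep_in Cc_indicator) (auto simp: compact_open_units_iff)

lemma unit_ind_adj: "compact_open_units G V \<Longrightarrow> op_adj (unit_ind G V) = unit_ind G V"
  by (rule op_adj_eqI) (auto simp: inner_ell2.rep_eq unit_ind_apply intro!: infsum_cong)

lemma compact_open_units_Int: "compact_open_units G V \<Longrightarrow> compact_open_units G W \<Longrightarrow> compact_open_units G (V \<inter> W)"
  by (auto simp: compact_open_units_iff intro!: compact_Int_closedin compact_closed)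

lemma compact_open_units_Un: "compact_open_units G V \<Longrightarrow> compact_open_units G W \<Longrightarrow> compact_open_units G (V \<union> W)"
  by (auto simp: compact_open_units_iff compactin_Un)

lemma compact_open_units_empty: "compact_open_units G {}"
  by (auto simp: compact_open_units_iff)

lemma unit_ind_mult:
  "compact_open_units G V \<Longrightarrow> compact_open_units G W \<Longrightarrow> unit_ind G V * unit_ind G W = unit_ind G (V \<inter> W)"
  by (rule op_eqI, rule ell2_eqI) (simp add: op_apply_op unit_ind_apply compact_open_units_Int)

lemma unit_ind_idem: "compact_open_units G V \<Longrightarrow> unit_ind G V * unit_ind G V = unit_ind G V"
  by (simp add: unit_ind_mult)

lemma unit_ind_Un:
  "compact_open_units G V \<Longrightarrow> compact_open_units G W \<Longrightarrow>
    unit_ind G (V \<union> W) = unit_ind G V + unit_ind G W - unit_ind G V * unit_ind G W"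
  by (rule op_eqI, rule ell2_eqI)
    (auto simp: op_apply_op ell2_coords unit_ind_apply compact_open_units_Un)

lemma unit_ind_empty: "unit_ind G {} = 0"
  by (rule op_eqI, rule ell2_eqI) (simp add: op_apply_op ell2_coords unit_ind_apply compact_open_units_empty)

lemma unit_ind_nonzero:
  assumes "compact_open_units G V" "V \<noteq> {}" shows "unit_ind G V \<noteq> 0"
proof
  assume 0: "unit_ind G V = 0"
  obtain v where v: "v \<in> V" "v \<in> gunits G" using assms by (auto simp: compact_open_units_iff)
  have "Rep_ell2 (op_apply (unit_ind G V) (delta v)) v = 1"
    using v unit_arrow unit_rng by (simp add: unit_ind_apply[OF assms(1)] ell2_coords)
  then show False by (simp add: 0 op_apply_op ell2_coords)
qed

lemma norm_unit_ind_le: "compact_open_units G V \<Longrightarrow> norm (unit_ind G V) \<le> 1"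
  by (rule norm_op_le) (simp_all add: norm_proj_apply_le unit_ind_adj unit_ind_idem)

subsection \<open>Compressing to the diagonal\<close>

text \<open>Effectiveness gives an arrow of \<open>B\<close> with distinct ends in \<open>W\<close>.
  Separate the ends by \<open>P\<close> and \<open>Q\<close> and let \<open>W'\<close> be the range
  of a small piece \<open>N\<close> of \<open>B\<close>: an arrow of \<open>B\<close> with range in
  \<open>W'\<close> lies in \<open>N\<close> by injectivity, so its source is in \<open>P\<close>,
  hence outside \<open>W'\<close>, a subset of \<open>Q\<close>.\<close>

lemma effective_shrink:
  assumes eff: "effective_groupoid G" and B: "compact_open_bisection G B" "B \<inter> gunits G = {}"
    and W: "openin (gtop G) W" "W \<noteq> {}" "W \<subseteq> gunits G"
  shows "\<exists>W'. openin (gtop G) W' \<and> W' \<noteq> {} \<and> W' \<subseteq> W \<and> (\<forall>\<gamma>\<in>B. \<not> (grng G \<gamma> \<in> W' \<and> gsrc G \<gamma> \<in> W'))"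
proof -
  note BD = compact_open_bisectionD[OF B(1)]
  have pre: "openin (gtop G) {\<gamma> \<in> B. gsrc G \<gamma> \<in> P \<and> grng G \<gamma> \<in> Q}"
    if "openin (gtop G) P" "openin (gtop G) Q" for P Q
  proof -
    have "{\<gamma> \<in> B. gsrc G \<gamma> \<in> P \<and> grng G \<gamma> \<in> Q}
        = B \<inter> {\<gamma> \<in> topspace (gtop G). gsrc G \<gamma> \<in> P} \<inter> {\<gamma> \<in> topspace (gtop G). grng G \<gamma> \<in> Q}"
      using BD(2) by (auto simp: arrows_def)
    then show ?thesis
      using BD(1) openin_continuous_map_preimage[OF continuous_src that(1)]
        openin_continuous_map_preimage[OF continuous_rng that(2)] by (simp add: openin_Int)
  qed
  show ?thesis
  proof (cases "{\<gamma> \<in> B. gsrc G \<gamma> \<in> W \<and> grng G \<gamma> \<in> W} = {}")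
    case True
    then show ?thesis using W by (intro exI[of _ W]) auto
  next
    case False
    then obtain \<gamma>0 where \<gamma>0: "\<gamma>0 \<in> {\<gamma> \<in> B. gsrc G \<gamma> \<in> W \<and> grng G \<gamma> \<in> W}" by blast
    \<comment> \<open>Effectiveness speaks of compact open bisections, hence the passage to one
      whose arrows have both ends in \<open>W\<close>.\<close>
    obtain B' where B': "compact_open_bisection G B'" "\<gamma>0 \<in> B'" "B' \<subseteq> {\<gamma> \<in> B. gsrc G \<gamma> \<in> W \<and> grng G \<gamma> \<in> W}"
      using ample_basis[OF pre[OF W(1) W(1)] \<gamma>0] .
    moreover have "B' \<noteq> {}" "B' \<subseteq> arrows G - gunits G" using B' B(2) BD(2) by auto
    ultimately obtain \<gamma> where \<gamma>: "\<gamma> \<in> B'" "gsrc G \<gamma> \<noteq> grng G \<gamma>"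
      using eff unfolding effective_groupoid_def by blast
    have \<gamma>B: "\<gamma> \<in> B" "gsrc G \<gamma> \<in> W" "grng G \<gamma> \<in> W" "\<gamma> \<in> arrows G" using \<gamma> B' BD(2) by auto
    have "gsrc G \<gamma> \<in> topspace (gtop G)" "grng G \<gamma> \<in> topspace (gtop G)"
      using rng_in[OF \<gamma>B(4)] src_in[OF \<gamma>B(4)] by (auto simp: arrows_def)
    then obtain P Q where PQ: "openin (gtop G) P" "openin (gtop G) Q" "gsrc G \<gamma> \<in> P" "grng G \<gamma> \<in> Q" "disjnt P Q"
      using hausdorff \<gamma>(2) unfolding Hausdorff_space_def by metis
    have oN: "openin (gtop G) {\<gamma> \<in> B. gsrc G \<gamma> \<in> P \<and> grng G \<gamma> \<in> Q \<inter> W}"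
      by (intro pre openin_Int PQ W)
    have \<gamma>N: "\<gamma> \<in> {\<gamma> \<in> B. gsrc G \<gamma> \<in> P \<and> grng G \<gamma> \<in> Q \<inter> W}" using PQ \<gamma>B by auto
    obtain N where N: "compact_open_bisection G N" "\<gamma> \<in> N"
      "N \<subseteq> {\<gamma> \<in> B. gsrc G \<gamma> \<in> P \<and> grng G \<gamma> \<in> Q \<inter> W}" using ample_basis[OF oN \<gamma>N] .
    have "\<not> (grng G \<beta> \<in> grng G ` N \<and> gsrc G \<beta> \<in> grng G ` N)" if \<beta>: "\<beta> \<in> B" for \<beta>
    proof
      assume "grng G \<beta> \<in> grng G ` N \<and> gsrc G \<beta> \<in> grng G ` N"
      then obtain \<beta>' \<beta>'' where b: "\<beta>' \<in> N" "grng G \<beta> = grng G \<beta>'" "\<beta>'' \<in> N" "gsrc G \<beta> = grng G \<beta>''" by blast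
      then have "\<beta> = \<beta>'" using inj_onD[OF BD(3) b(2) \<beta>] N(3) by blast
      then have "gsrc G \<beta> \<in> P" "gsrc G \<beta> \<in> Q" using b N(3) by auto
      then show False using PQ(5) by (auto simp: disjnt_iff)
    qed
    moreover have "openin (gtop G) (grng G ` N)"
      using compact_open_bisectionD(7)[OF N(1)] by (simp add: compact_open_units_iff)
    ultimately show ?thesis using N by (intro exI[of _ "grng G ` N"]) auto
  qed
qed

lemma effective_shrink_finite:
  assumes eff: "effective_groupoid G" and "finite \<B>"
    and "\<And>B. B \<in> \<B> \<Longrightarrow> compact_open_bisection G B \<and> B \<inter> gunits G = {}"
    and "openin (gtop G) W" "W \<noteq> {}" "W \<subseteq> gunits G"
  shows "\<exists>W'. openin (gtop G) W' \<and> W' \<noteq> {} \<and> W' \<subseteq> W \<and> (\<forall>\<gamma>\<in>\<Union>\<B>. \<not> (grng G \<gamma> \<in> W' \<and> gsrc G \<gamma> \<in> W'))"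
  using assms(2-)
proof (induction \<B> rule: finite_induct)
  case empty
  then show ?case by (intro exI[of _ W]) auto
next
  case (insert B \<B>)
  have "\<exists>W'. openin (gtop G) W' \<and> W' \<noteq> {} \<and> W' \<subseteq> W \<and> (\<forall>\<gamma>\<in>\<Union>\<B>. \<not> (grng G \<gamma> \<in> W' \<and> gsrc G \<gamma> \<in> W'))"
    by (rule insert.IH) (use insert.prems in auto)
  then obtain W1 where W1: "openin (gtop G) W1" "W1 \<noteq> {}" "W1 \<subseteq> W"
    "\<forall>\<gamma>\<in>\<Union>\<B>. \<not> (grng G \<gamma> \<in> W1 \<and> gsrc G \<gamma> \<in> W1)" by blast
  have "compact_open_bisection G B" "B \<inter> gunits G = {}" "W1 \<subseteq> gunits G" using insert.prems W1 by auto
  then obtain W2 where W2: "openin (gtop G) W2" "W2 \<noteq> {}" "W2 \<subseteq> W1"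
    "\<forall>\<gamma>\<in>B. \<not> (grng G \<gamma> \<in> W2 \<and> gsrc G \<gamma> \<in> W2)"
    using effective_shrink[OF eff _ _ W1(1,2)] by metis
  show ?case using W1 W2 by (intro exI[of _ W2]) blast
qed

text \<open>\<open>V\<close> need not contain \<open>u\<close>, as shrinking may move away from it.
  Continuity first fixes a neighbourhood where \<open>f\<close> is near \<open>f u\<close>, and this
  survives the move.\<close>

lemma nearly_constant_diagonal:
  assumes eff: "effective_groupoid G" and f: "f \<in> Cc G" and u: "u \<in> gunits G" and "\<epsilon> > 0"
  shows "\<exists>V. compact_open_units G V \<and> V \<noteq> {} \<and> (\<forall>v\<in>V. cmod (f v - f u) < \<epsilon>) \<and>
    (\<forall>\<gamma>\<in>arrows G - gunits G. grng G \<gamma> \<in> V \<and> gsrc G \<gamma> \<in> V \<longrightarrow> f \<gamma> = 0)"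
proof -
  obtain K where K: "compactin (gtop G) K" "\<And>\<gamma>. \<gamma> \<notin> K \<Longrightarrow> f \<gamma> = 0" using f by (auto simp: Cc_iff)
  \<comment> \<open>The units are clopen, so the part of \<open>K\<close> off the units is compact
    and has a finite cover by bisections that miss them.\<close>
  have o: "openin (gtop G) (topspace (gtop G) - gunits G)" using closedin_units by (simp add: closedin_def)
  have "closedin (gtop G) (topspace (gtop G) - gunits G)" using openin_units by blast
  then have C: "compactin (gtop G) (K \<inter> (topspace (gtop G) - gunits G))" using K(1) by (intro compact_Int_closedin)
  obtain \<B> where \<B>: "finite \<B>" "\<And>B. B \<in> \<B> \<Longrightarrow> compact_open_bisection G B \<and> B \<subseteq> topspace (gtop G) - gunits G"
    "K \<inter> (topspace (gtop G) - gunits G) \<subseteq> \<Union>\<B>"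
    using compact_bisection_cover[OF C o Int_lower2] by metis
  let ?W = "{v \<in> topspace (gtop G). f v \<in> ball (f u) \<epsilon>} \<inter> gunits G"
  have "openin (gtop G) {v \<in> topspace (gtop G). f v \<in> ball (f u) \<epsilon>}"
    using f by (intro openin_continuous_map_preimage[of _ euclidean]) (auto simp: Cc_iff)
  then have W: "openin (gtop G) ?W" using openin_units by blast
  have "u \<in> ?W" using u unit_arrow \<open>\<epsilon> > 0\<close> by (auto simp: arrows_def)
  then have "?W \<noteq> {}" by blast
  moreover have "compact_open_bisection G B \<and> B \<inter> gunits G = {}" if "B \<in> \<B>" for B using \<B>(2)[OF that] by auto
  ultimately obtain W' where W': "openin (gtop G) W'" "W' \<noteq> {}" "W' \<subseteq> ?W"
      "\<forall>\<gamma>\<in>\<Union>\<B>. \<not> (grng G \<gamma> \<in> W' \<and> gsrc G \<gamma> \<in> W')"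
    using effective_shrink_finite[OF eff \<B>(1) _ W] by blast
  obtain v where "v \<in> W'" using W'(2) by blast
  then obtain V where V: "compact_open_bisection G V" "v \<in> V" "V \<subseteq> W'" using ample_basis[OF W'(1)] by blast
  have "compact_open_units G V"
    using compact_open_bisectionD[OF V(1)] V(3) W'(3) by (auto simp: compact_open_units_iff)
  moreover have "cmod (f v - f u) < \<epsilon>" if "v \<in> V" for v
    using that V(3) W'(3) by (auto simp: dist_norm norm_minus_commute)
  moreover have "f \<gamma> = 0" if "\<gamma> \<in> arrows G - gunits G" "grng G \<gamma> \<in> V" "gsrc G \<gamma> \<in> V" for \<gamma>
  proof (rule ccontr)
    assume "f \<gamma> \<noteq> 0"
    then have "\<gamma> \<in> \<Union>\<B>" using K(2)[of \<gamma>] that(1) \<B>(3) by (auto simp: arrows_def)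
    then show False using W'(4) V(3) that(2,3) by blast
  qed
  ultimately show ?thesis using V(2) by blast
qed

text \<open>With the off-diagonal entries gone, the compression is multiplication by
  \<open>f (grng G \<eta>)\<close>, and its distance to the scalar is controlled pointwise.\<close>

lemma norm_compression_le:
  assumes f: "f \<in> Cc G" and V: "compact_open_units G V"
    and off: "\<forall>\<gamma>\<in>arrows G - gunits G. grng G \<gamma> \<in> V \<and> gsrc G \<gamma> \<in> V \<longrightarrow> f \<gamma> = 0"
    and near: "\<And>v. v \<in> V \<Longrightarrow> cmod (f v - complex_of_real c) \<le> \<delta>" and "\<delta> \<ge> 0"
  shows "norm (unit_ind G V * regular_rep G f * unit_ind G V - c *\<^sub>R unit_ind G V) \<le> \<delta>"
proof -
  let ?w = "\<lambda>\<eta>. if \<eta> \<in> arrows G \<and> grng G \<eta> \<in> V then f (grng G \<eta>) - complex_of_real c else 0"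
  have "cmod (?w \<eta>) \<le> \<delta>" for \<eta> using near \<open>\<delta> \<ge> 0\<close> by simp
  then obtain D where D: "\<And>x \<eta>. Rep_ell2 (op_apply D x) \<eta> = ?w \<eta> * Rep_ell2 x \<eta>" and nD: "norm D \<le> \<delta>"
    using weighted_composition_op_ex[of ?w \<delta> "\<lambda>j. j", OF _ inj_on_id2] by blast
  have "unit_ind G V * regular_rep G f * unit_ind G V - c *\<^sub>R unit_ind G V = D"
  proof (rule op_eqI_delta, rule ell2_eqI)
    fix \<gamma> \<eta>
    let ?\<chi> = "\<lambda>\<eta>. \<eta> \<in> arrows G \<and> grng G \<eta> \<in> V"
    have d: "op_apply (unit_ind G V) (delta \<gamma>) = (if ?\<chi> \<gamma> then delta \<gamma> else 0)"
      by (rule ell2_eqI) (auto simp: unit_ind_apply[OF V] ell2_coords)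
    have "Rep_ell2 (op_apply (unit_ind G V * regular_rep G f * unit_ind G V) (delta \<gamma>)) \<eta>
        = (if ?\<chi> \<eta> \<and> ?\<chi> \<gamma> then rep_coord f \<gamma> \<eta> else 0)"
      by (simp add: op_apply_times d unit_ind_apply[OF V] op_apply_zero regular_rep_coord[OF f] ell2_coords)
    also have "\<dots> = (if ?\<chi> \<eta> \<and> \<eta> = \<gamma> then f (grng G \<eta>) else 0)"
    proof (cases "?\<chi> \<eta> \<and> ?\<chi> \<gamma> \<and> gsrc G \<eta> = gsrc G \<gamma>")
      case True
      then have a: "\<eta> \<in> arrows G" "\<gamma> \<in> arrows G" "gsrc G \<eta> = gsrc G \<gamma>" "grng G \<eta> \<in> V" "grng G \<gamma> \<in> V" by auto
      show ?thesis
      proof (cases "\<eta> = \<gamma>")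
        case False
        then have "gmul G \<eta> (ginv G \<gamma>) \<in> arrows G - gunits G"
          using mul_inv_self_unit[OF a(1-3)] a by (auto simp: arrow_simps)
        moreover have "grng G (gmul G \<eta> (ginv G \<gamma>)) = grng G \<eta>" "gsrc G (gmul G \<eta> (ginv G \<gamma>)) = grng G \<gamma>"
          using a by (simp_all add: arrow_simps)
        ultimately have "f (gmul G \<eta> (ginv G \<gamma>)) = 0" using off a by metis
        then show ?thesis using False by (simp add: rep_coord_def)
      qed (use a in \<open>simp add: rep_coord_def mul_inv\<close>)
    next
      case False
      then show ?thesis by (auto simp: rep_coord_def)
    qed
    finally show "Rep_ell2 (op_apply (unit_ind G V * regular_rep G f * unit_ind G V - c *\<^sub>R unit_ind G V) (delta \<gamma>)) \<eta>
        = Rep_ell2 (op_apply D (delta \<gamma>)) \<eta>"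
      by (simp add: op_apply_diff_op op_apply_scaleR_op minus_ell2.rep_eq scaleR_ell2.rep_eq D
          unit_ind_apply[OF V] delta.rep_eq)
  qed
  then show ?thesis using nD by simp
qed

text \<open>The diagonal entry of \<open>op_adj a * a\<close> at \<open>\<gamma>\<close> is
  \<open>(norm (op_apply a (delta \<gamma>)))\<^sup>2\<close>, positive for a suitable
  \<open>\<gamma>\<close> even if the diagonal of \<open>a\<close> vanishes.\<close>

lemma nonzero_compression_ex:
  assumes eff: "effective_groupoid G" and a: "a \<in> \<A>" "a \<noteq> 0"
  shows "\<exists>V c. compact_open_units G V \<and> V \<noteq> {} \<and> c > 0 \<and>
    norm (unit_ind G V * (op_adj a * a) * unit_ind G V - c *\<^sub>R unit_ind G V) \<le> (1/2) * c"
proof -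
  obtain \<gamma> where \<gamma>: "op_apply a (delta \<gamma>) \<noteq> 0" using a(2) op_eqI_delta[of a 0] by (auto simp: op_apply_op)
  have \<gamma>G: "\<gamma> \<in> arrows G" using \<gamma> reduced_apply_delta_outside[OF a(1)] by blast
  define b where "b = op_adj a * a"
  define c where "c = (norm (op_apply a (delta \<gamma>)))\<^sup>2"
  have c: "c > 0" using \<gamma> by (simp add: c_def)
  have "op_adj b = b" by (simp add: b_def)
  have bc: "Rep_ell2 (op_apply b (delta \<gamma>)) \<gamma> = complex_of_real c"
  proof -
    have "Re (Rep_ell2 (op_apply b (delta \<gamma>)) \<gamma>) = c"
      using inner_delta(1)[of \<gamma> "op_apply b (delta \<gamma>)"] inner_adj_times[of a "delta \<gamma>"]
      by (simp add: b_def c_def inner_commute)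
    moreover have "Im (Rep_ell2 (op_apply b (delta \<gamma>)) \<gamma>) = 0"
      using op_adj_delta[of b \<gamma> \<gamma>] \<open>op_adj b = b\<close> by (simp add: complex_eq_iff)
    ultimately show ?thesis by (simp add: complex_eq_iff)
  qed
  have "b \<in> \<A>" using a(1) cstar_subalgebraD(4,5)[OF cstar_subalgebra_reduced] by (simp add: b_def)
  \<comment> \<open>Three errors of \<open>c / 6\<close> add up to \<open>c / 2\<close>:
    approximation of the diagonal entry, variation of \<open>f\<close> on \<open>V\<close>, and
    approximation in norm after compression.\<close>
  moreover have "c / 6 > 0" using c by simp
  ultimately have "\<exists>T\<in>regular_rep G ` Cc G. dist T b < c / 6"
    unfolding reduced_cstar_def closure_approachable by blast
  then obtain f where f: "f \<in> Cc G" "norm (regular_rep G f - b) < c / 6" by (auto simp: dist_norm)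
  let ?u = "grng G \<gamma>"
  have u: "?u \<in> gunits G" using \<gamma>G by (rule rng_unit)
  have "cmod (f ?u - complex_of_real c) < c / 6"
  proof -
    have "f ?u - complex_of_real c = Rep_ell2 (op_apply (regular_rep G f - b) (delta \<gamma>)) \<gamma>"
      using \<gamma>G by (simp add: op_apply_op minus_ell2.rep_eq bc regular_rep_coord[OF f(1)] rep_coord_def mul_inv)
    also have "cmod \<dots> \<le> norm (regular_rep G f - b) * norm (delta \<gamma>)"
      by (rule order_trans[OF coord_le_norm norm_op_apply])
    finally show ?thesis using f(2) by (simp add: norm_delta)
  qed
  moreover obtain V where V: "compact_open_units G V" "V \<noteq> {}" "\<forall>v\<in>V. cmod (f v - f ?u) < c / 6"
    "\<forall>\<gamma>\<in>arrows G - gunits G. grng G \<gamma> \<in> V \<and> gsrc G \<gamma> \<in> V \<longrightarrow> f \<gamma> = 0"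
    using nearly_constant_diagonal[OF eff f(1) u, of "c / 6"] c by auto
  ultimately have near: "cmod (f v - complex_of_real c) \<le> c / 3" if "v \<in> V" for v
    using norm_triangle_ineq[of "f v - f ?u" "f ?u - complex_of_real c"] that by fastforce
  let ?p = "unit_ind G V"
  have "norm (?p * regular_rep G f * ?p - c *\<^sub>R ?p) \<le> c / 3"
    by (rule norm_compression_le[OF f(1) V(1,4) near]) (use c in auto)
  moreover have "norm (?p * (b - regular_rep G f) * ?p) \<le> c / 6"
  proof -
    have "norm (?p * (b - regular_rep G f) * ?p) \<le> norm (?p * (b - regular_rep G f)) * norm ?p"
      by (rule norm_mult_ineq)
    also have "\<dots> \<le> norm (?p * (b - regular_rep G f)) * 1"
      by (rule mult_left_mono[OF norm_unit_ind_le[OF V(1)]]) simp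
    also have "\<dots> \<le> norm ?p * norm (b - regular_rep G f)" by (simp add: norm_mult_ineq)
    also have "\<dots> \<le> 1 * norm (b - regular_rep G f)"
      by (rule mult_right_mono[OF norm_unit_ind_le[OF V(1)]]) simp
    finally show ?thesis using f(2) by (simp add: norm_minus_commute)
  qed
  moreover have "norm (?p * b * ?p - c *\<^sub>R ?p)
      \<le> norm (?p * (b - regular_rep G f) * ?p) + norm (?p * regular_rep G f * ?p - c *\<^sub>R ?p)"
  proof -
    have "?p * b * ?p - c *\<^sub>R ?p
        = (?p * (b - regular_rep G f) * ?p) + (?p * regular_rep G f * ?p - c *\<^sub>R ?p)"
      by (simp add: algebra_simps)
    then show ?thesis by (simp only: norm_triangle_ineq)
  qed
  ultimately have "norm (?p * b * ?p - c *\<^sub>R ?p) \<le> (1/2) * c" by linarith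
  then show ?thesis using V c unfolding b_def by blast
qed

text \<open>The first equation makes \<open>a * w\<close> a partial isometry that moves projections
  into hereditary subalgebras; the second factors \<open>unit_ind G V\<close> through
  \<open>a\<close>.\<close>

lemma reduced_polar_ex:
  assumes eff: "effective_groupoid G" and a: "a \<in> \<A>" "a \<noteq> 0"
  shows "\<exists>V w. compact_open_units G V \<and> V \<noteq> {} \<and> w \<in> corner \<A> (unit_ind G V) \<and>
    op_adj (a * w) * (a * w) = unit_ind G V \<and>
    w * w * (unit_ind G V * (op_adj a * a) * unit_ind G V) = unit_ind G V"
proof -
  obtain V c where V: "compact_open_units G V" "V \<noteq> {}" "c > 0"
    "norm (unit_ind G V * (op_adj a * a) * unit_ind G V - c *\<^sub>R unit_ind G V) \<le> (1/2) * c"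
    using nonzero_compression_ex[OF assms] by blast
  then show ?thesis
    using polar_ex[OF cstar_subalgebra_reduced unit_ind_in unit_ind_adj unit_ind_idem a(1) V(3,4)] by force
qed

subsection \<open>Ideals\<close>

text \<open>Conjugation by the indicator of \<open>B\<close> moves a set of units from sources to
  ranges, and all of \<open>B\<close> survives because its sources lie in \<open>Z\<close>. This
  links ideals to invariant sets.\<close>

lemma unit_ind_translate:
  assumes B: "compact_open_bisection G B" and Z: "compact_open_units G Z" and BZ: "\<And>\<beta>. \<beta> \<in> B \<Longrightarrow> gsrc G \<beta> \<in> Z"
  defines "T \<equiv> regular_rep G (indicator B)"
  shows "T * unit_ind G Z * op_adj T = unit_ind G (grng G ` B)"
proof (rule op_eqI_delta, rule ell2_eqI)
  fix \<gamma> \<eta>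
  note BD = compact_open_bisectionD[OF B]
  let ?\<beta> = "inv_into B (grng G) (grng G \<eta>)"
  have iB: "indicator B \<in> Cc G" by (rule Cc_indicator[OF BD(1,5)])
  obtain S where S: "\<And>x \<eta>. Rep_ell2 (op_apply S x) \<eta> =
      (if \<eta> \<in> arrows G \<and> grng G \<eta> \<in> grng G ` B
       then indicator B (inv_into B (grng G) (grng G \<eta>))
          * Rep_ell2 x (gmul G (ginv G (inv_into B (grng G) (grng G \<eta>))) \<eta>) else 0)"
    "\<And>\<gamma> \<eta>. Rep_ell2 (op_apply S (delta \<gamma>)) \<eta> = rep_coord (indicator B) \<gamma> \<eta>"
    using regular_rep_bisection[OF iB B] by force
  have T: "T = S" unfolding T_def by (rule regular_rep_eqI[OF iB S(2)])
  show "Rep_ell2 (op_apply (T * unit_ind G Z * op_adj T) (delta \<gamma>)) \<eta>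
      = Rep_ell2 (op_apply (unit_ind G (grng G ` B)) (delta \<gamma>)) \<eta>"
  proof (cases "\<eta> \<in> arrows G \<and> grng G \<eta> \<in> grng G ` B")
    case True
    then have \<eta>: "\<eta> \<in> arrows G" "grng G \<eta> \<in> grng G ` B" by auto
    note s = bisection_section[OF B \<eta>]
    define \<zeta> where "\<zeta> = gmul G (ginv G ?\<beta>) \<eta>"
    have \<zeta>: "\<zeta> \<in> arrows G" "grng G \<zeta> = gsrc G ?\<beta>" "gsrc G \<zeta> = gsrc G \<eta>"
      using s \<eta> by (simp_all add: \<zeta>_def arrow_simps)
    have \<beta>\<zeta>: "gmul G ?\<beta> \<zeta> = \<eta>" unfolding \<zeta>_def by (rule mul_inv_cancel_left) (use s \<eta> in auto)
    have "Rep_ell2 (op_apply (T * unit_ind G Z * op_adj T) (delta \<gamma>)) \<eta>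
        = Rep_ell2 (op_apply (op_adj S) (delta \<gamma>)) \<zeta>"
      using \<eta> s(1) \<zeta> BZ[OF s(1)]
      by (simp add: op_apply_times T S(1) unit_ind_apply[OF Z] flip: \<zeta>_def)
    also have "\<dots> = cnj (rep_coord (indicator B) \<zeta> \<gamma>)" by (simp add: op_adj_delta S(2))
    also have "\<dots> = (if \<eta> = \<gamma> then 1 else 0)"
    proof (cases "\<eta> = \<gamma>")
      case True
      have "gmul G (gmul G ?\<beta> \<zeta>) (ginv G \<zeta>) = ?\<beta>" by (rule mul_inv_cancel) (use s \<zeta> in auto)
      then have "gmul G \<eta> (ginv G \<zeta>) = ?\<beta>" unfolding \<beta>\<zeta> .
      then show ?thesis using \<zeta> \<eta> s True by (simp add: rep_coord_def)
    next
      case False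
      have "rep_coord (indicator B) \<zeta> \<gamma> = 0"
      proof (rule ccontr)
        assume "rep_coord (indicator B) \<zeta> \<gamma> \<noteq> 0"
        then have g: "\<gamma> \<in> arrows G" "gsrc G \<gamma> = gsrc G \<zeta>" "gmul G \<gamma> (ginv G \<zeta>) \<in> B"
          by (auto simp: rep_coord_def indicator_def split: if_splits)
        have "gsrc G (gmul G \<gamma> (ginv G \<zeta>)) = gsrc G ?\<beta>" using g \<zeta> by (simp add: arrow_simps)
        then have e: "gmul G \<gamma> (ginv G \<zeta>) = ?\<beta>" using inj_onD[OF BD(4) _ g(3) s(1)] by blast
        have "gmul G (gmul G \<gamma> (ginv G \<zeta>)) \<zeta> = \<gamma>" by (rule mul_inv_cancel_right) (use g \<zeta> in auto)
        then show False using False \<beta>\<zeta> unfolding e by simp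
      qed
      then show ?thesis using False by simp
    qed
    finally show ?thesis using True by (simp add: unit_ind_apply[OF BD(7)] ell2_coords)
  next
    case False
    then show ?thesis by (simp only: op_apply_times T S(1) unit_ind_apply[OF BD(7)] if_not_P[OF False] if_False)
  qed
qed

text \<open>The units covered by projections \<open>unit_ind G Z\<close> of the ideal form an open
  invariant set, nonempty because \<open>unit_ind G V\<close> factors through \<open>a\<close>.
  Minimality makes it everything, and compactness of \<open>U\<close> leaves finitely many
  \<open>Z\<close>.\<close>

lemma unit_ind_in_ideal_gen:
  assumes eff: "effective_groupoid G" and min: "minimal_groupoid G" and a: "a \<in> \<A>" "a \<noteq> 0"
    and U: "compact_open_units G U"
  shows "unit_ind G U \<in> ideal_gen \<A> a"
proof -
  note alg = cstar_subalgebraD[OF cstar_subalgebra_reduced]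
  let ?J = "ideal_gen \<A> a"
  have J: "w * z \<in> ?J" "z * w \<in> ?J" if "z \<in> ?J" "w \<in> \<A>" for z w
    using ideal_gen_mult[OF that(1) alg(4) that(2)] by auto
  obtain V w where V: "compact_open_units G V" "V \<noteq> {}" "w \<in> corner \<A> (unit_ind G V)"
    "w * w * (unit_ind G V * (op_adj a * a) * unit_ind G V) = unit_ind G V"
    using reduced_polar_ex[OF eff a] by blast
  have "0 + (w * w * unit_ind G V * op_adj a) * a * unit_ind G V \<in> ?J"
    by (intro ideal_gen.intros alg(4,5) unit_ind_in V a cornerD(1)[OF V(3)])
  then have VJ: "unit_ind G V \<in> ?J" using V(4) by (simp add: mult.assoc)
  define W where "W = {u. \<exists>Z. compact_open_units G Z \<and> u \<in> Z \<and> unit_ind G Z \<in> ?J}"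
  have "openin (gtop G) W"
    unfolding W_def by (subst openin_subopen) (auto simp: compact_open_units_iff)
  moreover have WG: "W \<subseteq> gunits G" by (auto simp: W_def compact_open_units_iff)
  moreover have step: "grng G \<gamma> \<in> W" if \<gamma>: "\<gamma> \<in> arrows G" "gsrc G \<gamma> \<in> W" for \<gamma>
  proof -
    obtain Z where Z: "compact_open_units G Z" "gsrc G \<gamma> \<in> Z" "unit_ind G Z \<in> ?J" using \<gamma> by (auto simp: W_def)
    have o: "openin (gtop G) {\<gamma> \<in> topspace (gtop G). gsrc G \<gamma> \<in> Z}"
      by (rule openin_continuous_map_preimage[OF continuous_src]) (use Z in \<open>simp add: compact_open_units_iff\<close>)
    have m: "\<gamma> \<in> {\<gamma> \<in> topspace (gtop G). gsrc G \<gamma> \<in> Z}" using \<gamma> Z by (simp add: arrows_def)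
    obtain B where B: "compact_open_bisection G B" "\<gamma> \<in> B" "B \<subseteq> {\<gamma> \<in> topspace (gtop G). gsrc G \<gamma> \<in> Z}"
      using ample_basis[OF o m] .
    note BD = compact_open_bisectionD[OF B(1)]
    have "regular_rep G (indicator B) \<in> \<A>" by (intro regular_rep_in Cc_indicator BD)
    then have "regular_rep G (indicator B) * unit_ind G Z * op_adj (regular_rep G (indicator B)) \<in> ?J"
      by (intro J Z alg(5))
    moreover have "regular_rep G (indicator B) * unit_ind G Z * op_adj (regular_rep G (indicator B)) = unit_ind G (grng G ` B)"
      by (rule unit_ind_translate[OF B(1) Z(1)]) (use B(3) in auto)
    ultimately show ?thesis using BD(7) B(2) unfolding W_def by auto
  qed
  moreover have "gsrc G \<gamma> \<in> W" if \<gamma>: "\<gamma> \<in> arrows G" "grng G \<gamma> \<in> W" for \<gamma>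
    using step[of "ginv G \<gamma>"] \<gamma> by (simp add: arrow_simps)
  ultimately have "W = {} \<or> W = gunits G"
    using min unfolding minimal_groupoid_def invariant_def openin_units_top_iff by blast
  moreover have "V \<subseteq> W" using V VJ by (auto simp: W_def)
  ultimately have WU: "W = gunits G" using V(2) by blast
  have fin: "\<exists>Z. compact_open_units G Z \<and> \<Union>\<F> \<subseteq> Z \<and> unit_ind G Z \<in> ?J"
    if "finite \<F>" "\<forall>Z\<in>\<F>. compact_open_units G Z \<and> unit_ind G Z \<in> ?J" for \<F>
    using that
  proof (induction \<F> rule: finite_induct)
    case empty
    show ?case by (rule exI[of _ "{}"]) (simp add: compact_open_units_empty unit_ind_empty ideal_gen.zero)
  next
    case (insert Y \<F>)
    then obtain Z where Z: "compact_open_units G Z" "\<Union>\<F> \<subseteq> Z" "unit_ind G Z \<in> ?J" by auto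
    have Y: "compact_open_units G Y" "unit_ind G Y \<in> ?J" using insert.prems by auto
    \<comment> \<open>Inclusion-exclusion for the union; the minus sign goes into the multiplier
      \<open>0 - unit_ind G Y\<close>, so that only sums and multiplication of ideal elements
      occur.\<close>
    have "unit_ind G Y + (unit_ind G Z + (0 - unit_ind G Y) * unit_ind G Z) \<in> ?J"
      by (intro ideal_gen_add J Y Z alg(1,3) unit_ind_in)
    moreover have "unit_ind G Y + (unit_ind G Z + (0 - unit_ind G Y) * unit_ind G Z) = unit_ind G (Y \<union> Z)"
      by (simp add: unit_ind_Un[OF Y(1) Z(1)] algebra_simps)
    ultimately have "unit_ind G (Y \<union> Z) \<in> ?J" by simp
    then show ?case using compact_open_units_Un[OF Y(1) Z(1)] Z(2) by (intro exI[of _ "Y \<union> Z"]) auto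
  qed
  let ?\<U> = "{Z. compact_open_units G Z \<and> unit_ind G Z \<in> ?J}"
  have "U \<subseteq> \<Union>?\<U>" using U WU by (auto simp: W_def compact_open_units_iff)
  moreover have "\<forall>Z\<in>?\<U>. openin (gtop G) Z" by (auto simp: compact_open_units_iff)
  moreover have "compactin (gtop G) U" using U by (simp add: compact_open_units_iff)
  ultimately obtain \<F> where \<F>: "finite \<F>" "\<F> \<subseteq> ?\<U>" "U \<subseteq> \<Union>\<F>" unfolding compactin_def by meson
  then have "\<forall>Z\<in>\<F>. compact_open_units G Z \<and> unit_ind G Z \<in> ?J" by auto
  from fin[OF \<F>(1) this]
  obtain Z where Z: "compact_open_units G Z" "\<Union>\<F> \<subseteq> Z" "unit_ind G Z \<in> ?J" by (elim exE conjE)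
  \<comment> \<open>\<open>Z\<close> may exceed \<open>U\<close>; multiplication by
    \<open>unit_ind G U\<close> cuts it down within the ideal.\<close>
  have "U \<inter> Z = U" using \<F>(3) Z(2) by blast
  then have "unit_ind G U * unit_ind G Z = unit_ind G U" using unit_ind_mult[OF U Z(1)] by simp
  then show ?thesis using J(1)[OF Z(3) unit_ind_in[OF U]] by simp
qed

text \<open>Local units: the ranges of a compact support lie in a compact open set of units. Thus an
  ideal containing every \<open>unit_ind G U\<close> contains the dense image of
  \<open>Cc G\<close>.\<close>

lemma unit_ind_regular_rep:
  assumes f: "f \<in> Cc G"
  shows "\<exists>U. compact_open_units G U \<and> unit_ind G U * regular_rep G f = regular_rep G f"
proof -
  obtain K where K: "compactin (gtop G) K" "\<And>\<gamma>. \<gamma> \<notin> K \<Longrightarrow> f \<gamma> = 0" using f by (auto simp: Cc_iff)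
  have "grng G ` K \<subseteq> gunits G" using compactin_subset_topspace[OF K(1)] rng_unit by (auto simp: arrows_def)
  then obtain \<B> where \<B>: "finite \<B>" "\<And>B. B \<in> \<B> \<Longrightarrow> compact_open_bisection G B \<and> B \<subseteq> gunits G" "grng G ` K \<subseteq> \<Union>\<B>"
    using compact_bisection_cover[OF image_compactin[OF K(1) continuous_rng] openin_units] by metis
  have U: "compact_open_units G (\<Union>\<B>)"
    unfolding compact_open_units_iff using \<B>(1,2) compact_open_bisectionD
    by (auto intro!: openin_Union compactin_Union)
  have "unit_ind G (\<Union>\<B>) * regular_rep G f = regular_rep G f"
  proof (rule op_eqI_delta, rule ell2_eqI)
    fix \<gamma> \<eta>
    have "rep_coord f \<gamma> \<eta> = 0" if "\<not> (\<eta> \<in> arrows G \<and> grng G \<eta> \<in> \<Union>\<B>)"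
    proof (rule ccontr)
      assume "rep_coord f \<gamma> \<eta> \<noteq> 0"
      then have a: "\<gamma> \<in> arrows G" "\<eta> \<in> arrows G" "gsrc G \<eta> = gsrc G \<gamma>" "gmul G \<eta> (ginv G \<gamma>) \<in> K"
        using K(2) by (auto simp: rep_coord_def split: if_splits)
      have "grng G (gmul G \<eta> (ginv G \<gamma>)) = grng G \<eta>" using a by (simp add: arrow_simps)
      then have "grng G \<eta> \<in> \<Union>\<B>" using a(4) \<B>(3) by (metis imageI subsetD)
      then show False using that a(2) by blast
    qed
    then show "Rep_ell2 (op_apply (unit_ind G (\<Union>\<B>) * regular_rep G f) (delta \<gamma>)) \<eta>
        = Rep_ell2 (op_apply (regular_rep G f) (delta \<gamma>)) \<eta>"
      by (simp only: op_apply_times unit_ind_apply[OF U] regular_rep_coord[OF f] split: if_split) simp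
  qed
  then show ?thesis using U by blast
qed

lemma cstar_simple_reduced:
  assumes eff: "effective_groupoid G" and min: "minimal_groupoid G"
  shows "cstar_simple \<A>"
  unfolding cstar_simple_def
proof (intro allI impI)
  fix I assume I: "closed_ideal I \<A>"
  have I': "0 \<in> I" "I \<subseteq> \<A>" "closed I" "\<And>x y. x \<in> I \<Longrightarrow> y \<in> I \<Longrightarrow> x + y \<in> I"
    "\<And>a x. a \<in> \<A> \<Longrightarrow> x \<in> I \<Longrightarrow> a * x \<in> I" "\<And>a x. a \<in> \<A> \<Longrightarrow> x \<in> I \<Longrightarrow> x * a \<in> I"
    using I by (auto simp: closed_ideal_def complex_subspace_def)
  show "I = {0} \<or> I = \<A>"
  proof (cases "I = {0}")
    case False
    then obtain a where a: "a \<in> I" "a \<noteq> 0" using I'(1) by blast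
    have J: "z \<in> I" if "z \<in> ideal_gen \<A> a" for z
      using that by induction (use I' a in auto)
    have "regular_rep G ` Cc G \<subseteq> I"
    proof (rule image_subsetI)
      fix f assume f: "f \<in> Cc G"
      obtain U where U: "compact_open_units G U" "unit_ind G U * regular_rep G f = regular_rep G f"
        using unit_ind_regular_rep[OF f] by blast
      have "unit_ind G U \<in> I" using unit_ind_in_ideal_gen[OF eff min _ a(2) U(1)] a(1) I'(2) J by blast
      then show "regular_rep G f \<in> I" using I'(6)[OF regular_rep_in[OF f]] U(2) by metis
    qed
    then have "\<A> \<subseteq> I" unfolding reduced_cstar_def using I'(3) by (rule closure_minimal)
    then show ?thesis using I'(2) by blast
  qed simp
qed

section \<open>The algebra \<open>B_alg G\<close> and the two implications\<close>

lemma B_alg_iff: "x \<in> B_alg G \<longleftrightarrow> (\<exists>y U. y \<in> \<A> \<and> compact_open_units G U \<and> x = unit_ind G U * y * unit_ind G U)"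
  by (auto simp: B_alg_def)

lemma zero_in_B_alg: "0 \<in> B_alg G"
  unfolding B_alg_iff
  by (intro exI[of _ 0] exI[of _ "{}"])
    (simp add: compact_open_units_empty cstar_subalgebraD(1)[OF cstar_subalgebra_reduced])

lemma B_alg_subset: "B_alg G \<subseteq> \<A>"
  unfolding B_alg_def by (auto intro!: cstar_subalgebraD(4)[OF cstar_subalgebra_reduced] unit_ind_in)

text \<open>A nonzero \<open>d\<close> in \<open>D\<close> gives the partial isometry
  \<open>d * w\<close> from \<open>unit_ind G V\<close> to a projection in \<open>D\<close>, so a
  proper isometry in the corner of \<open>unit_ind G V\<close> suffices.\<close>

lemma purely_infinite_of_properly_infinite:
  assumes eff: "effective_groupoid G" and min: "minimal_groupoid G"
    and pi: "alg_properly_infinite (B_alg G)"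
  shows "cstar_purely_infinite_simple \<A>"
  unfolding cstar_purely_infinite_simple_def
proof (intro conjI allI impI)
  fix D assume D: "hereditary D \<A> \<and> D \<noteq> {0}"
  note A = cstar_subalgebra_reduced
  have Dalg: "cstar_subalgebra D \<A>" using D by (simp add: hereditary_def)
  then obtain d where d: "d \<in> D" "d \<noteq> 0" using D cstar_subalgebraD(1)[OF Dalg] by blast
  then have dA: "d \<in> \<A>" using cstar_subalgebraD(8)[OF Dalg] by blast
  obtain V w where V: "compact_open_units G V" "V \<noteq> {}" "w \<in> corner \<A> (unit_ind G V)"
    "op_adj (d * w) * (d * w) = unit_ind G V"
    using reduced_polar_ex[OF eff dA d(2)] by blast
  define p where "p = unit_ind G V"
  have p: "p \<in> \<A>" "op_adj p = p" "p * p = p" "p \<noteq> 0"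
    using V by (auto simp: p_def unit_ind_in unit_ind_adj unit_ind_idem unit_ind_nonzero)
  have "p \<in> B_alg G"
    unfolding B_alg_iff using p V(1) by (intro exI[of _ p] exI[of _ V]) (simp add: p_def)
  then have "alg_properly_infinite_elem (B_alg G) p" using pi p(4) by (auto simp: alg_properly_infinite_def)
  then obtain x y where xy: "\<forall>k<2::nat. x k \<in> B_alg G \<and> y k \<in> B_alg G"
    "\<forall>k<2. \<forall>l<2. x k * p * y l = (if k = l then p else 0)"
    unfolding alg_properly_infinite_elem_iff[OF zero_in_B_alg] by blast
  have "x 0 \<in> \<A>" "x 1 \<in> \<A>" "y 0 \<in> \<A>" using xy(1) B_alg_subset by auto
  \<comment> \<open>\<open>y 0\<close> has a left inverse from \<open>x 0\<close> and is killed by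
    \<open>x 1 * p\<close>, which is nonzero because of \<open>y 1\<close>.\<close>
  moreover have "x 0 * p * y 0 = p" "x 1 * p * y 0 = 0" "x 1 * p * y 1 = p" using xy(2) by auto
  ultimately obtain s where s: "s \<in> corner \<A> p" "op_adj s * s = p" "s * op_adj s \<noteq> p"
    using nonunitary_isometry_ex[OF A p, of "x 0" "x 1" "y 0" "y 1"] by blast
  have wA: "w \<in> \<A>" using cornerD(1)[OF V(3)] .
  have "infinite_projection \<A> (d * w * op_adj (d * w))"
    by (rule infinite_projection_transport[OF A p(2,3) _ _ s])
      (use V(4) cstar_subalgebraD(4)[OF A dA wA] in \<open>simp_all only: p_def\<close>)
  moreover have "d * w * op_adj (d * w) \<in> D" using hereditary_conjugate[OF A _ d(1) wA] D by blast
  ultimately show "\<exists>p\<in>D. infinite_projection \<A> p" by blast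
qed (rule cstar_simple_reduced[OF eff min])

text \<open>The infinite projection \<open>q\<close> is taken in the corner of
  \<open>unit_ind G V\<close>, so \<open>c * a * q = q\<close> and two copies of \<open>u\<close>
  pass through \<open>a\<close>; multiplying by \<open>a\<close> on the left turns them into copies
  of \<open>a\<close>.\<close>

lemma properly_infinite_of_purely_infinite:
  assumes eff: "effective_groupoid G" and min: "minimal_groupoid G"
    and pi: "cstar_purely_infinite_simple \<A>"
  shows "alg_properly_infinite (B_alg G)"
  unfolding alg_properly_infinite_def
proof (intro ballI impI)
  fix a assume a: "a \<in> B_alg G" "a \<noteq> 0"
  note A = cstar_subalgebra_reduced
  note alg = cstar_subalgebraD(4,5)[OF A]
  have aA: "a \<in> \<A>" using a(1) B_alg_subset by blast
  obtain z U where U: "compact_open_units G U" "a = unit_ind G U * z * unit_ind G U"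
    using a(1) unfolding B_alg_iff by blast
  define u where "u = unit_ind G U"
  have u: "u \<in> \<A>" "u * u = u" using U by (auto simp: u_def unit_ind_in unit_ind_idem)
  have ua: "u * a = a" "a * u = a"
    unfolding U(2) u_def[symmetric] using u(2) by (simp_all add: mult.assoc) (simp flip: mult.assoc)
  obtain V w where V: "compact_open_units G V" "V \<noteq> {}" "w \<in> corner \<A> (unit_ind G V)"
    "w * w * (unit_ind G V * (op_adj a * a) * unit_ind G V) = unit_ind G V"
    using reduced_polar_ex[OF eff aA a(2)] by blast
  define p where "p = unit_ind G V"
  have p: "p \<in> \<A>" "op_adj p = p" "p * p = p" "p \<noteq> 0"
    using V by (auto simp: p_def unit_ind_in unit_ind_adj unit_ind_idem unit_ind_nonzero)
  define c where "c = w * w * p * op_adj a"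
  have cA: "c \<in> \<A>" unfolding c_def by (intro alg p aA cornerD(1)[OF V(3)])
  have cap: "c * a * p = p" using V(4) by (simp add: c_def p_def mult.assoc)
  have "hereditary (corner \<A> p) \<A>" by (rule hereditary_corner[OF A p(2,3)])
  moreover have "p \<in> corner \<A> p" using p by (simp add: corner_def)
  then have "corner \<A> p \<noteq> {0}" using p(4) by blast
  ultimately obtain q where q: "q \<in> corner \<A> p" "infinite_projection \<A> q"
    using pi unfolding cstar_purely_infinite_simple_def by blast
  have qA: "q \<in> \<A>" "p * q = q" using cornerD[OF q(1)] by auto
  have qq: "q * q = q" using q(2) by (simp add: infinite_projection_def projection_def)
  obtain e f g where e: "e \<in> \<A>" "e \<noteq> 0"
    and fg: "\<forall>i::nat. f i \<in> \<A> \<and> f i * q = f i \<and> g i \<in> \<A> \<and> q * g i = g i"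
      "\<forall>i j. f i * g j = (if i = j then e else 0)"
    using infinite_projection_matrix_units[OF A q(2)] by blast
  \<comment> \<open>The ideal argument is applied to the defect projection \<open>e\<close> rather
    than to \<open>a\<close>: however small \<open>e\<close> is, finitely many copies of it produce
    \<open>u\<close>.\<close>
  have "u \<in> ideal_gen \<A> e" unfolding u_def by (rule unit_ind_in_ideal_gen[OF eff min e U(1)])
  then obtain X Y where XY: "\<forall>k<2::nat. X k \<in> \<A> \<and> Y k \<in> \<A>"
    "\<forall>k<2. \<forall>l<2. X k * q * Y l = (if k = l then u else 0)"
    using double_below_infinite_projection[OF A, of f q g e u] fg by blast
  \<comment> \<open>The flanking \<open>u\<close> put both families into \<open>B_alg G\<close>, the
    inner ones are absorbed by \<open>a\<close>, and the leading \<open>a\<close> turns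
    \<open>u\<close> back into \<open>a\<close>.\<close>
  define x where "x k = u * (a * X k * q * c) * u" for k
  define y where "y l = u * (p * q * Y l) * u" for l
  have "x k \<in> B_alg G \<and> y k \<in> B_alg G" if "k < 2" for k
  proof -
    have "a * X k * q * c \<in> \<A>" "p * q * Y k \<in> \<A>" using XY(1) that by (auto intro!: alg aA qA cA p)
    then show ?thesis unfolding B_alg_iff x_def y_def u_def using U(1) by blast
  qed
  moreover have "x k * a * y l = (if k = l then a else 0)" if "k < 2" "l < 2" for k l
  proof -
    have "x k * a * y l = (u * a) * X k * q * c * (u * (a * u)) * p * q * Y l * u"
      by (simp add: x_def y_def mult.assoc)
    also have "\<dots> = a * X k * q * (c * a * p) * q * Y l * u" unfolding ua by (simp add: mult.assoc ua)
    also have "\<dots> = a * X k * q * (p * q) * Y l * u" unfolding cap by (simp add: mult.assoc)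
    also have "\<dots> = a * X k * (q * q) * Y l * u" unfolding qA(2) by (simp add: mult.assoc)
    also have "\<dots> = a * (X k * q * Y l) * u" unfolding qq by (simp add: mult.assoc)
    also have "\<dots> = (if k = l then a else 0)" using XY(2) that by (simp add: ua mult.assoc u(2))
    finally show ?thesis .
  qed
  ultimately show "alg_properly_infinite_elem (B_alg G) a"
    unfolding alg_properly_infinite_elem_iff[OF zero_in_B_alg] using a by blast
qed

end

theorem theorem4p7:
  fixes G :: "'g groupoid"
  assumes "ample G"
    and "Hausdorff_space (gtop G)"
    and "second_countable (gtop G)"
    and "minimal_groupoid G"
    and "effective_groupoid G"
  shows "alg_properly_infinite (B_alg G) \<longleftrightarrow> cstar_purely_infinite_simple (reduced_cstar G)"
proof -
  interpret ample_hausdorff_groupoid G by unfold_locales (rule assms)+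
  show ?thesis
    using purely_infinite_of_properly_infinite properly_infinite_of_purely_infinite assms(4,5) by blast
qed

end
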